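(* Let $p>0$ be a real number that is not an even integer. Let $D_1$ and $D_2$ be $A^p$-complete bounded domains in $\mathbb{C}^n$, and let $T:A^p(D_1)\to A^p(D_2)$ be a linear isometry. Put $\phi_0:=T^{-1}(1)\in A^p(D_1)$, $A_1:=\phi_0^{-1}(0)\subset D_1$ and $A_2:=(T(1))^{-1}(0)\subset D_2$. Let $D_1'\subset D_1$, $D_2'\subset D_2$ and the bijection $F:D_1'\to D_2'$ be the sets and map associated to $T$ (defined in the context). Then: (1) $D_1'=D_1\setminus A_1$ and $D_2'=D_2\setminus A_2$; (2) $F:D_1\setminus A_1\to D_2\setminus A_2$ is a biholomorphic map; (3) $|J_{F_1}(z)|^{2/p}=|\phi_0(z)|$ for $z\in D_1$, and $|J_{F_2}(w)|^{2/p}=|T(1)(w)|$ for $w\in D_2$; (4) $F_1(A_1)\subset\partial D_2$ and $F_2(A_2)\subset\partial D_1$. Here $F_1:D_1\to\mathbb{C}^n$ and $F_2:D_2\to\mathbb{C}^n$ denote the holomorphic extensions of $F:D_1\setminus A_1\to D_2$ and $F^{-1}:D_2\setminus A_2\to D_1$, respectively (given by Riemann's removable singularity theorem).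
   Context: For a bounded domain $D\subset\mathbb{C}^n$ and $p>0$, $A^p(D)$ denotes the space of holomorphic functions $\phi$ on $D$ with $\|\phi\|_p:=\left(\int_D|\phi|^p\,d\lambda_n\right)^{1/p}<\infty$, where $d\lambda_n$ is Lebesgue measure on $\mathbb{C}^n$ (the same notation is used for any domain in $\mathbb{C}^n$). A linear isometry $T:A^p(D_1)\to A^p(D_2)$ is a linear isomorphism (in particular a bijection) with $\|T\phi\|_p=\|\phi\|_p$ for all $\phi\in A^p(D_1)$. A bounded domain $D\subset\mathbb{C}^n$ is $A^p$-complete if there does not exist a domain $\tilde D\subset\mathbb{C}^n$ with $D\subsetneqq\tilde D$ such that the restriction map $A^p(\tilde D)\to A^p(D)$ is a linear isometry. Sets and map associated to $T$: for $z\in D$ let $H_{D,z}:=\{\phi\in A^p(D):\phi(z)=0\}$; since $D$ is bounded, $A^p(D)$ separates points and $z$ is determined by $H_{D,z}$. Define $D_1'$ as the set of $z\in D_1$ for which there is $w\in D_2$ with $T(H_{D_1,z})=H_{D_2,w}$, and $D_2'$ as the set of $w\in D_2$ for which there is $z\in D_1$ with $T(H_{D_1,z})=H_{D_2,w}$. The map $F:D_1'\to D_2'$ is the bijection with $F(z)=w$ if and only if $T(H_{D_1,z})=H_{D_2,w}$. $J_G$ denotes the holomorphic Jacobian determinant of a holomorphic map $G$. The constant function $1$ lies in $A^p(D_j)$ since $D_j$ is bounded. *)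

theory Defs
  imports "HOL-Analysis.Analysis"
begin

definition is_domain :: "(complex^'n) set \<Rightarrow> bool" where
  "is_domain D \<longleftrightarrow> open D \<and> connected D \<and> D \<noteq> {}"

text \<open>Intended for open \<open>D\<close>: real Frechet differentiability with a \<open>\<complex>\<close>-linear derivative
  (additivity is part of \<open>has_derivative\<close>).\<close>

definition holomorphic_cn_on :: "(complex^'n \<Rightarrow> complex) \<Rightarrow> (complex^'n) set \<Rightarrow> bool" where
  "holomorphic_cn_on f D \<longleftrightarrow>
     (\<forall>z\<in>D. \<exists>f'. (f has_derivative f') (at z) \<and> (\<forall>c v. f' (c *s v) = c * f' v))"

definition holomorphic_map_on :: "(complex^'n \<Rightarrow> complex^'m) \<Rightarrow> (complex^'n) set \<Rightarrow> bool" where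
  "holomorphic_map_on G D \<longleftrightarrow> (\<forall>i. holomorphic_cn_on (\<lambda>z. G z $ i) D)"

definition biholomorphic_map ::
    "(complex^'n \<Rightarrow> complex^'m) \<Rightarrow> (complex^'n) set \<Rightarrow> (complex^'m) set \<Rightarrow> bool" where
  "biholomorphic_map G U V \<longleftrightarrow>
     bij_betw G U V \<and> holomorphic_map_on G U \<and> holomorphic_map_on (inv_into U G) V"

definition holomorphic_extension ::
    "(complex^'n \<Rightarrow> complex^'m) \<Rightarrow> (complex^'n) set \<Rightarrow> (complex^'n \<Rightarrow> complex^'m)
      \<Rightarrow> (complex^'n) set \<Rightarrow> bool" where
  "holomorphic_extension G D F U \<longleftrightarrow> holomorphic_map_on G D \<and> (\<forall>z\<in>U. G z = F z)"

text \<open>Where \<open>G\<close> is holomorphic, the derivative is \<open>\<complex>\<close>-linear and its matrix over \<open>\<complex>\<close> has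
  the entries \<open>\<partial>G\<^sub>i / \<partial>z\<^sub>j\<close>; this is the complex determinant, not that of the real derivative.\<close>

definition holomorphic_jacobian :: "(complex^'n \<Rightarrow> complex^'n) \<Rightarrow> complex^'n \<Rightarrow> complex" where
  "holomorphic_jacobian G z = det (matrix (frechet_derivative G (at z)))"


text \<open>A function on \<open>D\<close> is represented by its extension by zero, so that equality of elements
  of \<open>A\<^sup>p(D)\<close> is equality of functions on \<open>D\<close>.\<close>

definition extend_zero :: "(complex^'n) set \<Rightarrow> (complex^'n \<Rightarrow> complex) \<Rightarrow> complex^'n \<Rightarrow> complex" where
  "extend_zero D \<phi> = (\<lambda>z. if z \<in> D then \<phi> z else 0)"

definition Ap :: "real \<Rightarrow> (complex^'n) set \<Rightarrow> (complex^'n \<Rightarrow> complex) set" where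
  "Ap p D = {\<phi>. holomorphic_cn_on \<phi> D \<and> (\<forall>z. z \<notin> D \<longrightarrow> \<phi> z = 0)
               \<and> set_integrable lborel D (\<lambda>z. norm (\<phi> z) powr p)}"

definition Ap_norm :: "real \<Rightarrow> (complex^'n) set \<Rightarrow> (complex^'n \<Rightarrow> complex) \<Rightarrow> real" where
  "Ap_norm p D \<phi> = (LINT z:D|lborel. norm (\<phi> z) powr p) powr (1 / p)"

definition Ap_linear_isometry ::
    "real \<Rightarrow> (complex^'n) set \<Rightarrow> (complex^'m) set
      \<Rightarrow> ((complex^'n \<Rightarrow> complex) \<Rightarrow> (complex^'m \<Rightarrow> complex)) \<Rightarrow> bool" where
  "Ap_linear_isometry p D1 D2 T \<longleftrightarrow>
     bij_betw T (Ap p D1) (Ap p D2)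
     \<and> (\<forall>\<phi>\<in>Ap p D1. \<forall>\<psi>\<in>Ap p D1. T (\<lambda>z. \<phi> z + \<psi> z) = (\<lambda>w. T \<phi> w + T \<psi> w))
     \<and> (\<forall>c. \<forall>\<phi>\<in>Ap p D1. T (\<lambda>z. c * \<phi> z) = (\<lambda>w. c * T \<phi> w))
     \<and> (\<forall>\<phi>\<in>Ap p D1. Ap_norm p D2 (T \<phi>) = Ap_norm p D1 \<phi>)"

text \<open>For \<open>D \<subseteq> E\<close>, \<open>extend_zero D\<close> represents the restriction map \<open>A\<^sup>p(E) \<rightarrow> A\<^sup>p(D)\<close>.
  The larger domain is not required to be bounded.\<close>

definition Ap_complete :: "real \<Rightarrow> (complex^'n) set \<Rightarrow> bool" where
  "Ap_complete p D \<longleftrightarrow>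
     \<not> (\<exists>E. is_domain E \<and> D \<subset> E \<and> Ap_linear_isometry p E D (extend_zero D))"

abbreviation Ap_one :: "(complex^'n) set \<Rightarrow> complex^'n \<Rightarrow> complex" where
  "Ap_one D \<equiv> extend_zero D (\<lambda>_. 1)"


definition Ap_vanishing :: "real \<Rightarrow> (complex^'n) set \<Rightarrow> complex^'n \<Rightarrow> (complex^'n \<Rightarrow> complex) set" where
  "Ap_vanishing p D z = {\<phi> \<in> Ap p D. \<phi> z = 0}"

definition assoc_source where
  "assoc_source p D1 D2 T = {z \<in> D1. \<exists>w\<in>D2. T ` Ap_vanishing p D1 z = Ap_vanishing p D2 w}"

definition assoc_target where
  "assoc_target p D1 D2 T = {w \<in> D2. \<exists>z\<in>D1. T ` Ap_vanishing p D1 z = Ap_vanishing p D2 w}"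

definition assoc_map where
  "assoc_map p D1 D2 T z = (THE w. w \<in> D2 \<and> T ` Ap_vanishing p D1 z = Ap_vanishing p D2 w)"

text \<open>On bounded domains the description above does define a bijection.\<close>

lemma bounded_in_Ap:
  fixes D :: "(complex^'n) set"
  assumes "open D" "bounded D" "p > 0" "holomorphic_cn_on f UNIV"
    and bd: "\<And>z. z \<in> D \<Longrightarrow> norm (f z) \<le> B"
  shows "extend_zero D f \<in> Ap p D"
proof -
  have eq: "extend_zero D f z = f z" if "z \<in> D" for z using that by (simp add: extend_zero_def)
  have "holomorphic_cn_on (extend_zero D f) D"
    unfolding holomorphic_cn_on_def
  proof
    fix z assume z: "z \<in> D"
    obtain f' where f': "(f has_derivative f') (at z)" "\<forall>c v. f' (c *s v) = c * f' v"
      using assms(4) unfolding holomorphic_cn_on_def by blast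
    have "(extend_zero D f has_derivative f') (at z)"
      by (rule has_derivative_transform_within_open[OF f'(1) \<open>open D\<close> z]) (simp add: eq)
    then show "\<exists>f'. (extend_zero D f has_derivative f') (at z) \<and> (\<forall>c v. f' (c *s v) = c * f' v)"
      using f'(2) by blast
  qed
  moreover have "set_integrable lborel D (\<lambda>z. norm (extend_zero D f z) powr p)"
  proof -
    have "continuous_on UNIV f"
      using assms(4) unfolding holomorphic_cn_on_def
      by (meson continuous_at_imp_continuous_on has_derivative_continuous)
    then have m: "f \<in> borel_measurable borel" by (rule borel_measurable_continuous_onI)
    have D: "D \<in> sets borel" using \<open>open D\<close> by simp
    have fin: "emeasure lborel D < \<infinity>" using emeasure_bounded_finite[OF \<open>bounded D\<close>] by simp
    have "set_integrable lborel D (\<lambda>z. norm (f z) powr p)"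
      unfolding set_integrable_def
    proof (rule Bochner_Integration.integrable_bound)
      show "integrable lborel (\<lambda>z. indicator D z *\<^sub>R (B powr p))"
        using D fin by simp
      show "(\<lambda>z. indicator D z *\<^sub>R (norm (f z) powr p)) \<in> borel_measurable lborel"
        using m D by simp
      show "AE z in lborel. norm (indicator D z *\<^sub>R (norm (f z) powr p))
              \<le> norm (indicator D z *\<^sub>R (B powr p))"
        using bd \<open>p > 0\<close> by (auto simp: indicator_def intro!: AE_I2 powr_mono2)
    qed
    then show ?thesis
      unfolding set_integrable_def
      by (rule back_subst[of "integrable lborel"]) (auto simp: fun_eq_iff indicator_def eq)
  qed
  ultimately show ?thesis by (auto simp: Ap_def extend_zero_def)
qed

lemma Ap_vanishing_inj:
  fixes D :: "(complex^'n) set"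
  assumes "open D" "bounded D" "p > 0" "z \<in> D" "w \<in> D"
    and eq: "Ap_vanishing p D z = Ap_vanishing p D w"
  shows "z = w"
proof -
  have "z $ i = w $ i" for i
  proof -
    let ?f = "\<lambda>x::complex^'n. x $ i - z $ i"
    have h: "holomorphic_cn_on ?f UNIV"
      unfolding holomorphic_cn_on_def
    proof
      fix x :: "complex^'n"
      have "(?f has_derivative (\<lambda>h. h $ i)) (at x)"
        by (auto intro!: derivative_eq_intros bounded_linear_imp_has_derivative bounded_linear_vec_nth)
      then show "\<exists>f'. (?f has_derivative f') (at x) \<and> (\<forall>c v. f' (c *s v) = c * f' v)"
        by (intro exI[of _ "\<lambda>h. h $ i"]) simp
    qed
    obtain C where C: "\<And>x. x \<in> D \<Longrightarrow> norm x \<le> C"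
      using \<open>bounded D\<close> unfolding bounded_iff by blast
    have "norm (?f x) \<le> C + norm (z $ i)" if "x \<in> D" for x
      using norm_triangle_ineq4[of "x $ i" "z $ i"] C[OF that] Finite_Cartesian_Product.norm_nth_le[of x i]
      by linarith
    then have "extend_zero D ?f \<in> Ap p D"
      by (rule bounded_in_Ap[OF assms(1-3) h])
    then have "extend_zero D ?f \<in> Ap_vanishing p D z"
      by (simp add: Ap_vanishing_def extend_zero_def)
    then have "extend_zero D ?f w = 0" unfolding eq by (simp add: Ap_vanishing_def)
    then show ?thesis using \<open>w \<in> D\<close> by (simp add: extend_zero_def)
  qed
  then show ?thesis by (simp add: vec_eq_iff)
qed

lemma Ap_one_in_Ap:
  assumes "open D" "bounded D" "p > 0"
  shows "Ap_one D \<in> Ap p D"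
  by (rule bounded_in_Ap[OF assms, where B = 1])
     (auto simp: holomorphic_cn_on_def intro!: exI[of _ "\<lambda>_. 0"])

lemma assoc_map_iff:
  assumes "open D2" "bounded D2" "p > 0" "z \<in> assoc_source p D1 D2 T" "w \<in> D2"
  shows "assoc_map p D1 D2 T z = w \<longleftrightarrow> T ` Ap_vanishing p D1 z = Ap_vanishing p D2 w"
proof -
  obtain w' where w': "w' \<in> D2" "T ` Ap_vanishing p D1 z = Ap_vanishing p D2 w'"
    using assms(4) by (auto simp: assoc_source_def)
  have "assoc_map p D1 D2 T z = w'"
    unfolding assoc_map_def
    by (rule the_equality) (use w' Ap_vanishing_inj[OF assms(1-3)] in auto)
  then show ?thesis using w' Ap_vanishing_inj[OF assms(1-3)] assms(5) by metis
qed

lemma assoc_map_bij: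
  assumes "open D1" "bounded D1" "open D2" "bounded D2" "p > 0"
    and T: "Ap_linear_isometry p D1 D2 T"
  shows "bij_betw (assoc_map p D1 D2 T) (assoc_source p D1 D2 T) (assoc_target p D1 D2 T)"
proof -
  note iff = assoc_map_iff[OF assms(3,4,5), where T = T and ?D1.0 = D1]
  have injT: "inj_on T (Ap p D1)" using T by (simp add: Ap_linear_isometry_def bij_betw_def)
  have sub: "Ap_vanishing p D1 z \<subseteq> Ap p D1" for z by (auto simp: Ap_vanishing_def)
  have mem: "assoc_map p D1 D2 T z \<in> D2 \<and>
      T ` Ap_vanishing p D1 z = Ap_vanishing p D2 (assoc_map p D1 D2 T z)"
    if "z \<in> assoc_source p D1 D2 T" for z
    using that iff[OF that] by (auto simp: assoc_source_def)
  show ?thesis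
  proof (rule bij_betw_imageI)
    show "inj_on (assoc_map p D1 D2 T) (assoc_source p D1 D2 T)"
    proof (rule inj_onI)
      fix x y assume x: "x \<in> assoc_source p D1 D2 T" and y: "y \<in> assoc_source p D1 D2 T"
        and "assoc_map p D1 D2 T x = assoc_map p D1 D2 T y"
      then have "T ` Ap_vanishing p D1 x = T ` Ap_vanishing p D1 y" using mem by metis
      then have "Ap_vanishing p D1 x = Ap_vanishing p D1 y"
        using inj_on_image_eq_iff[OF injT sub sub] by blast
      then show "x = y"
        using Ap_vanishing_inj[OF assms(1,2,5)] x y by (auto simp: assoc_source_def)
    qed
    show "assoc_map p D1 D2 T ` assoc_source p D1 D2 T = assoc_target p D1 D2 T"
    proof
      show "assoc_map p D1 D2 T ` assoc_source p D1 D2 T \<subseteq> assoc_target p D1 D2 T"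
        using mem by (auto simp: assoc_target_def assoc_source_def)
      show "assoc_target p D1 D2 T \<subseteq> assoc_map p D1 D2 T ` assoc_source p D1 D2 T"
      proof
        fix w assume "w \<in> assoc_target p D1 D2 T"
        then obtain z where z: "z \<in> D1" "w \<in> D2" "T ` Ap_vanishing p D1 z = Ap_vanishing p D2 w"
          by (auto simp: assoc_target_def)
        then have zs: "z \<in> assoc_source p D1 D2 T" by (auto simp: assoc_source_def)
        then have "assoc_map p D1 D2 T z = w" using iff[OF zs z(2)] z(3) by blast
        then show "w \<in> assoc_map p D1 D2 T ` assoc_source p D1 D2 T" using zs by blast
      qed
    qed
  qed
qed

end

theory Submission
  imports
    Defs
    "HOL-Complex_Analysis.Residue_Theorem"
    "HOL-Probability.Distributions"
begin

text \<open>Write \<open>\<phi>\<^sub>0\<close> for the preimage of the constant function \<open>1\<close>. The isometry sees every linear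
combination \<open>s \<phi>\<^sub>0 + c\<^sub>1 \<phi>\<^sub>1 + ... + c\<^sub>m \<phi>\<^sub>m\<close>: with respect to the measure \<open>|\<phi>\<^sub>0|\<^sup>p d\<lambda>\<close> on
\<open>D\<^sub>1\<close> the function \<open>s + \<Sum> c\<^sub>k \<phi>\<^sub>k / \<phi>\<^sub>0\<close> has the same \<open>p\<close>-norm as \<open>s + \<Sum> c\<^sub>k T \<phi>\<^sub>k\<close> has with
respect to Lebesgue measure on \<open>D\<^sub>2\<close>. When \<open>p\<close> is not an even integer, these norms determine the
joint distribution of finitely many functions (theorem \<open>complex_affine_moments_determine_measure\<close>,
the equimeasurability principle of Plotkin and Rudin), so \<open>(\<phi>\<^sub>k / \<phi>\<^sub>0)\<close> and \<open>(T \<phi>\<^sub>k)\<close> have the same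
joint distribution (\<open>equimeasurable\<close>).

Taking for the \<open>T \<phi>\<^sub>k\<close> the coordinate functions of \<open>D\<^sub>2\<close> produces a holomorphic map
\<open>F = (\<phi>\<^sub>1 / \<phi>\<^sub>0, ..., \<phi>\<^sub>n / \<phi>\<^sub>0)\<close> off the zeros of \<open>\<phi>\<^sub>0\<close>; it carries \<open>|\<phi>\<^sub>0|\<^sup>p d\<lambda>\<close> to Lebesgue
measure on \<open>D\<^sub>2\<close>. Adjoining one more function \<open>\<phi>\<close> makes the pair \<open>(F, \<phi> / \<phi>\<^sub>0)\<close> live on the graph
of \<open>T \<phi>\<close>, hence \<open>\<phi> = \<phi>\<^sub>0 \<cdot> (T \<phi> \<circ> F)\<close> wherever \<open>F\<close> takes values in \<open>D\<^sub>2\<close>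
(\<open>T_weighted_composition\<close>). This formula shows that \<open>F\<close> is the map attached to \<open>T\<close>, that the map
built from the inverse of \<open>T\<close> is its inverse, and, by comparing volumes of small balls, that
\<open>|J\<^sub>F|\<^sup>2 = |\<phi>\<^sub>0|\<^sup>p\<close> (\<open>jacobian_eq_U\<close>). In particular \<open>F\<close> is a local biholomorphism off the zeros of
\<open>\<phi>\<^sub>0\<close>. If it left \<open>D\<^sub>2\<close> at such a point, a neighbourhood of the image could be added to \<open>D\<^sub>2\<close>:
the formula above continues every \<open>A\<^sup>p\<close> function to it, and only a null set is added, which
contradicts completeness (\<open>complete_imp_U_eq_G\<close>). At a zero of \<open>\<phi>\<^sub>0\<close> the extended map stays in the
closure of \<open>D\<^sub>2\<close>, but it cannot hit \<open>D\<^sub>2\<close>, because \<open>1 = \<phi>\<^sub>0 \<cdot> (T 1 \<circ> F)\<close> would persist there.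

Distributions are recovered from norms as follows. Averaging \<open>|\<langle>c, x - y\<rangle>|\<^sup>p\<close> over the unit ball of
\<open>c\<close> gives a multiple of \<open>|x - y|\<^sup>p\<close>, so it suffices to recover a finite measure from its Riesz
potentials. Up to a polynomial correction of degree below \<open>p\<close>, \<open>r\<^sup>p\<close> is a mixture of the
Gaussians \<open>exp (- t r\<^sup>2)\<close> with weights of one sign; for even \<open>p\<close> there is no such mixture, \<open>r\<^sup>p\<close> itself
being a polynomial in \<open>r\<^sup>2\<close>. Passing from a signed measure to a high order difference of it kills
the polynomials, and then a vanishing potential forces all Gaussian energies, which are
nonnegative, to vanish
(\<open>riesz_and_even_moments_zero_imp_gaussian_zero\<close>).\<close>

text \<open>The dollar sign always selects a component of a vector; the notation for coefficients of
formal power series would make every such term ambiguous.\<close>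

no_notation fps_nth (infixl "$" 75)

section \<open>Volume under complex linear maps\<close>

lemma nn_integral_lborel_shift:
  fixes a :: "'a::euclidean_space" and f :: "'a \<Rightarrow> ennreal"
  assumes [measurable]: "f \<in> borel_measurable borel"
  shows "(\<integral>\<^sup>+x. f (x + a) \<partial>lborel) = (\<integral>\<^sup>+x. f x \<partial>lborel)"
proof -
  have "(\<integral>\<^sup>+x. f x \<partial>lborel) = (\<integral>\<^sup>+x. f x \<partial>(distr lborel borel ((+) a)))"
    by (simp add: lborel_distr_plus)
  also have "\<dots> = (\<integral>\<^sup>+x. f (a + x) \<partial>lborel)"
    by (subst nn_integral_distr) auto
  finally show ?thesis by (simp add: add.commute)
qed

text \<open>The usual proof of uniqueness of Haar measure: for indicator functions \<open>f\<close> of \<open>B\<close> and \<open>g\<close> of the unit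
ball, the double integral of \<open>f (x + y) g y\<close> is evaluated in both orders, using that \<open>g\<close> is even.\<close>
lemma translation_invariant_measure_proportional:
  fixes \<mu> :: "'a::euclidean_space measure"
  assumes sets [measurable_cong]: "sets \<mu> = sets borel" and "sigma_finite_measure \<mu>"
    and inv: "\<And>a. distr \<mu> borel (\<lambda>x. x + a) = \<mu>"
    and [measurable]: "B \<in> sets borel"
  shows "emeasure \<mu> B * emeasure lborel (ball (0::'a) 1) = emeasure lborel B * emeasure \<mu> (ball 0 1)"
proof -
  interpret sigma_finite_measure \<mu> by fact
  interpret pair_sigma_finite lborel \<mu> ..
  have shift: "(\<integral>\<^sup>+x. f (x + a) \<partial>\<mu>) = (\<integral>\<^sup>+x. f x \<partial>\<mu>)" if [measurable]: "f \<in> borel_measurable borel" for f :: "'a \<Rightarrow> ennreal" and a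
  proof -
    have "(\<integral>\<^sup>+x. f x \<partial>\<mu>) = (\<integral>\<^sup>+x. f x \<partial>(distr \<mu> borel (\<lambda>x. x + a)))" by (simp add: inv)
    also have "\<dots> = (\<integral>\<^sup>+x. f (x + a) \<partial>\<mu>)"
      by (subst nn_integral_distr) auto
    finally show ?thesis by simp
  qed
  define g where "g = (indicator (ball (0::'a) 1) :: 'a \<Rightarrow> ennreal)"
  let ?f = "indicator B :: 'a \<Rightarrow> ennreal"
  have [measurable]: "g \<in> borel_measurable borel"
    unfolding g_def by (rule borel_measurable_indicator) simp
  have ig: "integral\<^sup>N lborel g = emeasure lborel (ball (0::'a) 1)" "integral\<^sup>N \<mu> g = emeasure \<mu> (ball (0::'a) 1)"
    unfolding g_def by (subst nn_integral_indicator; simp add: sets)+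
  have "emeasure \<mu> B * emeasure lborel (ball (0::'a) 1) = (\<integral>\<^sup>+y. g y * (\<integral>\<^sup>+x. ?f x \<partial>\<mu>) \<partial>lborel)"
    by (subst nn_integral_multc) (simp_all add: ig mult.commute)
  also have "\<dots> = (\<integral>\<^sup>+y. (\<integral>\<^sup>+x. g y * ?f (x + y) \<partial>\<mu>) \<partial>lborel)"
    by (subst nn_integral_cmult) (auto simp: shift)
  also have "\<dots> = (\<integral>\<^sup>+x. (\<integral>\<^sup>+y. g y * ?f (x + y) \<partial>lborel) \<partial>\<mu>)"
    by (rule Fubini'[symmetric]) measurable
  also have "\<dots> = (\<integral>\<^sup>+x. (\<integral>\<^sup>+y. g (y - x) * ?f y \<partial>lborel) \<partial>\<mu>)"
  proof (rule nn_integral_cong)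
    fix x
    have "(\<integral>\<^sup>+y. g ((y + x) - x) * ?f (y + x) \<partial>lborel) = (\<integral>\<^sup>+y. g (y - x) * ?f y \<partial>lborel)"
      by (rule nn_integral_lborel_shift[where f="\<lambda>y. g (y - x) * ?f y"]) measurable
    then show "(\<integral>\<^sup>+y. g y * ?f (x + y) \<partial>lborel) = (\<integral>\<^sup>+y. g (y - x) * ?f y \<partial>lborel)"
      by (simp add: add.commute)
  qed
  also have "\<dots> = (\<integral>\<^sup>+y. (\<integral>\<^sup>+x. g (y - x) * ?f y \<partial>\<mu>) \<partial>lborel)"
    by (rule Fubini') measurable
  also have "\<dots> = (\<integral>\<^sup>+y. emeasure \<mu> (ball 0 1) * ?f y \<partial>lborel)"
  proof (rule nn_integral_cong)
    fix y
    have "(\<integral>\<^sup>+x. g (y - x) \<partial>\<mu>) = (\<integral>\<^sup>+x. g (x + (- y)) \<partial>\<mu>)"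
      by (intro nn_integral_cong) (auto simp: g_def indicator_def norm_minus_commute)
    also have "\<dots> = (\<integral>\<^sup>+x. g x \<partial>\<mu>)" by (rule shift) measurable
    also have "\<dots> = emeasure \<mu> (ball 0 1)" by (simp add: ig)
    finally show "(\<integral>\<^sup>+x. g (y - x) * ?f y \<partial>\<mu>) = emeasure \<mu> (ball 0 1) * ?f y"
      by (subst nn_integral_multc) auto
  qed
  also have "\<dots> = emeasure lborel B * emeasure \<mu> (ball 0 1)"
    by (subst nn_integral_cmult) (auto simp: mult.commute)
  finally show ?thesis .
qed

text \<open>Phrased with preimages rather than images: they are Borel for every Borel map, and the
factors multiply under composition.\<close>
definition pulls_volume :: "('a::euclidean_space \<Rightarrow> 'a) \<Rightarrow> real \<Rightarrow> bool" where
  "pulls_volume f a \<longleftrightarrow> f \<in> borel_measurable borel \<and> a > 0 \<and>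
     (\<forall>B\<in>sets borel. emeasure lborel (f -` B) = ennreal a * emeasure lborel B)"

lemma emeasure_unit_ball_pos_finite:
  "0 < emeasure lborel (ball (0::'a::euclidean_space) 1)" "emeasure lborel (ball (0::'a::euclidean_space) 1) < \<infinity>"
proof -
  show "emeasure lborel (ball (0::'a::euclidean_space) 1) < \<infinity>"
    by (intro emeasure_bounded_finite) auto
  show "0 < emeasure lborel (ball (0::'a::euclidean_space) 1)"
    by (simp add: emeasure_ball unit_ball_vol_pos)
qed

lemma pulls_volume_compose:
  assumes "pulls_volume f a" "pulls_volume g b"
  shows "pulls_volume (f \<circ> g) (a * b)"
proof -
  have [measurable]: "f \<in> borel_measurable borel" "g \<in> borel_measurable borel"
    using assms by (auto simp: pulls_volume_def)
  have "emeasure lborel ((f \<circ> g) -` B) = ennreal (a * b) * emeasure lborel B" if B: "B \<in> sets borel" for B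
  proof -
    have "f -` B \<in> sets borel"
      using measurable_sets[of f borel borel B] B by simp
    then show ?thesis
      using assms B by (auto simp: pulls_volume_def vimage_comp[symmetric] ennreal_mult' mult.assoc mult.commute mult.left_commute)
  qed
  then show ?thesis using assms by (auto simp: pulls_volume_def)
qed

lemma pulls_volume_unique:
  assumes "pulls_volume f a" "pulls_volume f b"
  shows "a = b"
proof -
  have "ennreal a * emeasure lborel (ball 0 1 :: 'a set) = ennreal b * emeasure lborel (ball 0 1 :: 'a set)"
    using assms unfolding pulls_volume_def by (metis open_ball borel_open)
  then have "ennreal a = ennreal b"
    using emeasure_unit_ball_pos_finite[where 'a='a] 
    by (metis ennreal_mult_divide_eq less_irrefl infinity_ennreal_def)
  then show ?thesis using assms by (simp add: pulls_volume_def)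
qed

text \<open>The image of Lebesgue measure under a linear bijection is again translation invariant.\<close>
lemma linear_bij_pulls_volume:
  fixes f :: "'a::euclidean_space \<Rightarrow> 'a"
  assumes "linear f" "bij f"
  obtains a where "pulls_volume f a"
proof -
  have [measurable]: "f \<in> borel_measurable borel"
    using assms(1) by (intro borel_measurable_continuous_onI linear_continuous_on linear_conv_bounded_linear[THEN iffD1])
  let ?\<mu> = "distr lborel borel f"
  obtain g where g: "linear g" "g \<circ> f = id"
    using linear_injective_left_inverse assms bij_is_inj by blast
  have gf: "g (f x) = x" for x using g(2) by (metis comp_apply id_apply)
  have fin: "emeasure ?\<mu> (ball 0 r) < \<infinity>" for r
  proof -
    have "f -` ball 0 r \<subseteq> g ` ball 0 r" 
    proof
      fix x assume "x \<in> f -` ball 0 r"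
      then show "x \<in> g ` ball 0 r" using gf[of x] by (intro image_eqI[of _ g "f x"]) auto
    qed
    moreover have "bounded (g ` ball 0 r)"
      using g(1) by (intro bounded_linear_image) (auto simp: linear_conv_bounded_linear)
    ultimately have "bounded (f -` ball 0 r)" using bounded_subset by blast
    then have "emeasure lborel (f -` ball 0 r) < \<infinity>" by (rule emeasure_bounded_finite)
    moreover have "emeasure ?\<mu> (ball 0 r) = emeasure lborel (f -` ball 0 r)"
      by (subst emeasure_distr) auto
    ultimately show ?thesis by metis
  qed
  have pos: "emeasure ?\<mu> (ball 0 1) > 0"
  proof -
    have "open (f -` ball 0 1)" using assms(1)
      by (intro open_vimage) (auto intro!: linear_continuous_on linear_conv_bounded_linear[THEN iffD1])
    moreover have "0 \<in> f -` ball 0 1" using assms(1) by (simp add: linear_0)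
    ultimately have "\<not> negligible (f -` ball 0 1)" using open_not_negligible by blast
    then have "emeasure lborel (f -` ball 0 1) \<noteq> 0"
      using measurable_sets[of f borel borel "ball 0 1"]
      by (auto simp: negligible_iff_emeasure0)
    then show ?thesis by (simp add: emeasure_distr zero_less_iff_neq_zero)
  qed
  have "sigma_finite_measure ?\<mu>"
  proof
    have "\<Union> (range (\<lambda>n. ball (0::'a) (real n))) = UNIV"
      by (auto simp: reals_Archimedean2)
    then show "\<exists>A. countable A \<and> A \<subseteq> sets ?\<mu> \<and> \<Union>A = space ?\<mu> \<and> (\<forall>a\<in>A. emeasure ?\<mu> a \<noteq> \<infinity>)"
      using fin by (intro exI[of _ "range (\<lambda>n. ball (0::'a) (real n))"]) (auto simp: less_top)
  qed
  moreover have "distr ?\<mu> borel (\<lambda>x. x + a) = ?\<mu>" for a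
  proof -
    have fb: "f (g a) = a" using assms(2) gf by (metis bij_pointE)
    have "distr ?\<mu> borel (\<lambda>x. x + a) = distr lborel borel (\<lambda>x. f x + a)"
      by (subst distr_distr) (auto simp: comp_def)
    also have "\<dots> = distr lborel borel (\<lambda>x. f (g a + x))"
      using fb assms(1) by (simp add: linear_add add.commute)
    also have "\<dots> = distr (distr lborel borel ((+) (g a))) borel f"
      by (subst distr_distr) (auto simp: comp_def)
    finally show ?thesis by (simp add: lborel_distr_plus)
  qed
  ultimately have eq: "emeasure ?\<mu> B * emeasure lborel (ball (0::'a) 1) = emeasure lborel B * emeasure ?\<mu> (ball 0 1)" if "B \<in> sets borel" for B
    using translation_invariant_measure_proportional[of ?\<mu> B] that by simp
  define v where "v = measure lborel (ball (0::'a) 1)"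
  define m where "m = measure ?\<mu> (ball (0::'a) 1)"
  have v: "emeasure lborel (ball (0::'a) 1) = ennreal v"
    unfolding v_def using emeasure_unit_ball_pos_finite(2)[where 'a='a] by (intro emeasure_eq_ennreal_measure) simp
  have m: "emeasure ?\<mu> (ball (0::'a) 1) = ennreal m"
    unfolding m_def using fin[of 1] by (intro emeasure_eq_ennreal_measure) simp
  have vm: "v > 0" "m > 0"
    using emeasure_unit_ball_pos_finite(1)[where 'a='a] pos unfolding v m by (simp_all add: ennreal_less_zero_iff)
  have "emeasure lborel (f -` B) = ennreal (m / v) * emeasure lborel B" if B: "B \<in> sets borel" for B
  proof -
    have "emeasure lborel (f -` B) * ennreal v = emeasure lborel B * ennreal m"
      using eq[OF B] B unfolding v m by (subst (asm) emeasure_distr) auto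
    then have "(emeasure lborel (f -` B) * ennreal v) * ennreal (1/v) = (emeasure lborel B * ennreal m) * ennreal (1/v)"
      by (simp only:)
    then have "emeasure lborel (f -` B) * (ennreal v * ennreal (1/v)) = (ennreal m * ennreal (1/v)) * emeasure lborel B"
      by (simp only: mult_ac)
    moreover have "ennreal v * ennreal (1/v) = 1" using vm by (simp flip: ennreal_mult)
    moreover have "ennreal m * ennreal (1/v) = ennreal (m / v)" using vm by (simp flip: ennreal_mult)
    ultimately show ?thesis by simp
  qed
  then have "pulls_volume f (m / v)" using vm by (auto simp add: pulls_volume_def)
  then show ?thesis using that by blast
qed

text \<open>The factor can be read off from the unit ball, which an isometry preserves.\<close>
lemma linear_isometry_pulls_volume:
  fixes f :: "'a::euclidean_space \<Rightarrow> 'a"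
  assumes "linear f" "bij f" "\<And>x. norm (f x) = norm x"
  shows "pulls_volume f 1"
proof -
  obtain a where a: "pulls_volume f a" using linear_bij_pulls_volume[OF assms(1,2)] .
  have "f -` ball 0 1 = ball 0 1" using assms(3) by auto
  then have "ennreal a * emeasure lborel (ball 0 1::'a set) = ennreal 1 * emeasure lborel (ball 0 1::'a set)"
    using a unfolding pulls_volume_def by (metis open_ball borel_open ennreal_1 mult_1)
  then have "ennreal a = ennreal 1"
    using emeasure_unit_ball_pos_finite[where 'a='a]
    by (metis ennreal_mult_divide_eq less_irrefl infinity_ennreal_def)
  then show ?thesis using a by (simp add: pulls_volume_def)
qed

lemma pulls_volume_distr:
  assumes "pulls_volume f 1" shows "distr lborel borel f = lborel"
  using assms by (intro measure_eqI) (auto simp: pulls_volume_def emeasure_distr)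
lemma complex_linear_imp_linear:
  fixes f :: "complex^'n \<Rightarrow> complex^'m"
  assumes "\<And>x y. f (x + y) = f x + f y" "\<And>c x. f (c *s x) = c *s f x"
  shows "linear f"
proof (rule linearI)
  fix r :: real and x
  have "r *\<^sub>R x = complex_of_real r *s x" for x :: "complex^'k"
    by (simp add: vec_eq_iff vector_scalar_mult_def scaleR_vec_def) (simp add: scaleR_conv_of_real)
  then show "f (r *\<^sub>R x) = r *\<^sub>R f x" using assms(2) by metis
qed (rule assms)

lemma linear_matrix_vector_mult_complex: "linear ((*v) (A :: complex^'n^'m))"
  by (rule complex_linear_imp_linear)
     (auto simp: matrix_vector_right_distrib vector_scalar_commute)

lemma bij_matrix_complex:
  fixes A :: "complex^'n^'n" assumes "invertible A" shows "bij ((*v) A)"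
proof -
  obtain B where "A ** B = mat 1" "B ** A = mat 1" using assms unfolding invertible_def by blast
  then show ?thesis by (intro o_bij[of "(*v) B"]) (auto simp: fun_eq_iff matrix_vector_mul_assoc)
qed

abbreviation "scales_by_det A \<equiv> pulls_volume ((*v) A) (1 / (cmod (det A))\<^sup>2)"

lemma scales_by_det_mult:
  fixes A B :: "complex^'n^'n"
  assumes "scales_by_det A" "scales_by_det B" shows "scales_by_det (A ** B)"
proof -
  have "(*v) (A ** B) = (*v) A \<circ> (*v) B" by (auto simp: matrix_vector_mul_assoc)
  then show ?thesis using pulls_volume_compose[OF assms]
    by (simp add: det_mul norm_mult power_mult_distrib)
qed

text \<open>The identity matrix with column \<open>k\<close> replaced by \<open>a\<close>. These matrices generate all invertible ones.\<close>
definition col_matrix :: "'n \<Rightarrow> complex^'n \<Rightarrow> complex^'n^'n" where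
  "col_matrix k a = (\<chi> i j. if j = k then a $ i else if i = j then 1 else 0)"

lemma det_col_matrix:
  fixes a :: "complex^'n"
  shows "det (col_matrix k a) = a $ k"
proof -
  have "det (\<chi> i j. if j = k then (mat 1 *v a) $ i else (mat 1::complex^'n^'n) $ i $ j) = a $ k * det (mat 1 :: complex^'n^'n)"
    by (rule cramer_lemma)
  moreover have "(\<chi> i j. if j = k then (mat 1 *v a) $ i else (mat 1::complex^'n^'n) $ i $ j) = col_matrix k a"
    by (simp only: matrix_vector_mul_lid) (auto simp: col_matrix_def vec_eq_iff mat_def)
  ultimately show ?thesis by simp
qed

lemma col_matrix_mult:
  fixes a x :: "complex^'n"
  shows "(col_matrix k a *v x) $ i = (if i = k then a $ k * x $ k else x $ i + a $ i * x $ k)"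
proof -
  have "(col_matrix k a *v x) $ i = (\<Sum>j\<in>UNIV. (if j = k then a $ i * x $ j else if i = j then x $ j else 0))"
    unfolding matrix_vector_mult_def col_matrix_def by (simp, intro sum.cong) auto
  also have "\<dots> = a $ i * x $ k + (\<Sum>j\<in>UNIV - {k}. (if i = j then x $ j else 0))"
    by (subst sum.remove[of _ k]) (auto intro!: sum.cong)
  finally show ?thesis by (auto simp: sum.delta if_distrib)
qed

text \<open>Let \<open>R\<close> be the isometry that flips the sign of coordinate \<open>k\<close>. Conjugating the shear by \<open>R\<close> inverts
it, so the volume factor of the shear equals its own inverse.\<close>
lemma scales_by_det_shear:
  fixes s :: "complex^'n"
  assumes "s $ k = 1" shows "scales_by_det (col_matrix k s)"
proof -
  let ?S = "col_matrix k s"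
  define R where "R = (\<lambda>z::complex^'n. (\<chi> i. if i = k then - z $ i else z $ i))"
  have R: "linear R" unfolding R_def by (rule linearI) (auto simp: vec_eq_iff)
  have RR: "R (R z) = z" for z unfolding R_def by (auto simp: vec_eq_iff)
  then have bR: "bij R" by (metis bijI')
  have "norm (R z) = norm z" for z
    unfolding R_def norm_vec_def L2_set_def by (intro arg_cong[of _ _ sqrt] sum.cong) auto
  then have vR: "pulls_volume R 1" by (intro linear_isometry_pulls_volume R bR)
  have "invertible ?S" using assms by (simp add: invertible_det_nz det_col_matrix)
  then obtain c where c: "pulls_volume ((*v) ?S) c"
    using linear_bij_pulls_volume[OF linear_matrix_vector_mult_complex bij_matrix_complex] by blast
  have "R \<circ> (*v) ?S \<circ> R \<circ> (*v) ?S = id"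
    using assms by (auto simp: fun_eq_iff vec_eq_iff R_def col_matrix_mult)
  then have "pulls_volume (id :: complex^'n \<Rightarrow> complex^'n) (1 * c * 1 * c)"
    using pulls_volume_compose[OF pulls_volume_compose[OF pulls_volume_compose[OF vR c] vR] c] by simp
  moreover have "pulls_volume (id :: complex^'n \<Rightarrow> complex^'n) 1"
    by (rule linear_isometry_pulls_volume) (auto simp: linear_id)
  ultimately have "1 * c * 1 * c = 1" by (rule pulls_volume_unique)
  then have "c\<^sup>2 = 1" by (simp add: power2_eq_square)
  moreover have "c > 0" using c by (simp add: pulls_volume_def)
  ultimately have "c = 1" by (simp add: power2_eq_1_iff)
  then have "1 / (cmod (det ?S))\<^sup>2 = c" using assms by (simp add: det_col_matrix)
  then show ?thesis using c by metis
qed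

text \<open>Stretching one complex coordinate by \<open>r\<close> stretches two real coordinates, whence the square.\<close>
lemma scales_by_det_real_diag:
  fixes k :: "'n::finite"
  assumes "r > 0" shows "scales_by_det (col_matrix k (axis k (complex_of_real r)))"
proof -
  let ?c = "\<lambda>b::complex^'n. if b $ k = 0 then 1 else r"
  let ?D = "(*v) (col_matrix k (axis k (complex_of_real r)))"
  have D: "?D x = 0 + (\<Sum>b\<in>Basis. (?c b * (x \<bullet> b)) *\<^sub>R b)" for x
  proof -
    have "?D x \<bullet> b = ?c b * (x \<bullet> b)" if bB: "b \<in> Basis" for b
    proof -
      obtain i u where b: "b = axis i u" "u \<in> Basis"
        using bB unfolding Basis_vec_def UN_iff by blast
      then have "u \<noteq> 0" using nonzero_Basis by blast
      have "?D x \<bullet> b = ?D x $ i \<bullet> u" "x \<bullet> b = x $ i \<bullet> u" by (simp_all add: b(1) inner_axis)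
      moreover have "?D x $ i = (if i = k then complex_of_real r * x $ k else x $ i)"
        by (simp add: col_matrix_mult) (simp add: axis_def)
      moreover have "?c b = (if i = k then r else 1)" using \<open>u \<noteq> 0\<close> by (simp add: b(1) axis_def)
      moreover have "(complex_of_real r * y) \<bullet> u = r * (y \<bullet> u)" for y
        by (simp add: inner_complex_def algebra_simps)
      ultimately show ?thesis by simp
    qed
    note comp = this
    show ?thesis by (rule euclidean_eqI) (simp add: comp inner_sum_left_Basis)
  qed
  have r2: "(\<Prod>b\<in>Basis. \<bar>?c b\<bar>) = r\<^sup>2"
  proof -
    have "{b \<in> (Basis::(complex^'n) set). b $ k \<noteq> 0} = {axis k 1, axis k \<i>}"
    proof -
      have "b \<in> {axis k 1, axis k \<i>}" if bB: "b \<in> Basis" "b $ k \<noteq> 0" for b :: "complex^'n"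
      proof -
        obtain i u where b: "b = axis i u" "u \<in> Basis"
          using bB(1) unfolding Basis_vec_def UN_iff by blast
        then have "i = k" using bB(2) by (simp add: axis_def split: if_splits)
        then show ?thesis using b by (auto simp: Basis_complex_def)
      qed
      then show ?thesis by (auto simp: axis_in_Basis_iff Basis_complex_def) 
    qed
    moreover have "(\<Prod>b\<in>(Basis::(complex^'n) set). \<bar>?c b\<bar>) = (\<Prod>b\<in>{b \<in> (Basis::(complex^'n) set). b $ k \<noteq> 0}. r)"
      by (rule prod.mono_neutral_cong_right) (use assms in auto)
    ultimately have "(\<Prod>b\<in>(Basis::(complex^'n) set). \<bar>?c b\<bar>) = (\<Prod>b\<in>{axis k 1, axis k \<i> :: complex^'n}. r)" by simp
    also have "\<dots> = r\<^sup>2" by (simp add: axis_eq_axis power2_eq_square)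
    finally show ?thesis .
  qed
  have dens: "lborel = density (distr lborel borel ?D) (\<lambda>_. ennreal (r\<^sup>2))"
    using lborel_affine_euclidean[of ?c 0] assms unfolding D[symmetric] r2 by auto
  have [measurable]: "?D \<in> borel_measurable borel"
    by (intro borel_measurable_continuous_onI linear_continuous_on linear_conv_bounded_linear[THEN iffD1] linear_matrix_vector_mult_complex)
  have r2B: "emeasure lborel B = ennreal (r\<^sup>2) * emeasure lborel (?D -` B)" if B: "B \<in> sets borel" for B
  proof -
    have "emeasure lborel B = emeasure (density (distr lborel borel ?D) (\<lambda>_. ennreal (r\<^sup>2))) B"
      using arg_cong[OF dens, of "\<lambda>M. emeasure M B"] .
    also have "\<dots> = ennreal (r\<^sup>2) * emeasure (distr lborel borel ?D) B"
      using B by (simp add: emeasure_density_const)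
    also have "emeasure (distr lborel borel ?D) B = emeasure lborel (?D -` B)"
      using B by (subst emeasure_distr) auto
    finally show ?thesis .
  qed
  have "emeasure lborel (?D -` B) = ennreal (1 / r\<^sup>2) * emeasure lborel B" if B: "B \<in> sets borel" for B
  proof -
    have "ennreal (1 / r\<^sup>2) * ennreal (r\<^sup>2) = 1" using assms by (simp flip: ennreal_mult)
    then show ?thesis unfolding r2B[OF B] by (simp add: mult.assoc[symmetric])
  qed
  then have "pulls_volume ?D (1 / r\<^sup>2)" using assms by (auto simp: pulls_volume_def)
  moreover have "cmod (det (col_matrix k (axis k (complex_of_real r)))) = r"
    using assms by (simp add: det_col_matrix)
  ultimately show ?thesis by simp
qed

lemma scales_by_det_unit_diag:
  fixes k :: "'n::finite"
  assumes "cmod u = 1" shows "scales_by_det (col_matrix k (axis k u))"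
proof -
  let ?D = "(*v) (col_matrix k (axis k u))"
  have "invertible (col_matrix k (axis k u))"
    using assms by (auto simp add: invertible_det_nz det_col_matrix axis_def)
  moreover have "norm (?D x) = norm x" for x
    unfolding norm_vec_def L2_set_def using assms
    by (intro arg_cong[of _ _ sqrt] sum.cong) (auto simp: col_matrix_mult axis_def norm_mult)
  ultimately have "pulls_volume ?D 1"
    by (intro linear_isometry_pulls_volume linear_matrix_vector_mult_complex bij_matrix_complex)
  moreover have "cmod (det (col_matrix k (axis k u))) = 1"
    using assms by (simp add: det_col_matrix)
  ultimately show ?thesis by simp
qed

lemma scales_by_det_col_matrix:
  fixes a :: "complex^'n"
  assumes "a $ k \<noteq> 0" shows "scales_by_det (col_matrix k a)"
proof -
  define s where "s = (\<chi> i. if i = k then 1 else a $ i / a $ k)"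
  define r where "r = cmod (a $ k)"
  define u where "u = a $ k / of_real r"
  have r: "r > 0" and u: "cmod u = 1" "u * r = a $ k" using assms by (auto simp: r_def u_def norm_divide)
  have "col_matrix k s ** (col_matrix k (axis k u) ** col_matrix k (axis k (complex_of_real r))) = col_matrix k a"
    unfolding matrix_eq
  proof
    fix x :: "complex^'n"
    have "(col_matrix k s *v (col_matrix k (axis k u) *v (col_matrix k (axis k (complex_of_real r)) *v x))) $ i
      = (col_matrix k a *v x) $ i" for i
    proof (cases "i = k")
      case True
      then show ?thesis using u(2) by (simp add: col_matrix_mult axis_def s_def mult.assoc[symmetric])
    next
      case False
      have "a $ i * (u * (complex_of_real r * x $ k)) = a $ i * x $ k * a $ k"
        unfolding u(2)[symmetric] by (simp add: mult_ac)
      then have "a $ i / a $ k * (u * (complex_of_real r * x $ k)) = a $ i * x $ k"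
        using assms by (simp add: field_simps)
      then show ?thesis using False by (simp add: col_matrix_mult axis_def s_def)
    qed
    then show "(col_matrix k s ** (col_matrix k (axis k u) ** col_matrix k (axis k (complex_of_real r)))) *v x = col_matrix k a *v x"
      by (simp add: matrix_vector_mul_assoc[symmetric] vec_eq_iff)
  qed
  moreover have "s $ k = 1" by (simp add: s_def)
  ultimately show ?thesis
    using scales_by_det_mult[OF scales_by_det_shear scales_by_det_mult[OF scales_by_det_unit_diag[OF u(1)] scales_by_det_real_diag[OF r]]] by metis
qed

lemma matrix_vector_expansion:
  fixes A :: "complex^'n^'m"
  shows "A *v x = (\<Sum>k\<in>UNIV. x $ k *s (A *v axis k 1))"
proof -
  have "(A *v axis k 1) $ i = A $ i $ k" for i k
    unfolding matrix_vector_mult_def by (simp add: axis_def if_distrib cong: if_cong)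
  then show ?thesis
    by (simp add: vec_eq_iff matrix_vector_mult_def mult.commute)
qed

text \<open>Elimination by columns: outside \<open>N\<close> the columns of \<open>A\<close> agree with those of the identity, and left
multiplication by the inverse of a \<open>col_matrix\<close> repairs one more column.\<close>
lemma scales_by_det_elimination:
  fixes A :: "complex^'n^'n"
  assumes "finite N" "\<And>k. k \<notin> N \<Longrightarrow> A *v axis k 1 = axis k 1" "invertible A"
  shows "scales_by_det A"
  using assms
proof (induction arbitrary: A rule: finite_induct)
  case empty
  have "A *v x = x" for x
  proof -
    have "A *v x = (\<Sum>k\<in>UNIV. x $ k *s (A *v axis k 1))"
      by (rule matrix_vector_expansion)
    also have "\<dots> = x" using empty by (simp add: basis_expansion)
    finally show ?thesis .
  qed
  then have "A = mat 1" by (simp add: matrix_eq)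
  moreover have "pulls_volume ((*v) (mat 1 :: complex^'n^'n)) 1"
    by (rule linear_isometry_pulls_volume[OF linear_matrix_vector_mult_complex bij_matrix_complex])
       (simp_all add: invertible_det_nz)
  ultimately show ?case by (simp only: det_I norm_one power_one div_by_1)
next
  case (insert k N)
  have step: "scales_by_det B" if Bk: "(B *v axis k 1) $ k \<noteq> 0"
    and B: "\<And>j. j \<notin> insert k N \<Longrightarrow> B *v axis j 1 = axis j 1" "invertible B" for B :: "complex^'n^'n"
  proof -
    define Q where "Q = col_matrix k (B *v axis k 1)"
    have iQ: "invertible Q" unfolding Q_def using Bk by (simp add: invertible_det_nz det_col_matrix)
    then obtain Q' where Q': "Q ** Q' = mat 1" "Q' ** Q = mat 1" unfolding invertible_def by blast
    have Qk: "Q *v axis k 1 = B *v axis k 1" 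
      unfolding Q_def by (auto simp: vec_eq_iff col_matrix_mult) (auto simp: axis_def)
    have Qj: "Q *v axis j 1 = axis j 1" if "j \<noteq> k" for j
      unfolding Q_def using that by (auto simp: vec_eq_iff col_matrix_mult axis_def)
    have Q'Q: "Q' *v (Q *v x) = x" for x using Q'(2) by (simp add: matrix_vector_mul_assoc)
    have "scales_by_det (Q' ** B)"
    proof (rule insert.IH)
      fix j assume "j \<notin> N"
      then show "(Q' ** B) *v axis j 1 = axis j 1"
        using B(1)[of j] Qk Qj[of j] Q'Q[of "axis j 1"] by (cases "j = k") (auto simp: matrix_vector_mul_assoc[symmetric])
    next
      have "invertible Q'" using Q' unfolding invertible_def by blast
      then show "invertible (Q' ** B)" using B(2) by (rule invertible_mult)
    qed
    moreover have "scales_by_det Q" unfolding Q_def by (rule scales_by_det_col_matrix) fact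
    ultimately have "scales_by_det (Q ** (Q' ** B))" by (rule scales_by_det_mult[rotated])
    then show ?thesis using Q' by (simp add: matrix_mul_assoc)
  qed
  show ?case
  proof (cases "(A *v axis k 1) $ k = 0")
    case False
    then show ?thesis using step insert.prems by blast
  next
    case True
    \<comment> \<open>Otherwise \<open>A *v axis k 1\<close> is a combination of unit vectors fixed by \<open>A\<close>, against injectivity.\<close>
    have "\<exists>l\<in>N. (A *v axis k 1) $ l \<noteq> 0"
    proof (rule ccontr)
      assume "\<not> (\<exists>l\<in>N. (A *v axis k 1) $ l \<noteq> 0)"
      then have 0: "(A *v axis k 1) $ l = 0" if "l \<in> insert k N" for l using True that by blast
      define y where "y = A *v axis k 1"
      have "A *v y = (\<Sum>j\<in>UNIV. y $ j *s (A *v axis j 1))"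
        by (rule matrix_vector_expansion)
      also have "\<dots> = (\<Sum>j\<in>UNIV. y $ j *s axis j 1)"
      proof (rule sum.cong[OF refl])
        fix j show "y $ j *s (A *v axis j 1) = y $ j *s axis j 1"
          using 0[of j] insert.prems(1)[of j] by (cases "j \<in> insert k N") (auto simp: y_def)
      qed
      also have "\<dots> = A *v axis k 1" unfolding basis_expansion by (simp add: y_def)
      finally have "y = axis k 1"
        using bij_matrix_complex[OF insert.prems(2)] by (metis bij_is_inj injD)
      then show False using True y_def by simp
    qed
    then obtain l where l: "l \<in> N" "(A *v axis k 1) $ l \<noteq> 0" by blast
    \<comment> \<open>A zero pivot is repaired by adding row \<open>l\<close> to row \<open>k\<close>.\<close>
    define E where "E = col_matrix l (axis l 1 + axis k (1::complex))"
    have lk: "l \<noteq> k" using l(1) insert.hyps by auto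
    have dE: "det E = 1" unfolding E_def by (simp add: det_col_matrix axis_def lk)
    then have iE: "invertible E" by (simp add: invertible_det_nz)
    then obtain E' where E': "E ** E' = mat 1" "E' ** E = mat 1" unfolding invertible_def by blast
    have vE': "scales_by_det E'"
    proof -
      have "E' = col_matrix l (axis l 1 + axis k (- 1::complex))" (is "_ = ?E2")
      proof -
        have "E ** ?E2 = mat 1"
          unfolding matrix_eq E_def using lk
          by (auto simp: matrix_vector_mul_assoc[symmetric] vec_eq_iff col_matrix_mult axis_def)
        then show ?thesis using E' by (metis matrix_mul_assoc matrix_mul_lid matrix_mul_rid)
      qed
      moreover have "scales_by_det ?E2" by (rule scales_by_det_col_matrix) (auto simp: axis_def lk)
      ultimately show ?thesis by simp
    qed
    have "scales_by_det (E ** A)"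
    proof (rule step)
      show "((E ** A) *v axis k 1) $ k \<noteq> 0"
        using True l lk unfolding E_def by (simp add: matrix_vector_mul_assoc[symmetric] col_matrix_mult) (simp add: axis_def)
      show "invertible (E ** A)" using iE insert.prems by (intro invertible_mult)
      fix j assume j: "j \<notin> insert k N"
      then have "j \<noteq> l" using l by auto
      then show "(E ** A) *v axis j 1 = axis j 1"
        using insert.prems(1)[OF j] unfolding E_def 
        by (auto simp: matrix_vector_mul_assoc[symmetric] col_matrix_mult vec_eq_iff) (auto simp: axis_def)
    qed
    then have "scales_by_det (E' ** (E ** A))" by (rule scales_by_det_mult[OF vE'])
    then show ?thesis using E' by (simp add: matrix_mul_assoc)
  qed
qed

lemma matrix_pulls_volume:
  fixes A :: "complex^'n^'n"
  assumes "invertible A" shows "pulls_volume ((*v) A) (1 / (cmod (det A))\<^sup>2)"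
  by (rule scales_by_det_elimination[of UNIV]) (use assms in auto)

section \<open>Energy of a signed measure against the Gaussian kernel\<close>

text \<open>Nonempty open sets are not null. All passages below from almost everywhere to everywhere use this.\<close>
lemma continuous_AE_zero_imp_zero:
  fixes g :: "'a::euclidean_space \<Rightarrow> 'b::real_normed_vector"
  assumes "open S" "continuous_on S g" and ae: "AE x in lborel. x \<in> S \<longrightarrow> g x = 0" and "x \<in> S"
  shows "g x = 0"
proof (rule ccontr)
  assume "g x \<noteq> 0"
  let ?U = "S \<inter> g -` (- {0})"
  have o: "open ?U" using assms(1,2) by (intro continuous_open_preimage) auto
  have "AE x in lborel. x \<notin> ?U" using ae by eventually_elim auto
  then have "?U \<in> null_sets lborel"
    using o by (subst AE_iff_null_sets) auto
  then have "negligible ?U" by (simp add: negligible_iff_null_sets null_sets_completionI)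
  then show False using o \<open>x \<in> S\<close> \<open>g x \<noteq> 0\<close> open_not_negligible[of ?U] by auto
qed

abbreviation gauss :: "real \<Rightarrow> 'a::real_normed_vector \<Rightarrow> real" where
  "gauss s u \<equiv> exp (- s * (norm u)\<^sup>2)"

lemma gaussian_integrable:
  fixes s :: real assumes "s > 0"
  shows "integrable lborel (\<lambda>z::'a::euclidean_space. gauss s z)"
proof -
  have 1: "integrable lborel (\<lambda>x::real. exp (- s * x\<^sup>2))"
  proof -
    define \<sigma> where "\<sigma> = 1 / sqrt (2 * s)"
    have \<sigma>: "\<sigma> > 0" "2 * \<sigma>\<^sup>2 = 1 / s" using assms by (auto simp: \<sigma>_def power_divide)
    have "integrable lborel (\<lambda>x. sqrt (2 * pi * \<sigma>\<^sup>2) * normal_density 0 \<sigma> x)"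
      using \<sigma> by (intro integrable_mult_right) simp
    moreover have "sqrt (2 * pi * \<sigma>\<^sup>2) * normal_density 0 \<sigma> x = exp (- s * x\<^sup>2)" for x
    proof -
      have "- (x - 0)\<^sup>2 / (2 * \<sigma>\<^sup>2) = - s * x\<^sup>2" using assms unfolding \<sigma>(2) by simp
      moreover have "sqrt (2 * pi * \<sigma>\<^sup>2) > 0" using \<sigma> by simp
      ultimately show ?thesis using \<sigma> unfolding normal_density_def by simp
    qed
    ultimately show ?thesis by simp
  qed
  have e: "gauss s z = (\<Prod>b\<in>Basis. exp (- s * (z \<bullet> b)\<^sup>2))" for z :: 'a
  proof -
    have "(norm z)\<^sup>2 = (\<Sum>b\<in>Basis. (z \<bullet> b)\<^sup>2)"
      unfolding power2_norm_eq_inner by (subst euclidean_inner) (simp add: power2_eq_square)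
    then have "- s * (norm z)\<^sup>2 = (\<Sum>b\<in>Basis. - s * (z \<bullet> b)\<^sup>2)"
      by (simp only: sum_distrib_left)
    then show ?thesis by (simp only: exp_sum[OF finite_Basis])
  qed
  have "(\<integral>\<^sup>+z. ennreal (gauss s z) \<partial>(lborel::'a measure)) = (\<integral>\<^sup>+z. (\<Prod>b\<in>Basis. ennreal (exp (- s * (z \<bullet> b)\<^sup>2))) \<partial>(lborel::'a measure))"
    unfolding e by (intro nn_integral_cong) (simp add: prod_ennreal)
  also have "\<dots> = (\<Prod>b\<in>(Basis::'a set). (\<integral>\<^sup>+x. ennreal (exp (- s * x\<^sup>2)) \<partial>lborel))"
    by (rule nn_integral_lborel_prod) auto
  also have "\<dots> < \<infinity>"
  proof -
    have "(\<integral>\<^sup>+x. ennreal (exp (- s * x\<^sup>2)) \<partial>lborel) = ennreal (\<integral>x. exp (- s * x\<^sup>2) \<partial>lborel)"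
      using 1 by (intro nn_integral_eq_integral) auto
    then show ?thesis by (simp add: ennreal_power[symmetric] power_less_top_ennreal)
  qed
  finally show ?thesis
    by (intro integrableI_bounded) auto
qed

lemma gaussian_integral_pos:
  fixes s :: real assumes "s > 0"
  shows "(\<integral>z. gauss s z \<partial>(lborel::'a::euclidean_space measure)) > 0"
proof -
  have "(\<integral>z. gauss s z \<partial>(lborel::'a measure)) \<noteq> 0"
  proof
    assume "(\<integral>z. gauss s z \<partial>(lborel::'a measure)) = 0"
    then have "AE z::'a in lborel. gauss s z = 0"
      by (subst (asm) integral_nonneg_eq_0_iff_AE) (use gaussian_integrable[OF assms] in auto)
    then have "gauss s (0::'a) = 0"
      by (intro continuous_AE_zero_imp_zero[of UNIV]) (auto intro!: continuous_intros)
    then show False by simp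
  qed
  moreover have "(\<integral>z. gauss s z \<partial>(lborel::'a measure)) \<ge> 0" by simp
  ultimately show ?thesis by linarith
qed

text \<open>The parallelogram law for \<open>x - z\<close> and \<open>y - z\<close>. It turns the \<open>L\<^sup>2\<close> inner product of two Gaussians
into a Gaussian in the distance of their centres.\<close>
lemma gaussian_product_midpoint:
  fixes x y z :: "'a::real_inner"
  shows "exp (- 2 * t * (norm (x - z))\<^sup>2) * exp (- 2 * t * (norm (y - z))\<^sup>2)
       = gauss t (x - y) * gauss (4 * t) (z - (1/2) *\<^sub>R (x + y))"
proof -
  have "2 * (norm (x - z))\<^sup>2 + 2 * (norm (y - z))\<^sup>2 = (norm (x - y))\<^sup>2 + 4 * (norm (z - (1/2) *\<^sub>R (x + y)))\<^sup>2"
    by (simp add: power2_norm_eq_inner inner_simps inner_commute algebra_simps)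
  then have "- 2 * t * (norm (x - z))\<^sup>2 + - 2 * t * (norm (y - z))\<^sup>2 = - t * (norm (x - y))\<^sup>2 + - (4 * t) * (norm (z - (1/2) *\<^sub>R (x + y)))\<^sup>2"
    by algebra
  then show ?thesis by (simp only: exp_add[symmetric])
qed

text \<open>Integrating \<open>gaussian_product_midpoint\<close> over \<open>z\<close>: the mutual energy of \<open>A\<close> and \<open>B\<close> for the kernel
\<open>exp (- t |x - y|\<^sup>2)\<close> is, up to a positive constant, an \<open>L\<^sup>2\<close> inner product. Energies of signed
measures are therefore nonnegative.\<close>
lemma gaussian_energy_pair:
  fixes A B :: "'a::euclidean_space measure"
  assumes "finite_measure A" "finite_measure B" and [measurable_cong]: "sets A = sets borel" "sets B = sets borel"
    and t: "t > 0"
  defines "G \<equiv> \<lambda>M z. (\<integral>x. exp (- 2 * t * (norm (x - z))\<^sup>2) \<partial>M)"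
  shows "has_bochner_integral lborel (\<lambda>z. G A z * G B z)
           ((\<integral>z. gauss (4 * t) z \<partial>(lborel::'a measure)) * (\<integral>w. gauss t (fst w - snd w) \<partial>(A \<Otimes>\<^sub>M B)))"
proof -
  interpret A: finite_measure A by fact
  interpret B: finite_measure B by fact
  interpret AB: pair_sigma_finite A B ..
  interpret P: finite_measure "A \<Otimes>\<^sub>M B" by (intro finite_measure_pair_measure) fact+
  interpret PL: pair_sigma_finite "A \<Otimes>\<^sub>M B" "lborel :: 'a measure" ..
  define e where "e = (\<lambda>x z::'a. exp (- 2 * t * (norm (x - z))\<^sup>2))"
  have e01: "0 \<le> e x z" "e x z \<le> 1" for x z using t by (auto simp: e_def)
  have [measurable]: "(\<lambda>w. e (fst w) (snd w)) \<in> borel_measurable (borel \<Otimes>\<^sub>M borel)"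
    unfolding e_def by measurable
  have [measurable]: "(\<lambda>x. e x z) \<in> borel_measurable borel" for z unfolding e_def by measurable
  have ie: "integrable A (\<lambda>x. e x z)" "integrable B (\<lambda>x. e x z)" for z
    by (rule A.integrable_const_bound[of _ 1] B.integrable_const_bound[of _ 1]; use e01 in auto)+
  have [measurable]: "G A \<in> borel_measurable borel" "G B \<in> borel_measurable borel"
    unfolding G_def by measurable
  have Gnn: "G A z \<ge> 0" "G B z \<ge> 0" for z unfolding G_def by auto
  have mG: "ennreal (G A z * G B z) = (\<integral>\<^sup>+w. ennreal (e (fst w) z) * ennreal (e (snd w) z) \<partial>(A \<Otimes>\<^sub>M B))" for z
  proof -
    have "ennreal (G A z * G B z) = (\<integral>\<^sup>+x. ennreal (e x z) \<partial>A) * (\<integral>\<^sup>+x. ennreal (e x z) \<partial>B)"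
      using ie e01 Gnn by (simp add: ennreal_mult nn_integral_eq_integral G_def e_def)
    also have "\<dots> = (\<integral>\<^sup>+x. (\<integral>\<^sup>+y. ennreal (e x z) * ennreal (e y z) \<partial>B) \<partial>A)"
      by (subst nn_integral_cmult) (auto simp: nn_integral_multc)
    also have "\<dots> = (\<integral>\<^sup>+w. ennreal (e (fst w) z) * ennreal (e (snd w) z) \<partial>(A \<Otimes>\<^sub>M B))"
      by (subst B.nn_integral_fst[symmetric]) auto
    finally show ?thesis .
  qed
  define K where "K = (\<integral>z. gauss (4 * t) z \<partial>(lborel::'a measure))"
  have K: "(\<integral>\<^sup>+z. ennreal (gauss (4 * t) z) \<partial>(lborel::'a measure)) = ennreal K"
    unfolding K_def using t gaussian_integrable[of "4 * t", where 'a='a] by (intro nn_integral_eq_integral) auto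
  have "(\<integral>\<^sup>+z. ennreal (G A z * G B z) \<partial>lborel) = (\<integral>\<^sup>+z. (\<integral>\<^sup>+w. ennreal (e (fst w) z) * ennreal (e (snd w) z) \<partial>(A \<Otimes>\<^sub>M B)) \<partial>lborel)"
    by (simp add: mG)
  also have "\<dots> = (\<integral>\<^sup>+w. (\<integral>\<^sup>+z. ennreal (e (fst w) z) * ennreal (e (snd w) z) \<partial>lborel) \<partial>(A \<Otimes>\<^sub>M B))"
    by (rule PL.Fubini') (unfold e_def, measurable)
  also have "\<dots> = (\<integral>\<^sup>+w. ennreal (gauss t (fst w - snd w)) * ennreal K \<partial>(A \<Otimes>\<^sub>M B))"
  proof (rule nn_integral_cong)
    fix w :: "'a \<times> 'a"
    let ?m = "(1/2) *\<^sub>R (fst w + snd w)"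
    have "(\<integral>\<^sup>+z. ennreal (e (fst w) z) * ennreal (e (snd w) z) \<partial>lborel) =
       (\<integral>\<^sup>+z. ennreal (gauss t (fst w - snd w)) * ennreal (gauss (4 * t) (z - ?m)) \<partial>lborel)"
      unfolding e_def by (intro nn_integral_cong) (simp only: ennreal_mult[symmetric] exp_ge_zero gaussian_product_midpoint)
    also have "\<dots> = ennreal (gauss t (fst w - snd w)) * (\<integral>\<^sup>+z. ennreal (gauss (4 * t) (z - ?m)) \<partial>lborel)"
      by (rule nn_integral_cmult) measurable
    also have "(\<integral>\<^sup>+z. ennreal (gauss (4 * t) (z - ?m)) \<partial>lborel) = ennreal K"
    proof -
      have "(\<integral>\<^sup>+z. ennreal (gauss (4 * t) (z - ?m)) \<partial>lborel)
        = (\<integral>\<^sup>+z. ennreal (gauss (4 * t) (z - ?m)) \<partial>(distr lborel borel ((+) ?m)))"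
        by (simp only: lborel_distr_plus)
      also have "\<dots> = (\<integral>\<^sup>+z. ennreal (gauss (4 * t) z) \<partial>(lborel::'a measure))"
        by (subst nn_integral_distr) simp_all
      finally show ?thesis using K by simp
    qed
    finally show "(\<integral>\<^sup>+z. ennreal (e (fst w) z) * ennreal (e (snd w) z) \<partial>lborel) = ennreal (gauss t (fst w - snd w)) * ennreal K" .
  qed
  also have "\<dots> = (\<integral>\<^sup>+w. ennreal (gauss t (fst w - snd w)) \<partial>(A \<Otimes>\<^sub>M B)) * ennreal K"
    by (rule nn_integral_multc) measurable
  also have "(\<integral>\<^sup>+w. ennreal (gauss t (fst w - snd w)) \<partial>(A \<Otimes>\<^sub>M B)) = ennreal (\<integral>w. gauss t (fst w - snd w) \<partial>(A \<Otimes>\<^sub>M B))"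
    using t by (intro nn_integral_eq_integral P.integrable_const_bound[of _ 1]) auto
  also have "\<dots> * ennreal K = ennreal (K * (\<integral>w. gauss t (fst w - snd w) \<partial>(A \<Otimes>\<^sub>M B)))"
    using gaussian_integral_pos[of "4 * t", where 'a='a] t unfolding K_def[symmetric]
    by (simp add: ennreal_mult mult.commute)
  finally have "(\<integral>\<^sup>+z. ennreal (G A z * G B z) \<partial>lborel) = ennreal (K * (\<integral>w. gauss t (fst w - snd w) \<partial>(A \<Otimes>\<^sub>M B)))" .
  then show ?thesis unfolding K_def[symmetric]
    using Gnn gaussian_integral_pos[of "4 * t", where 'a='a] t unfolding K_def[symmetric]
    by (intro has_bochner_integral_nn_integral) auto
qed

section \<open>Fractional powers as mixtures of exponentials\<close>

text \<open>The Taylor remainder of order \<open>k\<close> of \<open>exp (- s)\<close>, with the sign that makes it positive for \<open>s > 0\<close>.\<close>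
definition exp_tail :: "nat \<Rightarrow> real \<Rightarrow> real" where
  "exp_tail k s = (- 1) ^ (k + 1) * (exp (- s) - (\<Sum>j\<le>k. (- s) ^ j / fact j))"

lemma exp_tail_lagrange:
  assumes "s \<ge> 0"
  obtains t where "\<bar>t\<bar> \<le> s" "exp_tail k s = exp t / fact (k + 1) * s ^ (k + 1)"
proof -
  obtain t where t: "\<bar>t\<bar> \<le> \<bar>- s\<bar>" "exp (- s) = (\<Sum>m<k+1. (- s) ^ m / fact m) + exp t / fact (k + 1) * (- s) ^ (k + 1)"
    using Maclaurin_exp_le[of "- s" "k + 1"] by blast
  have "exp_tail k s = (- 1) ^ (k + 1) * (exp t / fact (k + 1) * (- s) ^ (k + 1))"
    unfolding exp_tail_def t(2) by (simp add: lessThan_Suc_atMost)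
  also have "\<dots> = exp t / fact (k + 1) * ((- 1) ^ (k + 1) * (- s) ^ (k + 1))" by (simp only: mult_ac)
  also have "(- 1) ^ (k + 1) * (- s) ^ (k + 1) = s ^ (k + 1)"
    by (simp only: power_mult_distrib[symmetric]) simp
  finally show ?thesis using that t(1) assms by simp
qed

lemma exp_tail_pos: "s > 0 \<Longrightarrow> exp_tail k s > 0"
  by (rule exp_tail_lagrange[of s k]) auto

lemma exp_tail_0 [simp]: "exp_tail k 0 = 0"
  by (rule exp_tail_lagrange[of 0 k]) auto

lemma exp_tail_nonneg: "s \<ge> 0 \<Longrightarrow> exp_tail k s \<ge> 0"
  using exp_tail_pos[of s k] by (cases "s = 0") auto

lemma exp_tail_measurable [measurable]: "exp_tail k \<in> borel_measurable borel"
  unfolding exp_tail_def by measurable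

lemma exp_tail_le_small:
  assumes "0 \<le> s" "s \<le> 1" shows "exp_tail k s \<le> (real k + 3) * s ^ (k + 1)"
proof -
  obtain t where t: "\<bar>t\<bar> \<le> s" "exp_tail k s = exp t / fact (k + 1) * s ^ (k + 1)"
    using exp_tail_lagrange assms(1) by blast
  have "exp t \<le> exp 1" using t(1) assms by simp
  then have "exp t \<le> 3" using exp_le by linarith
  moreover have "(1::real) \<le> fact (k + 1)" by (rule fact_ge_1)
  ultimately have "exp t / fact (k + 1) \<le> 3"
    using frac_le[of 3 "exp t" 1 "fact (k + 1)"] by simp
  then have "exp t / fact (k + 1) \<le> real k + 3" by simp
  then show ?thesis unfolding t(2) using assms by (intro mult_right_mono) auto
qed

lemma exp_tail_le_large:
  assumes "1 \<le> s" shows "exp_tail k s \<le> (real k + 3) * s ^ k"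
proof -
  have "exp_tail k s \<le> \<bar>exp_tail k s\<bar>" by simp
  also have "\<dots> = \<bar>exp (- s) - (\<Sum>j\<le>k. (- s) ^ j / fact j)\<bar>"
    unfolding exp_tail_def by (simp add: abs_mult power_abs)
  also have "\<dots> \<le> exp (- s) + (\<Sum>j\<le>k. \<bar>(- s) ^ j / fact j\<bar>)"
    using sum_abs[of "\<lambda>j. (- s) ^ j / fact j" "{..k}"] abs_triangle_ineq4[of "exp (- s)" "\<Sum>j\<le>k. (- s) ^ j / fact j"] by simp
  also have "\<dots> \<le> 1 + (\<Sum>j\<le>k. s ^ k)"
  proof (intro add_mono sum_mono)
    show "exp (- s) \<le> 1" using assms by simp
    fix j assume "j \<in> {..k}"
    have "\<bar>(- s) ^ j / fact j\<bar> = s ^ j / fact j" using assms by (simp add: power_abs)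
    also have "\<dots> \<le> s ^ j / 1" using assms by (intro divide_left_mono fact_ge_1) auto
    also have "\<dots> \<le> s ^ k" using assms \<open>j \<in> {..k}\<close> by (simp add: power_increasing)
    finally show "\<bar>(- s) ^ j / fact j\<bar> \<le> s ^ k" .
  qed
  also have "\<dots> = 1 + (real k + 1) * s ^ k" by simp
  also have "\<dots> \<le> (real k + 3) * s ^ k" using one_le_power[OF assms, of k] by (simp add: algebra_simps)
  finally show ?thesis .
qed

text \<open>The remainder is of order \<open>s ^ (k + 1)\<close> near \<open>0\<close> and of order \<open>s ^ k\<close> near infinity; both are
dominated by a power in between.\<close>
lemma exp_tail_le_powr:
  fixes \<alpha> :: real
  assumes "s \<ge> 0" "real k < \<alpha>" "\<alpha> < real k + 1"
  shows "exp_tail k s \<le> (real k + 3) * s powr \<alpha>"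
proof (cases "s = 0")
  case False
  then have s: "s > 0" using assms by simp
  show ?thesis
  proof (cases "s \<le> 1")
    case True
    have "s ^ (k + 1) = s powr (k + 1)" using s powr_realpow[of s "k + 1"] by (simp add: add.commute)
    also have "\<dots> \<le> s powr \<alpha>" using s True assms by (intro powr_mono') auto
    finally have "(real k + 3) * s ^ (k + 1) \<le> (real k + 3) * s powr \<alpha>" by (intro mult_left_mono) auto
    then show ?thesis using exp_tail_le_small[of s k] s True by linarith
  next
    case False
    have "s ^ k = s powr k" using s by (simp add: powr_realpow)
    also have "\<dots> \<le> s powr \<alpha>" using False assms by (intro powr_mono) auto
    finally have "(real k + 3) * s ^ k \<le> (real k + 3) * s powr \<alpha>" by (intro mult_left_mono) auto
    then show ?thesis using exp_tail_le_large[of s k] False by linarith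
  qed
qed simp

lemma exp_tail_weight_integrable:
  fixes \<alpha> :: real
  assumes "real k < \<alpha>" "\<alpha> < real k + 1"
  shows "(\<integral>\<^sup>+s. ennreal (indicator {0<..} s * (exp_tail k s * s powr (- \<alpha> - 1))) \<partial>lborel) < \<infinity>"
proof -
  let ?K = "real k + 3"
  have fin: "(\<integral>\<^sup>+s. ennreal (indicator S s * f s) \<partial>lborel) < \<infinity>"
    if "f integrable_on S" "\<And>x. x \<in> S \<Longrightarrow> f x \<ge> 0" "S \<in> sets borel" "f \<in> borel_measurable borel" for S and f :: "real \<Rightarrow> real"
  proof -
    have [measurable]: "S \<in> sets borel" "f \<in> borel_measurable borel" by fact+
    have "f absolutely_integrable_on S" using that by (intro nonnegative_absolutely_integrable_1) auto
    then have "integrable lebesgue (\<lambda>s. indicator S s * f s)" by (simp add: set_integrable_def)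
    then have "integrable lborel (\<lambda>s. indicator S s * f s)" by (subst (asm) integrable_completion) auto
    then have "(\<integral>\<^sup>+s. ennreal (norm (indicator S s * f s)) \<partial>lborel) < \<infinity>"
      by (simp add: integrable_iff_bounded)
    also have "(\<integral>\<^sup>+s. ennreal (norm (indicator S s * f s)) \<partial>lborel) = (\<integral>\<^sup>+s. ennreal (indicator S s * f s) \<partial>lborel)"
      using that(2) by (intro nn_integral_cong) (auto simp: indicator_def)
    finally show ?thesis .
  qed
  have 1: "(\<integral>\<^sup>+s. ennreal (indicator {0..1} s * (?K * s powr (k - \<alpha>))) \<partial>lborel) < \<infinity>"
    using integrable_on_powr_from_0[of "k - \<alpha>" 1] assms by (intro fin integrable_on_cmult_left) auto
  have 2: "(\<integral>\<^sup>+s. ennreal (indicator {1..} s * (?K * s powr (k - \<alpha> - 1))) \<partial>lborel) < \<infinity>"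
    using has_integral_integrable[OF has_integral_powr_to_inf[of "k - \<alpha> - 1" 1]] assms by (intro fin integrable_on_cmult_left) auto
  have "(\<integral>\<^sup>+s. ennreal (indicator {0<..} s * (exp_tail k s * s powr (- \<alpha> - 1))) \<partial>lborel)
     \<le> (\<integral>\<^sup>+s. ennreal (indicator {0..1} s * (?K * s powr (k - \<alpha>))) + ennreal (indicator {1..} s * (?K * s powr (k - \<alpha> - 1))) \<partial>lborel)"
  proof (rule nn_integral_mono)
    fix s :: real
    have "indicator {0<..} s * (exp_tail k s * s powr (- \<alpha> - 1))
      \<le> indicator {0..1} s * (?K * s powr (k - \<alpha>)) + indicator {1..} s * (?K * s powr (k - \<alpha> - 1))"
    proof (cases "s > 0")
      case s: True
      show ?thesis
      proof (cases "s \<le> 1")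
        case True
        have "exp_tail k s * s powr (- \<alpha> - 1) \<le> ?K * s ^ (k + 1) * s powr (- \<alpha> - 1)"
          using exp_tail_le_small[of s k] s True by (intro mult_right_mono) auto
        also have "\<dots> = ?K * (s powr (k + 1) * s powr (- \<alpha> - 1))"
          using s powr_realpow[of s "k + 1"] by (simp add: add.commute)
        also have "s powr (k + 1) * s powr (- \<alpha> - 1) = s powr (k - \<alpha>)"
          by (simp add: powr_add[symmetric])
        finally show ?thesis using s True by (auto simp: indicator_def)
      next
        case False
        have "exp_tail k s * s powr (- \<alpha> - 1) \<le> ?K * s ^ k * s powr (- \<alpha> - 1)"
          using exp_tail_le_large[of s k] False by (intro mult_right_mono) auto
        also have "\<dots> = ?K * (s powr k * s powr (- \<alpha> - 1))"
          using s by (simp add: powr_realpow[symmetric])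
        also have "s powr k * s powr (- \<alpha> - 1) = s powr (k - \<alpha> - 1)"
          by (simp add: powr_add[symmetric] algebra_simps)
        finally show ?thesis using s False by (auto simp: indicator_def)
      qed
    qed (auto simp: indicator_def)
    then have "ennreal (indicator {0<..} s * (exp_tail k s * s powr (- \<alpha> - 1)))
      \<le> ennreal (indicator {0..1} s * (?K * s powr (k - \<alpha>)) + indicator {1..} s * (?K * s powr (k - \<alpha> - 1)))"
      by (rule ennreal_leI)
    also have "\<dots> = ennreal (indicator {0..1} s * (?K * s powr (k - \<alpha>))) + ennreal (indicator {1..} s * (?K * s powr (k - \<alpha> - 1)))"
      by (rule ennreal_plus) auto
    finally show "ennreal (indicator {0<..} s * (exp_tail k s * s powr (- \<alpha> - 1)))
      \<le> ennreal (indicator {0..1} s * (?K * s powr (k - \<alpha>))) + ennreal (indicator {1..} s * (?K * s powr (k - \<alpha> - 1)))" .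
  qed
  also have "\<dots> = (\<integral>\<^sup>+s. ennreal (indicator {0..1} s * (?K * s powr (k - \<alpha>))) \<partial>lborel)
     + (\<integral>\<^sup>+s. ennreal (indicator {1..} s * (?K * s powr (k - \<alpha> - 1))) \<partial>lborel)"
    by (rule nn_integral_add) auto
  also have "\<dots> < \<infinity>" using 1 2 by simp
  finally show ?thesis .
qed

abbreviation tail_weight :: "nat \<Rightarrow> real \<Rightarrow> real \<Rightarrow> real \<Rightarrow> real" where
  "tail_weight k \<alpha> r s \<equiv> indicator {0<..} s * (exp_tail k (s * r) * s powr (- \<alpha> - 1))"

text \<open>The substitution \<open>s \<mapsto> r s\<close> shows that the integral is homogeneous of degree \<open>\<alpha>\<close> in \<open>r\<close>. It converges
because \<open>\<alpha>\<close> lies strictly between \<open>k\<close> and \<open>k + 1\<close>, and \<open>C > 0\<close> because the remainder has one sign.\<close>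
lemma powr_as_exp_tail_integral:
  fixes \<alpha> :: real
  assumes "real k < \<alpha>" "\<alpha> < real k + 1"
  obtains C where "C > 0" "\<And>r. r \<ge> 0 \<Longrightarrow>
    (\<integral>\<^sup>+s. ennreal (tail_weight k \<alpha> r s) \<partial>lborel) = ennreal (C * r powr \<alpha>)"
proof -
  let ?f = "\<lambda>s. ennreal (indicator {0<..} s * (exp_tail k s * s powr (- \<alpha> - 1)))"
  define C where "C = enn2real (\<integral>\<^sup>+s. ?f s \<partial>lborel)"
  have C: "(\<integral>\<^sup>+s. ?f s \<partial>lborel) = ennreal C"
    using exp_tail_weight_integrable[OF assms] unfolding C_def by simp
  have "C > 0"
  proof (rule ccontr)
    assume "\<not> C > 0"
    then have "(\<integral>\<^sup>+s. ?f s \<partial>lborel) = 0" using C by (simp add: ennreal_neg)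
    then have "AE s in lborel. ?f s = 0" by (subst (asm) nn_integral_0_iff_AE) auto
    then have "AE s in lborel. s \<in> {0::real<..} \<longrightarrow> (1::real) = 0"
    proof eventually_elim
      case (elim s)
      show ?case
      proof
        assume s: "s \<in> {0<..}"
        then have "exp_tail k s * s powr (- \<alpha> - 1) > 0" by (simp add: exp_tail_pos)
        then show "(1::real) = 0" using elim s by (simp add: ennreal_eq_0_iff)
      qed
    qed
    then have "(1::real) = 0"
      using continuous_AE_zero_imp_zero[of "{0<..}" "\<lambda>_::real. 1::real" 1] by auto
    then show False by simp
  qed
  moreover have "(\<integral>\<^sup>+s. ennreal (tail_weight k \<alpha> r s) \<partial>lborel) = ennreal (C * r powr \<alpha>)"
    if r: "r \<ge> 0" for r
  proof (cases "r = 0")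
    case False
    then have r: "r > 0" using r by simp
    have "ennreal C = ennreal \<bar>r\<bar> * (\<integral>\<^sup>+s. ?f (0 + r * s) \<partial>lborel)"
      unfolding C[symmetric] using r by (intro nn_integral_real_affine) auto
    also have "\<dots> = ennreal r * (\<integral>\<^sup>+s. ennreal (r powr (- \<alpha> - 1)) * ennreal (tail_weight k \<alpha> r s) \<partial>lborel)"
    proof -
      have "?f (0 + r * s) = ennreal (r powr (- \<alpha> - 1)) * ennreal (tail_weight k \<alpha> r s)" for s
      proof (cases "s > 0")
        case True
        then show ?thesis using r
          by (subst ennreal_mult[symmetric]) (auto simp: indicator_def powr_mult exp_tail_nonneg mult_ac)
      next
        case False
        then show ?thesis using r by (auto simp: indicator_def zero_less_mult_iff)
      qed
      then show ?thesis using r by simp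
    qed
    also have "\<dots> = ennreal r * ennreal (r powr (- \<alpha> - 1)) * (\<integral>\<^sup>+s. ennreal (tail_weight k \<alpha> r s) \<partial>lborel)"
      by (subst nn_integral_cmult) (auto simp: mult.assoc)
    also have "ennreal r * ennreal (r powr (- \<alpha> - 1)) = ennreal (r powr (- \<alpha>))"
    proof -
      have "r * r powr (- \<alpha> - 1) = r powr (1 + (- \<alpha> - 1))" using r by (subst powr_add) auto
      then show ?thesis using r by (simp add: ennreal_mult[symmetric])
    qed
    finally have e: "ennreal C = ennreal (r powr (- \<alpha>)) * (\<integral>\<^sup>+s. ennreal (tail_weight k \<alpha> r s) \<partial>lborel)" .
    have one: "ennreal (r powr \<alpha>) * ennreal (r powr (- \<alpha>)) = 1"
      using r by (simp add: ennreal_mult[symmetric] powr_add[symmetric])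
    have "ennreal (C * r powr \<alpha>) = ennreal (r powr \<alpha>) * ennreal C"
      using \<open>C > 0\<close> by (simp add: ennreal_mult[symmetric] mult.commute)
    also have "\<dots> = (\<integral>\<^sup>+s. ennreal (tail_weight k \<alpha> r s) \<partial>lborel)"
      unfolding e by (simp only: mult.assoc[symmetric] one mult_1)
    finally show ?thesis by simp
  qed simp
  ultimately show ?thesis using that by blast
qed

lemma norm_diff_powr_le:
  fixes x y :: "'a::real_normed_vector"
  assumes "p > 0"
  shows "norm (x - y) powr p \<le> 2 powr p * (norm x powr p + norm y powr p)"
proof -
  have "norm (x - y) \<le> 2 * max (norm x) (norm y)"
    using norm_triangle_ineq4[of x y] by (simp add: max_def)
  then have "norm (x - y) powr p \<le> (2 * max (norm x) (norm y)) powr p"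
    using assms by (intro powr_mono2) auto
  also have "\<dots> = 2 powr p * max (norm x) (norm y) powr p" by (simp add: powr_mult)
  also have "\<dots> \<le> 2 powr p * (norm x powr p + norm y powr p)"
    by (intro mult_left_mono) (auto simp: max_def)
  finally show ?thesis .
qed

lemma power_le_one_plus_powr:
  fixes u :: real assumes "u \<ge> 0" "real n \<le> p"
  shows "u ^ n \<le> 1 + u powr p"
proof (cases "u \<le> 1")
  case True
  then have "u ^ n \<le> 1" using assms by (simp add: power_le_one)
  then show ?thesis using powr_ge_zero[of u p] by linarith
next
  case False
  then have "u ^ n = u powr n" by (simp add: powr_realpow)
  also have "\<dots> \<le> u powr p" using False assms by (intro powr_mono) auto
  finally show ?thesis by simp
qed

lemma integrable_norm_diff_pair:
  fixes A B :: "'a::euclidean_space measure"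
  assumes "finite_measure A" "finite_measure B" and sets [measurable_cong]: "sets A = sets borel" "sets B = sets borel"
    and p: "p > 0" and "integrable A (\<lambda>x. norm x powr p)" "integrable B (\<lambda>x. norm x powr p)"
  shows "integrable (A \<Otimes>\<^sub>M B) (\<lambda>w. norm (fst w - snd w) powr p)"
proof -
  interpret A: finite_measure A by fact
  interpret B: finite_measure B by fact
  interpret AB: pair_sigma_finite A B ..
  interpret P: finite_measure "A \<Otimes>\<^sub>M B" by (intro finite_measure_pair_measure) fact+
  have 1: "integrable (A \<Otimes>\<^sub>M B) (\<lambda>w. norm (fst w) powr p)"
  proof (rule integrableI_bounded)
    have "(\<integral>\<^sup>+w. ennreal (norm (norm (fst w) powr p)) \<partial>(A \<Otimes>\<^sub>M B)) = (\<integral>\<^sup>+x. ennreal (norm x powr p) * emeasure B (space B) \<partial>A)"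
      by (subst B.nn_integral_fst[symmetric]) auto
    also have "\<dots> < \<infinity>"
      using assms(6) B.emeasure_finite[of "space B", unfolded less_top] by (subst nn_integral_multc) (auto simp: integrable_iff_bounded ennreal_mult_less_top)
    finally show "(\<integral>\<^sup>+w. ennreal (norm (norm (fst w) powr p)) \<partial>(A \<Otimes>\<^sub>M B)) < \<infinity>" .
  qed measurable
  have 2: "integrable (A \<Otimes>\<^sub>M B) (\<lambda>w. norm (snd w) powr p)"
  proof (rule integrableI_bounded)
    have "(\<integral>\<^sup>+w. ennreal (norm (norm (snd w) powr p)) \<partial>(A \<Otimes>\<^sub>M B)) = (\<integral>\<^sup>+x. (\<integral>\<^sup>+y. ennreal (norm y powr p) \<partial>B) \<partial>A)"
      by (subst B.nn_integral_fst[symmetric]) auto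
    also have "\<dots> < \<infinity>"
      using assms(7) A.emeasure_finite[of "space A", unfolded less_top] by (auto simp: integrable_iff_bounded ennreal_mult_less_top)
    finally show "(\<integral>\<^sup>+w. ennreal (norm (norm (snd w) powr p)) \<partial>(A \<Otimes>\<^sub>M B)) < \<infinity>" .
  qed measurable
  show ?thesis
    by (rule Bochner_Integration.integrable_bound[of _ "\<lambda>w. 2 powr p * (norm (fst w) powr p + norm (snd w) powr p)"])
       (use 1 2 norm_diff_powr_le[OF p] in auto)
qed

text \<open>\<open>powr_as_exp_tail_integral\<close> with \<open>r = |x - y|\<^sup>2\<close> and \<open>\<alpha> = p / 2\<close>, integrated over a product measure.\<close>
lemma exp_tail_energy_pair:
  fixes A B :: "'a::euclidean_space measure"
  assumes "finite_measure A" "finite_measure B" and sets [measurable_cong]: "sets A = sets borel" "sets B = sets borel"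
    and p: "2 * real k < p" "p < 2 * real k + 2"
    and int: "integrable A (\<lambda>x. norm x powr p)" "integrable B (\<lambda>x. norm x powr p)"
    and C: "C > 0" "\<And>r. r \<ge> 0 \<Longrightarrow>
    (\<integral>\<^sup>+s. ennreal (tail_weight k (p / 2) r s) \<partial>lborel) = ennreal (C * r powr (p / 2))"
  shows "s > 0 \<Longrightarrow> integrable (A \<Otimes>\<^sub>M B) (\<lambda>w. exp_tail k (s * (norm (fst w - snd w))\<^sup>2))" (is "_ \<Longrightarrow> ?I s")
    and "has_bochner_integral lborel
      (\<lambda>s. indicator {0<..} s * ((\<integral>w. exp_tail k (s * (norm (fst w - snd w))\<^sup>2) \<partial>(A \<Otimes>\<^sub>M B)) * s powr (- (p / 2) - 1)))
      (C * (\<integral>w. norm (fst w - snd w) powr p \<partial>(A \<Otimes>\<^sub>M B)))" (is ?B)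
proof -
  interpret A: finite_measure A by fact
  interpret B: finite_measure B by fact
  interpret P: finite_measure "A \<Otimes>\<^sub>M B" by (intro finite_measure_pair_measure) fact+
  interpret PL: pair_sigma_finite "A \<Otimes>\<^sub>M B" "lborel :: real measure" ..
  have pp: "p > 0" using p(1) by (rule order_le_less_trans[rotated]) simp
  have ip: "integrable (A \<Otimes>\<^sub>M B) (\<lambda>w. norm (fst w - snd w) powr p)"
    using assms pp by (intro integrable_norm_diff_pair) auto
  have sq: "(u\<^sup>2) powr (p / 2) = u powr p" if "u \<ge> 0" for u :: real
  proof (cases "u = 0")
    case False
    then have "u\<^sup>2 = u powr 2" using that by simp
    then show ?thesis by (simp add: powr_powr)
  qed simp
  show I: "?I s" if "s > 0" for s
  proof (rule Bochner_Integration.integrable_bound[of _ "\<lambda>w. (real k + 3) * s powr (p / 2) * norm (fst w - snd w) powr p"])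
    show "integrable (A \<Otimes>\<^sub>M B) (\<lambda>w. (real k + 3) * s powr (p / 2) * norm (fst w - snd w) powr p)"
      using ip by (rule integrable_mult_right)
    show "AE w in A \<Otimes>\<^sub>M B. norm (exp_tail k (s * (norm (fst w - snd w))\<^sup>2)) \<le> norm ((real k + 3) * s powr (p / 2) * norm (fst w - snd w) powr p)"
    proof (rule AE_I2)
      fix w :: "'a \<times> 'a"
      let ?u = "norm (fst w - snd w)"
      have "exp_tail k (s * ?u\<^sup>2) \<le> (real k + 3) * (s * ?u\<^sup>2) powr (p / 2)"
        using that p by (intro exp_tail_le_powr[of _ k "p / 2"]) auto
      also have "(s * ?u\<^sup>2) powr (p / 2) = s powr (p / 2) * ?u powr p"
        using that by (subst powr_mult) (auto simp: sq)
      finally show "norm (exp_tail k (s * ?u\<^sup>2)) \<le> norm ((real k + 3) * s powr (p / 2) * ?u powr p)"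
        using that by (simp add: exp_tail_nonneg mult.assoc)
    qed
  qed measurable
  let ?F = "\<lambda>s. indicator {0<..} s * ((\<integral>w. exp_tail k (s * (norm (fst w - snd w))\<^sup>2) \<partial>(A \<Otimes>\<^sub>M B)) * s powr (- (p / 2) - 1))"
  have Fnn: "?F s \<ge> 0" for s
    by (auto simp: indicator_def intro!: mult_nonneg_nonneg integral_nonneg_AE AE_I2 exp_tail_nonneg)
  have e: "ennreal (?F s) = (\<integral>\<^sup>+w. ennreal (indicator {0<..} s * (exp_tail k (s * (norm (fst w - snd w))\<^sup>2) * s powr (- (p / 2) - 1))) \<partial>(A \<Otimes>\<^sub>M B))" for s
  proof (cases "s > 0")
    case True
    have "ennreal (?F s) = ennreal (\<integral>w. exp_tail k (s * (norm (fst w - snd w))\<^sup>2) * s powr (- (p / 2) - 1) \<partial>(A \<Otimes>\<^sub>M B))"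
      using True by simp
    also have "\<dots> = (\<integral>\<^sup>+w. ennreal (exp_tail k (s * (norm (fst w - snd w))\<^sup>2) * s powr (- (p / 2) - 1)) \<partial>(A \<Otimes>\<^sub>M B))"
      using I[OF True] True by (intro nn_integral_eq_integral[symmetric] integrable_mult_left) (auto intro!: mult_nonneg_nonneg exp_tail_nonneg)
    finally show ?thesis using True by simp
  qed simp
  have "(\<integral>\<^sup>+s. ennreal (?F s) \<partial>lborel) = (\<integral>\<^sup>+w. (\<integral>\<^sup>+s. ennreal (indicator {0<..} s * (exp_tail k (s * (norm (fst w - snd w))\<^sup>2) * s powr (- (p / 2) - 1))) \<partial>lborel) \<partial>(A \<Otimes>\<^sub>M B))"
    unfolding e by (rule PL.Fubini') measurable
  also have "\<dots> = (\<integral>\<^sup>+w. ennreal (C * norm (fst w - snd w) powr p) \<partial>(A \<Otimes>\<^sub>M B))"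
    by (subst C(2)) (auto simp: sq)
  also have "\<dots> = ennreal (\<integral>w. C * norm (fst w - snd w) powr p \<partial>(A \<Otimes>\<^sub>M B))"
    using C(1) ip by (intro nn_integral_eq_integral) auto
  also have "(\<integral>w. C * norm (fst w - snd w) powr p \<partial>(A \<Otimes>\<^sub>M B)) = C * (\<integral>w. norm (fst w - snd w) powr p \<partial>(A \<Otimes>\<^sub>M B))"
    by simp
  finally show ?B
    using Fnn C(1) by (intro has_bochner_integral_nn_integral) auto
qed

lemma gaussian_transform_continuous:
  fixes A :: "'a::euclidean_space measure"
  assumes "finite_measure A" and sets [measurable_cong]: "sets A = sets borel"
  shows "continuous_on ({0<..} \<times> UNIV) (\<lambda>(s, z). \<integral>x. gauss s (x - z) \<partial>A)"
  unfolding continuous_on_sequentially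
proof (intro allI ballI impI, elim conjE)
  interpret finite_measure A by fact
  fix X :: "nat \<Rightarrow> real \<times> 'a" and a assume a: "a \<in> {0<..} \<times> UNIV" and X: "\<forall>n. X n \<in> {0<..} \<times> UNIV" "X \<longlonglongrightarrow> a"
  have "(\<lambda>n. \<integral>x. exp (- fst (X n) * (norm (x - snd (X n)))\<^sup>2) \<partial>A) \<longlonglongrightarrow> (\<integral>x. exp (- fst a * (norm (x - snd a))\<^sup>2) \<partial>A)"
  proof (rule integral_dominated_convergence[where w = "\<lambda>_. 1"])
    show "AE x in A. (\<lambda>n. exp (- fst (X n) * (norm (x - snd (X n)))\<^sup>2)) \<longlonglongrightarrow> exp (- fst a * (norm (x - snd a))\<^sup>2)"
      by (intro AE_I2 tendsto_intros X)
    fix n show "AE x in A. norm (exp (- fst (X n) * (norm (x - snd (X n)))\<^sup>2)) \<le> 1"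
      using X(1)[rule_format, of n] by (auto simp: mem_Times_iff)
  qed auto
  then show "((\<lambda>(s, z). \<integral>x. gauss s (x - z) \<partial>A) \<circ> X) \<longlonglongrightarrow> (case a of (s, z) \<Rightarrow> \<integral>x. gauss s (x - z) \<partial>A)"
    by (simp add: comp_def case_prod_beta)
qed

text \<open>Signed measures are represented as finite combinations \<open>\<Sum> c\<^sub>i M\<^sub>i\<close> of finite measures. If the potential
of such a combination for the kernel \<open>h\<close> vanishes identically, so does its energy.\<close>
lemma integral_pair_combination_zero:
  fixes I :: "'i set" and c :: "'i \<Rightarrow> real" and M :: "'i \<Rightarrow> 'a::euclidean_space measure"
  assumes fin: "finite I" "\<And>i. i \<in> I \<Longrightarrow> finite_measure (M i)"
    and int: "\<And>i j. i \<in> I \<Longrightarrow> j \<in> I \<Longrightarrow> integrable (M i \<Otimes>\<^sub>M M j) (\<lambda>w. h (fst w) (snd w))"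
    and zero: "\<And>y. (\<Sum>i\<in>I. c i * (\<integral>x. h x y \<partial>M i)) = 0"
  shows "(\<Sum>i\<in>I. \<Sum>j\<in>I. c i * c j * (\<integral>w. h (fst w) (snd w) \<partial>(M i \<Otimes>\<^sub>M M j))) = 0"
proof -
  have snd: "(\<integral>w. h (fst w) (snd w) \<partial>(M i \<Otimes>\<^sub>M M j)) = (\<integral>y. (\<integral>x. h x y \<partial>M i) \<partial>M j)"
    and isnd: "integrable (M j) (\<lambda>y. \<integral>x. h x y \<partial>M i)" if "i \<in> I" "j \<in> I" for i j
  proof -
    interpret A: finite_measure "M i" by (rule fin(2)) fact
    interpret B: finite_measure "M j" by (rule fin(2)) fact
    interpret AB: pair_sigma_finite "M i" "M j" ..
    have *: "integrable (M i \<Otimes>\<^sub>M M j) (case_prod h)" using int[OF that] by (simp add: case_prod_beta')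
    show "(\<integral>w. h (fst w) (snd w) \<partial>(M i \<Otimes>\<^sub>M M j)) = (\<integral>y. (\<integral>x. h x y \<partial>M i) \<partial>M j)"
      using AB.integral_snd[OF *] by (simp add: case_prod_beta')
    show "integrable (M j) (\<lambda>y. \<integral>x. h x y \<partial>M i)" using AB.integrable_snd[OF *] .
  qed
  have "(\<Sum>i\<in>I. \<Sum>j\<in>I. c i * c j * (\<integral>w. h (fst w) (snd w) \<partial>(M i \<Otimes>\<^sub>M M j)))
    = (\<Sum>j\<in>I. \<Sum>i\<in>I. c j * (\<integral>y. c i * (\<integral>x. h x y \<partial>M i) \<partial>M j))"
    by (subst sum.swap) (auto intro!: sum.cong simp: snd)
  also have "\<dots> = (\<Sum>j\<in>I. c j * (\<integral>y. (\<Sum>i\<in>I. c i * (\<integral>x. h x y \<partial>M i)) \<partial>M j))"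
  proof (rule sum.cong[OF refl])
    fix j assume j: "j \<in> I"
    have "(\<integral>y. (\<Sum>i\<in>I. c i * (\<integral>x. h x y \<partial>M i)) \<partial>M j) = (\<Sum>i\<in>I. \<integral>y. c i * (\<integral>x. h x y \<partial>M i) \<partial>M j)"
      using j by (intro Bochner_Integration.integral_sum integrable_mult_right isnd)
    then show "(\<Sum>i\<in>I. c j * (\<integral>y. c i * (\<integral>x. h x y \<partial>M i) \<partial>M j)) = c j * (\<integral>y. (\<Sum>i\<in>I. c i * (\<integral>x. h x y \<partial>M i)) \<partial>M j)"
      by (simp only: sum_distrib_left)
  qed
  also have "\<dots> = 0" by (simp add: zero)
  finally show ?thesis .
qed

text \<open>The energy argument. The kernel \<open>|x - y|\<^sup>p\<close> is a positive mixture over \<open>s\<close> of the kernels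
\<open>\<plusminus> (exp (- s |x - y|\<^sup>2) - polynomial)\<close>. The assumption on even moments makes the polynomial
energies vanish, so a mixture of the nonnegative Gaussian energies \<open>Q s\<close> vanishes. Hence
\<open>Q s = 0\<close> for almost every \<open>s\<close>, and up to a positive factor \<open>Q s\<close> is the
squared \<open>L\<^sup>2\<close> norm of the Gaussian transform \<open>G (2 s)\<close>.\<close>
lemma riesz_and_even_moments_zero_imp_gaussian_zero:
  fixes I :: "'i set" and c :: "'i \<Rightarrow> real" and M :: "'i \<Rightarrow> 'a::euclidean_space measure"
  assumes finI: "finite I" and fin: "\<And>i. i \<in> I \<Longrightarrow> finite_measure (M i)"
    and sets: "\<And>i. i \<in> I \<Longrightarrow> sets (M i) = sets borel"
    and p: "2 * real k < p" "p < 2 * real k + 2"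
    and int: "\<And>i. i \<in> I \<Longrightarrow> integrable (M i) (\<lambda>x. norm x powr p)"
    and pot: "\<And>y. (\<Sum>i\<in>I. c i * (\<integral>x. norm (x - y) powr p \<partial>M i)) = 0"
    and mom: "\<And>y l. l \<le> k \<Longrightarrow> (\<Sum>i\<in>I. c i * (\<integral>x. norm (x - y) ^ (2 * l) \<partial>M i)) = 0"
    and "s > 0"
  shows "(\<Sum>i\<in>I. c i * (\<integral>x. gauss s (x - z) \<partial>M i)) = 0"
proof -
  let ?N = "\<lambda>i j. M i \<Otimes>\<^sub>M M j"
  let ?E = "\<lambda>s i j. \<integral>w. gauss s (fst w - snd w) \<partial>(?N i j)"
  let ?H = "\<lambda>l i j. \<integral>w. norm (fst w - snd w) ^ (2 * l) \<partial>(?N i j)"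
  have pp: "p > 0" using p(1) by (rule order_le_less_trans[rotated]) simp
  have finN: "finite_measure (?N i j)" if "i \<in> I" "j \<in> I" for i j
    using that fin by (intro finite_measure_pair_measure)
  have meas: "f \<in> borel_measurable (?N i j)" if "f \<in> borel_measurable (borel \<Otimes>\<^sub>M borel)" "i \<in> I" "j \<in> I" for f :: "_ \<Rightarrow> real" and i j
    using that sets by (subst measurable_cong_sets[OF sets_pair_measure_cong refl]) auto
  have ip: "integrable (?N i j) (\<lambda>w. norm (fst w - snd w) powr p)" if "i \<in> I" "j \<in> I" for i j
    using that fin sets int pp by (intro integrable_norm_diff_pair) auto
  have il: "integrable (?N i j) (\<lambda>w. norm (fst w - snd w) ^ (2 * l))" if "i \<in> I" "j \<in> I" "l \<le> k" for i j l
  proof -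
    interpret finite_measure "?N i j" using finN that by blast
    show ?thesis
    proof (rule Bochner_Integration.integrable_bound[of _ "\<lambda>w. 1 + norm (fst w - snd w) powr p"])
      show "integrable (?N i j) (\<lambda>w. 1 + norm (fst w - snd w) powr p)" using ip that by auto
      show "(\<lambda>w. norm (fst w - snd w) ^ (2 * l)) \<in> borel_measurable (?N i j)"
        by (rule meas) (use that in measurable)
      have "real (2 * l) \<le> p" using that p by simp
      then show "AE w in ?N i j. norm (norm (fst w - snd w) ^ (2 * l)) \<le> norm (1 + norm (fst w - snd w) powr p)"
        by (intro AE_I2) (use power_le_one_plus_powr in auto)
    qed
  qed
  obtain C where C: "C > 0" "\<And>r. r \<ge> 0 \<Longrightarrow>
    (\<integral>\<^sup>+s. ennreal (tail_weight k (p / 2) r s) \<partial>lborel) = ennreal (C * r powr (p / 2))"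
    using powr_as_exp_tail_integral[of k "p / 2"] p by auto
  define A where "A = (\<lambda>i j s. \<integral>w. exp_tail k (s * (norm (fst w - snd w))\<^sup>2) \<partial>(?N i j))"
  define Q where "Q = (\<lambda>s. \<Sum>i\<in>I. \<Sum>j\<in>I. c i * c j * ?E s i j)"
  note pair = exp_tail_energy_pair[OF fin fin sets sets p int int C]
  have "has_bochner_integral lborel
      (\<lambda>s. \<Sum>i\<in>I. \<Sum>j\<in>I. c i * c j * (indicator {0<..} s * (A i j s * s powr (- (p / 2) - 1))))
      (\<Sum>i\<in>I. \<Sum>j\<in>I. c i * c j * (C * (\<integral>w. norm (fst w - snd w) powr p \<partial>(?N i j))))"
    unfolding A_def by (intro has_bochner_integral_sum has_bochner_integral_mult_right pair(2))
  also have "(\<Sum>i\<in>I. \<Sum>j\<in>I. c i * c j * (C * (\<integral>w. norm (fst w - snd w) powr p \<partial>(?N i j))))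
    = C * (\<Sum>i\<in>I. \<Sum>j\<in>I. c i * c j * (\<integral>w. norm (fst w - snd w) powr p \<partial>(?N i j)))"
    by (simp add: sum_distrib_left mult_ac)
  also have "(\<Sum>i\<in>I. \<Sum>j\<in>I. c i * c j * (\<integral>w. norm (fst w - snd w) powr p \<partial>(?N i j))) = 0"
    by (rule integral_pair_combination_zero[OF finI fin ip pot])
  finally have hb: "has_bochner_integral lborel
      (\<lambda>s. \<Sum>i\<in>I. \<Sum>j\<in>I. c i * c j * (indicator {0<..} s * (A i j s * s powr (- (p / 2) - 1)))) 0" by simp
  \<comment> \<open>Expanding \<open>exp_tail\<close>: the even moments contribute nothing.\<close>
  have A_Q: "(\<Sum>i\<in>I. \<Sum>j\<in>I. c i * c j * A i j s) = (- 1) ^ (k + 1) * Q s" if s: "s > 0" for s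
  proof -
    have Aij: "A i j s = (- 1) ^ (k + 1) * (?E s i j
       - (\<Sum>l\<le>k. (- s) ^ l / fact l * ?H l i j))" if ij: "i \<in> I" "j \<in> I" for i j
    proof -
      interpret finite_measure "?N i j" using finN ij by blast
      have pw: "(- (s * u\<^sup>2)) ^ l / fact l = (- s) ^ l / fact l * u ^ (2 * l)" for u :: real and l
        by (simp only: mult_minus_left[symmetric] power_mult_distrib power_mult times_divide_eq_left)
      have ie: "integrable (?N i j) (\<lambda>w. gauss s (fst w - snd w))"
      proof (rule integrable_const_bound[of _ 1])
        show "AE w in ?N i j. norm (gauss s (fst w - snd w)) \<le> 1" using s by simp
        show "(\<lambda>w. gauss s (fst w - snd w)) \<in> borel_measurable (?N i j)"
          by (rule meas[OF _ ij]) measurable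
      qed
      have "A i j s = (\<integral>w. (- 1) ^ (k + 1) * (gauss s (fst w - snd w) - (\<Sum>l\<le>k. (- s) ^ l / fact l * norm (fst w - snd w) ^ (2 * l))) \<partial>(?N i j))"
        unfolding A_def exp_tail_def mult_minus_left
        by (intro Bochner_Integration.integral_cong refl) (simp only: pw)
      also have "\<dots> = (- 1) ^ (k + 1) * (\<integral>w. gauss s (fst w - snd w) - (\<Sum>l\<le>k. (- s) ^ l / fact l * norm (fst w - snd w) ^ (2 * l)) \<partial>(?N i j))"
        by (rule integral_mult_right_zero)
      also have "(\<integral>w. gauss s (fst w - snd w) - (\<Sum>l\<le>k. (- s) ^ l / fact l * norm (fst w - snd w) ^ (2 * l)) \<partial>(?N i j))
        = ?E s i j - (\<integral>w. (\<Sum>l\<le>k. (- s) ^ l / fact l * norm (fst w - snd w) ^ (2 * l)) \<partial>(?N i j))"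
        by (intro Bochner_Integration.integral_diff ie Bochner_Integration.integrable_sum integrable_mult_right il ij) auto
      also have "(\<integral>w. (\<Sum>l\<le>k. (- s) ^ l / fact l * norm (fst w - snd w) ^ (2 * l)) \<partial>(?N i j))
        = (\<Sum>l\<le>k. (- s) ^ l / fact l * ?H l i j)"
        by (subst Bochner_Integration.integral_sum) (auto intro!: integrable_mult_right il ij)
      finally show ?thesis .
    qed
    have "(\<Sum>i\<in>I. \<Sum>j\<in>I. c i * c j * A i j s) = (\<Sum>i\<in>I. \<Sum>j\<in>I. (- 1) ^ (k + 1) * (c i * c j * ?E s i j)
       - (\<Sum>l\<le>k. (- 1) ^ (k + 1) * ((- s) ^ l / fact l) * (c i * c j * ?H l i j)))"
      by (intro sum.cong refl) (simp add: Aij right_diff_distrib sum_distrib_left mult_ac)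
    also have "\<dots> = (- 1) ^ (k + 1) * Q s - (\<Sum>i\<in>I. \<Sum>j\<in>I. \<Sum>l\<le>k. (- 1) ^ (k + 1) * ((- s) ^ l / fact l) * (c i * c j * ?H l i j))"
      unfolding Q_def sum_subtractf by (simp only: sum_distrib_left)
    also have "(\<Sum>i\<in>I. \<Sum>j\<in>I. \<Sum>l\<le>k. (- 1) ^ (k + 1) * ((- s) ^ l / fact l) * (c i * c j * ?H l i j))
      = (\<Sum>l\<le>k. \<Sum>i\<in>I. \<Sum>j\<in>I. (- 1) ^ (k + 1) * ((- s) ^ l / fact l) * (c i * c j * ?H l i j))"
      by (simp only: sum.swap[of _ _ "{..k}"])
    also have "\<dots> = (\<Sum>l\<le>k. (- 1) ^ (k + 1) * ((- s) ^ l / fact l) * (\<Sum>i\<in>I. \<Sum>j\<in>I. c i * c j * ?H l i j))"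
      by (simp only: sum_distrib_left)
    also have "\<dots> = 0"
      by (rule sum.neutral) (auto intro!: integral_pair_combination_zero[OF finI fin il mom])
    finally show ?thesis by simp
  qed
  define G where "G = (\<lambda>s z. \<Sum>i\<in>I. c i * (\<integral>x. gauss s (x - z) \<partial>M i))"
  define K where "K = (\<lambda>s. (\<integral>z. gauss (4 * s) z \<partial>(lborel :: 'a measure)))"
  have Kpos: "K s > 0" if "s > 0" for s unfolding K_def using that by (intro gaussian_integral_pos) simp
  have GQ: "has_bochner_integral lborel (\<lambda>z. (G (2 * s) z)\<^sup>2) (K s * Q s)" if s: "s > 0" for s
  proof -
    have "has_bochner_integral lborel (\<lambda>z. \<Sum>i\<in>I. \<Sum>j\<in>I. c i * c j * ((\<integral>x. exp (- 2 * s * (norm (x - z))\<^sup>2) \<partial>M i) * (\<integral>x. exp (- 2 * s * (norm (x - z))\<^sup>2) \<partial>M j)))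
       (\<Sum>i\<in>I. \<Sum>j\<in>I. c i * c j * (K s * ?E s i j))"
      unfolding K_def by (intro has_bochner_integral_sum has_bochner_integral_mult_right gaussian_energy_pair fin sets s)
    moreover have "(G (2 * s) z)\<^sup>2 = (\<Sum>i\<in>I. \<Sum>j\<in>I. c i * c j * ((\<integral>x. exp (- 2 * s * (norm (x - z))\<^sup>2) \<partial>M i) * (\<integral>x. exp (- 2 * s * (norm (x - z))\<^sup>2) \<partial>M j)))" for z
      unfolding G_def power2_eq_square sum_product by (intro sum.cong refl) (simp add: mult_ac)
    moreover have "(\<Sum>i\<in>I. \<Sum>j\<in>I. c i * c j * (K s * ?E s i j)) = K s * Q s"
      unfolding Q_def by (simp add: sum_distrib_left mult_ac)
    ultimately show ?thesis by simp
  qed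
  have Qnn: "Q s \<ge> 0" if s: "s > 0" for s
  proof -
    have "K s * Q s = (\<integral>z. (G (2 * s) z)\<^sup>2 \<partial>lborel)" using GQ[OF s] by (simp add: has_bochner_integral_integral_eq)
    also have "\<dots> \<ge> 0" by simp
    finally show ?thesis using Kpos[OF s] by (simp add: zero_le_mult_iff)
  qed
  have AE_Q: "AE s in lborel. s > 0 \<longrightarrow> Q s = 0"
  proof -
    let ?W = "\<lambda>s. indicator {0<..} s * (Q s * s powr (- (p / 2) - 1))"
    have "has_bochner_integral lborel (\<lambda>s. (- 1) ^ (k + 1) * (\<Sum>i\<in>I. \<Sum>j\<in>I. c i * c j * (indicator {0<..} s * (A i j s * s powr (- (p / 2) - 1))))) ((- 1) ^ (k + 1) * 0)"
      by (rule has_bochner_integral_mult_right[OF hb])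
    moreover have "(- 1) ^ (k + 1) * (\<Sum>i\<in>I. \<Sum>j\<in>I. c i * c j * (indicator {0<..} s * (A i j s * s powr (- (p / 2) - 1)))) = ?W s" for s
    proof (cases "s > 0")
      case True
      have "(\<Sum>i\<in>I. \<Sum>j\<in>I. c i * c j * (A i j s * s powr (- (p / 2) - 1))) = (\<Sum>i\<in>I. \<Sum>j\<in>I. c i * c j * A i j s) * s powr (- (p / 2) - 1)"
        by (simp only: sum_distrib_right mult.assoc)
      then have "(- 1) ^ (k + 1) * (\<Sum>i\<in>I. \<Sum>j\<in>I. c i * c j * (A i j s * s powr (- (p / 2) - 1))) = ((- 1) ^ (k + 1) * (- 1) ^ (k + 1)) * Q s * s powr (- (p / 2) - 1)"
        unfolding A_Q[OF True] by (simp only: mult.assoc)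
      also have "(- 1 :: real) ^ (k + 1) * (- 1) ^ (k + 1) = 1" by (simp add: power_mult_distrib[symmetric])
      finally show ?thesis using True by simp
    qed simp
    ultimately have "has_bochner_integral lborel ?W 0" by simp
    moreover have "?W s \<ge> 0" for s using Qnn by (auto simp: indicator_def)
    ultimately have "AE s in lborel. ?W s = 0"
      using integral_nonneg_eq_0_iff_AE[of lborel ?W] by (auto simp: has_bochner_integral_iff)
    then show ?thesis by eventually_elim (auto simp: indicator_def)
  qed
  have Gcont: "continuous_on ({0<..} \<times> UNIV) (\<lambda>(s, z). G s z)"
  proof -
    have "continuous_on ({0<..} \<times> UNIV) (\<lambda>w. \<Sum>i\<in>I. c i * (case w of (s, z) \<Rightarrow> \<integral>x. gauss s (x - z) \<partial>M i))"
      by (intro continuous_on_sum continuous_on_mult_left gaussian_transform_continuous fin sets)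
    then show ?thesis by (simp add: G_def case_prod_beta)
  qed
  have G0: "G (2 * s) z = 0" if "s > 0" "Q s = 0" for s z
  proof -
    have "has_bochner_integral lborel (\<lambda>z. (G (2 * s) z)\<^sup>2) 0" using GQ[OF that(1)] that(2) by simp
    then have "AE z in lborel. (G (2 * s) z)\<^sup>2 = 0"
      using integral_nonneg_eq_0_iff_AE[of lborel "\<lambda>z. (G (2 * s) z)\<^sup>2"] by (auto simp: has_bochner_integral_iff)
    then have "AE z in lborel. z \<in> UNIV \<longrightarrow> G (2 * s) z = 0" by simp
    moreover have "continuous_on UNIV (\<lambda>z. case (2 * s, z) of (s, z) \<Rightarrow> G s z)"
      by (rule continuous_on_compose2[OF Gcont]) (use that in \<open>auto intro!: continuous_intros\<close>)
    ultimately show ?thesis using continuous_AE_zero_imp_zero[of UNIV "G (2 * s)" z] by simp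
  qed
  \<comment> \<open>The exceptional null set of parameters is removed by continuity in \<open>s\<close>.\<close>
  have "G (2 * (s / 2)) z = 0"
  proof (rule continuous_AE_zero_imp_zero[of "{0<..}" "\<lambda>s. G (2 * s) z"])
    show "AE s in lborel. s \<in> {0<..} \<longrightarrow> G (2 * s) z = 0"
      using AE_Q by eventually_elim (use G0 in auto)
    have "continuous_on {0<..} (\<lambda>s. case (2 * s, z) of (s, z) \<Rightarrow> G s z)"
      by (rule continuous_on_compose2[OF Gcont]) (auto intro!: continuous_intros)
    then show "continuous_on {0<..} (\<lambda>s. G (2 * s) z)" by simp
  qed (use \<open>s > 0\<close> in auto)
  then show ?thesis by (simp add: G_def)
qed

section \<open>Riesz potentials determine a finite measure\<close>

lemma alternating_binomial_Suc:
  fixes f :: "nat \<Rightarrow> real"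
  shows "(\<Sum>j\<le>Suc m. (- 1) ^ j * real (Suc m choose j) * f j) = (\<Sum>j\<le>m. (- 1) ^ j * real (m choose j) * (f j - f (Suc j)))"
proof -
  have "(\<Sum>j\<le>Suc m. (- 1) ^ j * real (Suc m choose j) * f j)
     = f 0 + (\<Sum>j\<le>m. (- 1) ^ Suc j * real (m choose Suc j) * f (Suc j)) - (\<Sum>j\<le>m. (- 1) ^ j * real (m choose j) * f (Suc j))"
    by (subst sum.atMost_Suc_shift) (simp add: algebra_simps sum.distrib sum_subtractf sum_negf)
  also have "f 0 + (\<Sum>j\<le>m. (- 1) ^ Suc j * real (m choose Suc j) * f (Suc j)) = (\<Sum>j\<le>Suc m. (- 1) ^ j * real (m choose j) * f j)"
    by (subst sum.atMost_Suc_shift) simp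
  also have "\<dots> = (\<Sum>j\<le>m. (- 1) ^ j * real (m choose j) * f j)" by simp
  finally show ?thesis by (simp add: algebra_simps sum_subtractf)
qed

text \<open>The \<open>m\<close>-th difference of a polynomial of degree below \<open>m\<close>; each difference lowers the degree.\<close>
lemma alternating_binomial_poly:
  fixes q :: "real poly"
  assumes "degree q < m"
  shows "(\<Sum>j\<le>m. (- 1) ^ j * real (m choose j) * poly q (real j)) = 0"
  using assms
proof (induction m arbitrary: q)
  case (Suc m)
  define r where "r = q - q \<circ>\<^sub>p [:1, 1:]"
  have r: "poly q (real j) - poly q (real (Suc j)) = poly r (real j)" for j
    by (simp add: r_def poly_pcompose add.commute)
  have "(\<Sum>j\<le>m. (- 1) ^ j * real (m choose j) * poly r (real j)) = 0"
  proof (cases "degree q = 0")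
    case True
    then obtain a where "q = [:a:]" using degree_eq_zeroE by blast
    then show ?thesis by (simp add: r_def)
  next
    case False
    have "degree r < degree q"
    proof (rule degree_lessI)
      show "r \<noteq> 0 \<or> degree q > 0" using False by simp
      show "\<forall>i\<ge>degree q. coeff r i = 0"
      proof (intro allI impI)
        fix i assume "degree q \<le> i"
        show "coeff r i = 0"
        proof (cases "i = degree q")
          case True
          have "lead_coeff (q \<circ>\<^sub>p [:1, 1:]) = lead_coeff q" by (subst lead_coeff_comp) auto
          moreover have "degree (q \<circ>\<^sub>p [:1, 1:]) = degree q" by (simp add: degree_pcompose)
          ultimately show ?thesis using True by (simp add: r_def)
        next
          case False
          then show ?thesis using \<open>degree q \<le> i\<close> by (simp add: r_def coeff_eq_0 degree_pcompose)
        qed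
      qed
    qed
    then show ?thesis using Suc by simp
  qed
  then show ?case unfolding alternating_binomial_Suc by (simp only: r)
qed simp

lemma norm_power_along_line_poly:
  fixes v a :: "'a::real_inner"
  obtains q where "degree q \<le> 2 * l" "\<And>t. norm (v + t *\<^sub>R a) ^ (2 * l) = poly q t"
proof -
  define q0 where "q0 = [:v \<bullet> v, 2 * (v \<bullet> a), a \<bullet> a:]"
  have "norm (v + t *\<^sub>R a) ^ (2 * l) = poly (q0 ^ l) t" for t
  proof -
    have "(norm (v + t *\<^sub>R a))\<^sup>2 = poly q0 t"
      unfolding power2_norm_eq_inner q0_def by (simp add: inner_simps inner_commute algebra_simps)
    then show ?thesis by (simp add: power_mult)
  qed
  moreover have "degree (q0 ^ l) \<le> 2 * l"
  proof -
    have "degree q0 \<le> 2" unfolding q0_def by (simp add: degree_pCons_le le_trans[OF degree_pCons_le])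
    then show ?thesis using degree_power_le[of q0 l] by (meson le_trans mult_le_mono1)
  qed
  ultimately show ?thesis using that by blast
qed

lemma integrable_shift_powr:
  fixes A :: "'a::euclidean_space measure"
  assumes "finite_measure A" and sets [measurable_cong]: "sets A = sets borel" and p: "p > 0"
    and int: "integrable A (\<lambda>x. norm x powr p)"
  shows "integrable A (\<lambda>x. norm (x + a) powr p)"
proof -
  interpret finite_measure A by fact
  show ?thesis
  proof (rule Bochner_Integration.integrable_bound[of _ "\<lambda>x. 2 powr p * (norm x powr p + norm (- a) powr p)"])
    show "integrable A (\<lambda>x. 2 powr p * (norm x powr p + norm (- a) powr p))"
      using int by auto
    show "AE x in A. norm (norm (x + a) powr p) \<le> norm (2 powr p * (norm x powr p + norm (- a) powr p))"
      using norm_diff_powr_le[OF p, of _ "- a"] by (intro AE_I2) simp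
  qed measurable
qed

text \<open>The moment condition of \<open>riesz_and_even_moments_zero_imp_gaussian_zero\<close> is removed by applying
that lemma to the \<open>m\<close>-th difference, in a direction \<open>n b\<close>, of the signed measure: differences of order
\<open>m = 2 k + 1\<close> annihilate \<open>|x - y| ^ (2 l)\<close> for \<open>l \<le> k\<close> and keep the potentials zero. As \<open>n\<close> tends to
infinity, all translated copies escape to infinity except the one with index \<open>0\<close>.\<close>
lemma riesz_potential_zero_imp_gaussian_zero:
  fixes I :: "'i set" and c :: "'i \<Rightarrow> real" and M :: "'i \<Rightarrow> 'a::euclidean_space measure"
  assumes finI: "finite I" and fin: "\<And>i. i \<in> I \<Longrightarrow> finite_measure (M i)"
    and sets: "\<And>i. i \<in> I \<Longrightarrow> sets (M i) = sets borel"
    and p: "2 * real k < p" "p < 2 * real k + 2"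
    and int: "\<And>i. i \<in> I \<Longrightarrow> integrable (M i) (\<lambda>x. norm x powr p)"
    and pot: "\<And>y. (\<Sum>i\<in>I. c i * (\<integral>x. norm (x - y) powr p \<partial>M i)) = 0"
    and "s > 0"
  shows "(\<Sum>i\<in>I. c i * (\<integral>x. gauss s (x - z) \<partial>M i)) = 0"
proof -
  have pp: "p > 0" using p(1) by (rule order_le_less_trans[rotated]) simp
  define m where "m = 2 * k + 1"
  obtain b :: 'a where b: "b \<in> Basis" using nonempty_Basis by blast
  define B where "B = (\<lambda>j. (- 1) ^ j * real (m choose j))"
  define g where "g = (\<lambda>t. \<Sum>i\<in>I. c i * (\<integral>x. gauss s (x + t *\<^sub>R b - z) \<partial>M i))"
  have meas: "f \<in> borel_measurable (M i)" if "f \<in> borel_measurable borel" "i \<in> I" for f :: "_ \<Rightarrow> real" and i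
    using that sets by (subst measurable_cong_sets[OF _ refl]) auto
  have mshift: "(\<lambda>x. x + a) \<in> measurable (M i) borel" if "i \<in> I" for i and a :: 'a
    using that sets by (subst measurable_cong_sets[OF _ refl]) auto
  \<comment> \<open>The index set \<open>I \<times> {..m}\<close> carries the translates \<open>?M\<close> with their binomial weights.\<close>
  have main: "(\<Sum>j\<le>m. B j * g (real j * n)) = 0" for n
  proof -
    let ?M = "\<lambda>(i, j::nat). distr (M i) borel (\<lambda>x. x + (real j * n) *\<^sub>R b)"
    let ?c = "\<lambda>(i, j). c i * B j"
    have dist: "(\<Sum>u\<in>I \<times> {..m}. ?c u * (\<integral>x. h x \<partial>?M u)) = (\<Sum>j\<le>m. B j * (\<Sum>i\<in>I. c i * (\<integral>x. h (x + (real j * n) *\<^sub>R b) \<partial>M i)))"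
      if "h \<in> borel_measurable borel" for h :: "'a \<Rightarrow> real"
    proof -
      have "(\<Sum>u\<in>I \<times> {..m}. ?c u * (\<integral>x. h x \<partial>?M u)) = (\<Sum>i\<in>I. \<Sum>j\<le>m. c i * B j * (\<integral>x. h x \<partial>?M (i, j)))"
        unfolding sum.cartesian_product by (intro sum.cong) auto
      also have "\<dots> = (\<Sum>i\<in>I. \<Sum>j\<le>m. c i * B j * (\<integral>x. h (x + (real j * n) *\<^sub>R b) \<partial>M i))"
        by (intro sum.cong refl) (simp add: integral_distr[OF mshift that])
      also have "\<dots> = (\<Sum>j\<le>m. B j * (\<Sum>i\<in>I. c i * (\<integral>x. h (x + (real j * n) *\<^sub>R b) \<partial>M i)))"
        by (subst sum.swap) (simp add: sum_distrib_left mult_ac)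
      finally show ?thesis .
    qed
    have "(\<Sum>u\<in>I \<times> {..m}. ?c u * (\<integral>x. gauss s (x - z) \<partial>?M u)) = 0"
    proof (rule riesz_and_even_moments_zero_imp_gaussian_zero[OF _ _ _ p])
      show "finite (I \<times> {..m})" using finI by simp
      show "finite_measure (?M u)" if "u \<in> I \<times> {..m}" for u
        using that fin by (auto intro!: finite_measure.finite_measure_distr mshift)
      show "sets (?M u) = sets borel" for u by (auto split: prod.splits)
      show "integrable (?M u) (\<lambda>x. norm x powr p)" if "u \<in> I \<times> {..m}" for u
        using that by (auto simp: integrable_distr_eq[OF mshift] intro!: integrable_shift_powr fin sets int pp)
      show "(\<Sum>u\<in>I \<times> {..m}. ?c u * (\<integral>x. norm (x - y) powr p \<partial>?M u)) = 0" for y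
      proof -
        have "(\<Sum>i\<in>I. c i * (\<integral>x. norm (x + (real j * n) *\<^sub>R b - y) powr p \<partial>M i)) = 0" for j :: nat
          using pot[of "y - (real j * n) *\<^sub>R b"] by (simp add: algebra_simps)
        then show ?thesis by (subst dist) simp_all
      qed
      show "(\<Sum>u\<in>I \<times> {..m}. ?c u * (\<integral>x. norm (x - y) ^ (2 * l) \<partial>?M u)) = 0" if l: "l \<le> k" for y l
      proof -
        have "(\<Sum>j\<le>m. B j * (\<Sum>i\<in>I. c i * (\<integral>x. norm (x + (real j * n) *\<^sub>R b - y) ^ (2 * l) \<partial>M i)))
          = (\<Sum>i\<in>I. c i * (\<integral>x. (\<Sum>j\<le>m. B j * norm (x + (real j * n) *\<^sub>R b - y) ^ (2 * l)) \<partial>M i))"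
        proof -
          have ii: "integrable (M i) (\<lambda>x. norm (x + a - y) ^ (2 * l))" if i: "i \<in> I" for i a
          proof -
            interpret finite_measure "M i" using fin i by blast
            show ?thesis
            proof (rule Bochner_Integration.integrable_bound[of _ "\<lambda>x. 1 + norm (x + (a - y)) powr p"])
              show "integrable (M i) (\<lambda>x. 1 + norm (x + (a - y)) powr p)"
                using integrable_shift_powr[OF fin[OF i] sets[OF i] pp int[OF i], of "a - y"] by simp
              show "(\<lambda>x. norm (x + a - y) ^ (2 * l)) \<in> borel_measurable (M i)"
                by (rule meas[OF _ i]) measurable
              have "real (2 * l) \<le> p" using l p by simp
              then show "AE x in M i. norm (norm (x + a - y) ^ (2 * l)) \<le> norm (1 + norm (x + (a - y)) powr p)"
                by (intro AE_I2) (simp add: power_le_one_plus_powr add_diff_eq)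
            qed
          qed
          have "(\<integral>x. (\<Sum>j\<le>m. B j * norm (x + (real j * n) *\<^sub>R b - y) ^ (2 * l)) \<partial>M i)
            = (\<Sum>j\<le>m. B j * (\<integral>x. norm (x + (real j * n) *\<^sub>R b - y) ^ (2 * l) \<partial>M i))" if "i \<in> I" for i
            using that by (subst Bochner_Integration.integral_sum) (auto intro!: integrable_mult_right ii)
          then have "(\<Sum>i\<in>I. c i * (\<integral>x. (\<Sum>j\<le>m. B j * norm (x + (real j * n) *\<^sub>R b - y) ^ (2 * l)) \<partial>M i))
            = (\<Sum>i\<in>I. c i * (\<Sum>j\<le>m. B j * (\<integral>x. norm (x + (real j * n) *\<^sub>R b - y) ^ (2 * l) \<partial>M i)))"
            by (intro sum.cong refl) simp
          also have "\<dots> = (\<Sum>j\<le>m. B j * (\<Sum>i\<in>I. c i * (\<integral>x. norm (x + (real j * n) *\<^sub>R b - y) ^ (2 * l) \<partial>M i)))"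
            unfolding sum_distrib_left by (subst sum.swap) (intro sum.cong refl, simp add: mult_ac)
          finally show ?thesis by simp
        qed
        also have "\<dots> = 0"
        proof -
          have "(\<Sum>j\<le>m. B j * norm (x + (real j * n) *\<^sub>R b - y) ^ (2 * l)) = 0" for x
          proof -
            obtain q where q: "degree q \<le> 2 * l" "\<And>t. norm ((x - y) + t *\<^sub>R (n *\<^sub>R b)) ^ (2 * l) = poly q t"
              using norm_power_along_line_poly[of l "x - y" "n *\<^sub>R b"] by metis
            have "norm (x + (real j * n) *\<^sub>R b - y) ^ (2 * l) = poly q (real j)" for j :: nat
              using q(2)[of "real j"] by (simp add: algebra_simps)
            then show ?thesis
              using alternating_binomial_poly[of q m] q(1) l by (simp add: B_def m_def)
          qed
          then show ?thesis by simp
        qed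
        finally show ?thesis by (subst dist) simp_all
      qed
    qed (use \<open>s > 0\<close> in auto)
    then show ?thesis unfolding g_def by (subst (asm) dist) simp_all
  qed
  have lim0: "(\<lambda>n. g (real j * real n)) \<longlonglongrightarrow> 0" if j: "j > 0" for j :: nat
  proof -
    have "(\<lambda>n. \<integral>x. gauss s (x + (real j * real n) *\<^sub>R b - z) \<partial>M i) \<longlonglongrightarrow> (\<integral>x. 0 \<partial>M i)" if i: "i \<in> I" for i
    proof (rule integral_dominated_convergence[where w = "\<lambda>_. 1"])
      interpret finite_measure "M i" using fin i by blast
      show "integrable (M i) (\<lambda>_. 1::real)" by simp
      show "(\<lambda>x. gauss s (x + (real j * real n) *\<^sub>R b - z)) \<in> borel_measurable (M i)" for n
        by (rule meas[OF _ i]) measurable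
      show "AE x in M i. norm (gauss s (x + (real j * real n) *\<^sub>R b - z)) \<le> 1" for n
        using \<open>s > 0\<close> by simp
      show "AE x in M i. (\<lambda>n. gauss s (x + (real j * real n) *\<^sub>R b - z)) \<longlonglongrightarrow> 0"
      proof (rule AE_I2)
        fix x
        have "filterlim (\<lambda>n. - norm (x - z) + real n) at_top sequentially"
          by (rule filterlim_tendsto_add_at_top[OF tendsto_const filterlim_real_sequentially])
        then have "filterlim (\<lambda>n. real n - norm (x - z)) at_top sequentially" by simp
        then have "filterlim (\<lambda>n. norm (x + (real j * real n) *\<^sub>R b - z)) at_top sequentially"
        proof (rule filterlim_at_top_mono, intro always_eventually allI)
          fix n
          have "norm ((real j * real n) *\<^sub>R b) \<le> norm (x + (real j * real n) *\<^sub>R b - z) + norm (x - z)"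
            using norm_triangle_ineq4[of "x + (real j * real n) *\<^sub>R b - z" "x - z"] by (simp add: algebra_simps)
          moreover have "norm ((real j * real n) *\<^sub>R b) \<ge> real n"
            using b j by (simp add: mult_le_cancel_right1)
          ultimately show "real n - norm (x - z) \<le> norm (x + (real j * real n) *\<^sub>R b - z)" by linarith
        qed
        then have "filterlim (\<lambda>n. s * (norm (x + (real j * real n) *\<^sub>R b - z))\<^sup>2) at_top sequentially"
          using \<open>s > 0\<close> by (intro filterlim_tendsto_pos_mult_at_top[OF tendsto_const] filterlim_pow_at_top) auto
        then have "filterlim (\<lambda>n. - (s * (norm (x + (real j * real n) *\<^sub>R b - z))\<^sup>2)) at_bot sequentially"
          by (simp add: filterlim_uminus_at_bot)
        then show "(\<lambda>n. gauss s (x + (real j * real n) *\<^sub>R b - z)) \<longlonglongrightarrow> 0"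
          using filterlim_compose[OF exp_at_bot] by force
      qed
    qed simp
    then have "(\<lambda>n. \<Sum>i\<in>I. c i * (\<integral>x. gauss s (x + (real j * real n) *\<^sub>R b - z) \<partial>M i)) \<longlonglongrightarrow> (\<Sum>i\<in>I. c i * 0)"
      by (intro tendsto_sum tendsto_mult_left) simp
    then show ?thesis by (simp add: g_def)
  qed
  have "(\<lambda>n. \<Sum>j\<le>m. B j * g (real j * real n)) \<longlonglongrightarrow> (\<Sum>j\<le>m. B j * (if j = 0 then g 0 else 0))"
  proof (intro tendsto_sum tendsto_mult_left)
    fix j show "(\<lambda>n. g (real j * real n)) \<longlonglongrightarrow> (if j = 0 then g 0 else 0)"
      using lim0[of j] by (cases "j = 0") auto
  qed
  then have "(\<Sum>j\<le>m. B j * (if j = 0 then g 0 else 0)) = 0"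
    unfolding main by (simp add: LIMSEQ_const_iff)
  moreover have "(\<Sum>j\<le>m. B j * (if j = 0 then g 0 else 0)) = B 0 * g 0"
    by (subst sum.remove[of _ 0]) auto
  ultimately show ?thesis by (simp add: B_def g_def)
qed

lemma gaussian_mollification_change_of_variable:
  fixes f :: "'a::euclidean_space \<Rightarrow> ennreal"
  assumes [measurable]: "f \<in> borel_measurable borel" and n: "n > 0"
  shows "(\<integral>\<^sup>+w. f (x + (1 / n) *\<^sub>R w) * ennreal (exp (- (norm w)\<^sup>2)) \<partial>lborel)
       = ennreal (n ^ DIM('a)) * (\<integral>\<^sup>+z. f z * ennreal (gauss (n\<^sup>2) (x - z)) \<partial>lborel)"
proof -
  let ?h = "\<lambda>w. f (x + (1 / n) *\<^sub>R w) * ennreal (exp (- (norm w)\<^sup>2))"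
  have d: "lborel = density (distr lborel borel (\<lambda>z. - n *\<^sub>R x + n *\<^sub>R z)) (\<lambda>_. ennreal (\<bar>n\<bar> ^ DIM('a)))"
    using lborel_affine[of n "- n *\<^sub>R x"] n by simp
  have "(\<integral>\<^sup>+w. ?h w \<partial>lborel) = (\<integral>\<^sup>+w. ?h w \<partial>(density (distr lborel borel (\<lambda>z. - n *\<^sub>R x + n *\<^sub>R z)) (\<lambda>_. ennreal (\<bar>n\<bar> ^ DIM('a)))))"
    by (rule arg_cong[OF d, of "\<lambda>M. integral\<^sup>N M ?h"])
  also have "\<dots> = (\<integral>\<^sup>+z. ennreal (\<bar>n\<bar> ^ DIM('a)) * ?h (- n *\<^sub>R x + n *\<^sub>R z) \<partial>lborel)"
    by (subst nn_integral_density, simp, simp, subst nn_integral_distr) simp_all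
  also have "\<dots> = (\<integral>\<^sup>+z. ennreal (n ^ DIM('a)) * (f z * ennreal (gauss (n\<^sup>2) (x - z))) \<partial>lborel)"
  proof (intro nn_integral_cong)
    fix z
    have "- n *\<^sub>R x + n *\<^sub>R z = (- n) *\<^sub>R (x - z)" by (simp add: algebra_simps)
    then have "(norm (- n *\<^sub>R x + n *\<^sub>R z))\<^sup>2 = n\<^sup>2 * (norm (x - z))\<^sup>2"
      by (simp add: power_mult_distrib)
    moreover have "x + (1 / n) *\<^sub>R (- n *\<^sub>R x + n *\<^sub>R z) = z" using n by (simp add: scaleR_add_right scaleR_diff_right)
    ultimately show "ennreal (\<bar>n\<bar> ^ DIM('a)) * ?h (- n *\<^sub>R x + n *\<^sub>R z)
      = ennreal (n ^ DIM('a)) * (f z * ennreal (gauss (n\<^sup>2) (x - z)))"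
      using n by simp
  qed
  also have "\<dots> = ennreal (n ^ DIM('a)) * (\<integral>\<^sup>+z. f z * ennreal (gauss (n\<^sup>2) (x - z)) \<partial>lborel)"
    by (rule nn_integral_cmult) measurable
  finally show ?thesis .
qed

lemma gaussian_mollification_tendsto:
  fixes f :: "'a::euclidean_space \<Rightarrow> real"
  assumes cont: "continuous_on UNIV f" and f01: "\<And>x. 0 \<le> f x" "\<And>x. f x \<le> 1"
  shows "(\<lambda>n. \<integral>w. f (x + (1 / real (Suc n)) *\<^sub>R w) * exp (- (norm w)\<^sup>2) \<partial>lborel)
     \<longlonglongrightarrow> f x * (\<integral>w. exp (- (norm w)\<^sup>2) \<partial>(lborel :: 'a measure))"
proof -
  have [measurable]: "f \<in> borel_measurable borel" by (rule borel_measurable_continuous_onI[OF cont])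
  have "(\<lambda>n. \<integral>w. f (x + (1 / real (Suc n)) *\<^sub>R w) * exp (- (norm w)\<^sup>2) \<partial>lborel)
     \<longlonglongrightarrow> (\<integral>w. f x * exp (- (norm w)\<^sup>2) \<partial>(lborel :: 'a measure))"
  proof (rule integral_dominated_convergence[where w = "\<lambda>w::'a. exp (- (norm w)\<^sup>2)"])
    show "integrable lborel (\<lambda>w::'a. exp (- (norm w)\<^sup>2))" using gaussian_integrable[of 1, where 'a='a] by simp
    show "AE w in lborel. norm (f (x + (1 / real (Suc n)) *\<^sub>R w) * exp (- (norm w)\<^sup>2)) \<le> exp (- (norm w)\<^sup>2)" for n
      using f01 by (intro AE_I2) (simp add: abs_mult mult_left_le_one_le)
    show "AE w in lborel. (\<lambda>n. f (x + (1 / real (Suc n)) *\<^sub>R w) * exp (- (norm w)\<^sup>2)) \<longlonglongrightarrow> f x * exp (- (norm w)\<^sup>2)"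
    proof (intro AE_I2 tendsto_mult tendsto_const)
      fix w :: 'a
      have "(\<lambda>n. x + (1 / real (Suc n)) *\<^sub>R w) \<longlonglongrightarrow> x + 0 *\<^sub>R w"
        using LIMSEQ_inverse_real_of_nat by (intro tendsto_intros) (simp add: inverse_eq_divide)
      then have "(\<lambda>n. x + (1 / real (Suc n)) *\<^sub>R w) \<longlonglongrightarrow> x" by simp
      moreover have "isCont f x" using cont by (simp add: continuous_on_eq_continuous_at)
      ultimately show "(\<lambda>n. f (x + (1 / real (Suc n)) *\<^sub>R w)) \<longlonglongrightarrow> f x"
        using isCont_tendsto_compose by blast
    qed
  qed measurable
  then show ?thesis by simp
qed

text \<open>The Gaussian mollification of \<open>f\<close> at scale \<open>1 / n\<close> integrates to a superposition of Gaussian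
transforms of the measure, and it converges to a multiple of \<open>f\<close>.\<close>
lemma gaussian_transforms_determine_continuous_integrals:
  fixes \<mu> \<nu> :: "'a::euclidean_space measure" and f :: "'a \<Rightarrow> real"
  assumes "finite_measure \<mu>" "finite_measure \<nu>"
    and sets [measurable_cong]: "sets \<mu> = sets borel" "sets \<nu> = sets borel"
    and eq: "\<And>s z. s > 0 \<Longrightarrow> (\<integral>x. gauss s (x - z) \<partial>\<mu>) = (\<integral>x. gauss s (x - z) \<partial>\<nu>)"
    and cont: "continuous_on UNIV f" and f01: "\<And>x. 0 \<le> f x" "\<And>x. f x \<le> 1"
  shows "(\<integral>x. f x \<partial>\<mu>) = (\<integral>x. f x \<partial>\<nu>)"
proof -
  have [measurable]: "f \<in> borel_measurable borel" by (rule borel_measurable_continuous_onI[OF cont])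
  define F where "F = (\<lambda>n x. \<integral>w. f (x + (1 / real (Suc n)) *\<^sub>R w) * exp (- (norm w)\<^sup>2) \<partial>(lborel :: 'a measure))"
  define \<kappa> where "\<kappa> = (\<integral>w. exp (- (norm w)\<^sup>2) \<partial>(lborel :: 'a measure))"
  have ig: "integrable lborel (\<lambda>w::'a. exp (- (norm w)\<^sup>2))" using gaussian_integrable[of 1, where 'a='a] by simp
  have \<kappa>: "\<kappa> > 0" unfolding \<kappa>_def using gaussian_integral_pos[of 1, where 'a='a] by simp
  have iF: "integrable lborel (\<lambda>w. f (x + a *\<^sub>R w) * exp (- (norm w)\<^sup>2))" for x a
    by (rule Bochner_Integration.integrable_bound[OF ig]) (use f01 in \<open>auto simp: abs_mult mult_left_le_one_le\<close>)
  have [measurable]: "F n \<in> borel_measurable borel" for n unfolding F_def by measurable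
  have F0: "0 \<le> F n x" "F n x \<le> \<kappa>" for n x
  proof -
    show "0 \<le> F n x" unfolding F_def using f01 by (intro integral_nonneg_AE AE_I2) auto
    show "F n x \<le> \<kappa>" unfolding F_def \<kappa>_def using f01 iF ig by (intro integral_mono) (auto simp: mult_left_le_one_le)
  qed
  have nnF: "(\<integral>\<^sup>+x. ennreal (F n x) \<partial>M) = ennreal (real (Suc n) ^ DIM('a)) * (\<integral>\<^sup>+z. ennreal (f z) * ennreal (\<integral>x. exp (- ((real (Suc n))\<^sup>2) * (norm (x - z))\<^sup>2) \<partial>M) \<partial>lborel)"
    if "finite_measure M" "sets M = sets borel" for M :: "'a measure" and n
  proof -
    interpret M: finite_measure M by fact
    interpret P: pair_sigma_finite M "lborel :: 'a measure" ..
    note [measurable_cong] = that(2)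
    let ?N = "real (Suc n)"
    have "(\<integral>\<^sup>+x. ennreal (F n x) \<partial>M) = (\<integral>\<^sup>+x. (\<integral>\<^sup>+w. ennreal (f (x + (1 / ?N) *\<^sub>R w)) * ennreal (exp (- (norm w)\<^sup>2)) \<partial>lborel) \<partial>M)"
    proof (rule nn_integral_cong)
      fix x
      have "ennreal (F n x) = (\<integral>\<^sup>+w. ennreal (f (x + (1 / ?N) *\<^sub>R w) * exp (- (norm w)\<^sup>2)) \<partial>lborel)"
        unfolding F_def using f01 iF by (intro nn_integral_eq_integral[symmetric]) auto
      then show "ennreal (F n x) = (\<integral>\<^sup>+w. ennreal (f (x + (1 / ?N) *\<^sub>R w)) * ennreal (exp (- (norm w)\<^sup>2)) \<partial>lborel)"
        using f01 by (simp add: ennreal_mult)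
    qed
    also have "\<dots> = (\<integral>\<^sup>+x. ennreal (?N ^ DIM('a)) * (\<integral>\<^sup>+z. ennreal (f z) * ennreal (gauss (?N\<^sup>2) (x - z)) \<partial>lborel) \<partial>M)"
      by (intro nn_integral_cong gaussian_mollification_change_of_variable) auto
    also have "\<dots> = ennreal (?N ^ DIM('a)) * (\<integral>\<^sup>+x. (\<integral>\<^sup>+z. ennreal (f z) * ennreal (gauss (?N\<^sup>2) (x - z)) \<partial>lborel) \<partial>M)"
      by (rule nn_integral_cmult) measurable
    also have "(\<integral>\<^sup>+x. (\<integral>\<^sup>+z. ennreal (f z) * ennreal (gauss (?N\<^sup>2) (x - z)) \<partial>lborel) \<partial>M)
      = (\<integral>\<^sup>+z. (\<integral>\<^sup>+x. ennreal (f z) * ennreal (gauss (?N\<^sup>2) (x - z)) \<partial>M) \<partial>lborel)"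
      by (rule P.Fubini'[symmetric]) measurable
    also have "\<dots> = (\<integral>\<^sup>+z. ennreal (f z) * ennreal (\<integral>x. gauss (?N\<^sup>2) (x - z) \<partial>M) \<partial>lborel)"
    proof (rule nn_integral_cong)
      fix z
      have "(\<integral>\<^sup>+x. ennreal (f z) * ennreal (gauss (?N\<^sup>2) (x - z)) \<partial>M) = ennreal (f z) * (\<integral>\<^sup>+x. ennreal (gauss (?N\<^sup>2) (x - z)) \<partial>M)"
        by (rule nn_integral_cmult) measurable
      also have "(\<integral>\<^sup>+x. ennreal (gauss (?N\<^sup>2) (x - z)) \<partial>M) = ennreal (\<integral>x. gauss (?N\<^sup>2) (x - z) \<partial>M)"
        by (intro nn_integral_eq_integral M.integrable_const_bound[of _ 1]) auto
      finally show "(\<integral>\<^sup>+x. ennreal (f z) * ennreal (gauss (?N\<^sup>2) (x - z)) \<partial>M) = ennreal (f z) * ennreal (\<integral>x. gauss (?N\<^sup>2) (x - z) \<partial>M)" .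
    qed
    finally show ?thesis .
  qed
  have intF: "(\<integral>x. F n x \<partial>\<mu>) = (\<integral>x. F n x \<partial>\<nu>)" for n
  proof -
    have "(\<integral>\<^sup>+x. ennreal (F n x) \<partial>\<mu>) = (\<integral>\<^sup>+x. ennreal (F n x) \<partial>\<nu>)"
      unfolding nnF[OF assms(1) sets(1)] nnF[OF assms(2) sets(2)] by (subst eq) auto
    then show ?thesis using F0(1) by (simp add: integral_eq_nn_integral)
  qed
  have lim: "(\<lambda>n. \<integral>x. F n x \<partial>M) \<longlonglongrightarrow> (\<integral>x. f x \<partial>M) * \<kappa>" if "finite_measure M" "sets M = sets borel" for M :: "'a measure"
  proof -
    interpret M: finite_measure M by fact
    note [measurable_cong] = that(2)
    have "(\<lambda>n. \<integral>x. F n x \<partial>M) \<longlonglongrightarrow> (\<integral>x. f x * \<kappa> \<partial>M)"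
    proof (rule integral_dominated_convergence[where w = "\<lambda>_. \<kappa>"])
      show "AE x in M. (\<lambda>n. F n x) \<longlonglongrightarrow> f x * \<kappa>"
        unfolding F_def \<kappa>_def by (intro AE_I2 gaussian_mollification_tendsto cont f01)
      show "AE x in M. norm (F n x) \<le> \<kappa>" for n using F0 by simp
    qed auto
    then show ?thesis by simp
  qed
  have "(\<integral>x. f x \<partial>\<mu>) * \<kappa> = (\<integral>x. f x \<partial>\<nu>) * \<kappa>"
    using LIMSEQ_unique[OF lim[OF assms(1) sets(1), unfolded intF] lim[OF assms(2) sets(2)]] .
  then show ?thesis using \<kappa> by simp
qed

lemma gaussian_transforms_determine_measure:
  fixes \<mu> \<nu> :: "'a::euclidean_space measure"
  assumes fin: "finite_measure \<mu>" "finite_measure \<nu>"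
    and sets: "sets \<mu> = sets borel" "sets \<nu> = sets borel"
    and eq: "\<And>s z. s > 0 \<Longrightarrow> (\<integral>x. gauss s (x - z) \<partial>\<mu>) = (\<integral>x. gauss s (x - z) \<partial>\<nu>)"
  shows "\<mu> = \<nu>"
proof -
  interpret M: finite_measure \<mu> by fact
  interpret N: finite_measure \<nu> by fact
  have "measure \<mu> C = measure \<nu> C" if C: "closed C" "C \<noteq> {}" for C
  proof -
    \<comment> \<open>Continuous functions decreasing to the indicator function of the closed set \<open>C\<close>.\<close>
    define f where "f = (\<lambda>n x. max 0 (1 - real n * infdist x C))"
    have fc: "continuous_on UNIV (f n)" for n unfolding f_def by (intro continuous_intros)
    have f01: "0 \<le> f n x" "f n x \<le> 1" for n x by (auto simp: f_def infdist_nonneg)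
    have lim: "(\<lambda>n. \<integral>x. f n x \<partial>M) \<longlonglongrightarrow> measure M C" if "finite_measure M" "sets M = sets borel" for M :: "'a measure"
    proof -
      interpret M: finite_measure M by fact
      note [measurable_cong] = that(2)
      have [measurable]: "C \<in> sets borel" using C by simp
      have [measurable]: "f n \<in> borel_measurable borel" for n by (rule borel_measurable_continuous_onI[OF fc])
      have "(\<lambda>n. \<integral>x. f n x \<partial>M) \<longlonglongrightarrow> (\<integral>x. indicator C x \<partial>M)"
      proof (rule integral_dominated_convergence[where w = "\<lambda>_. 1"])
        show "AE x in M. (\<lambda>n. f n x) \<longlonglongrightarrow> indicator C x"
        proof (rule AE_I2)
          fix x
          show "(\<lambda>n. f n x) \<longlonglongrightarrow> indicator C x"
          proof (cases "x \<in> C")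
            case True
            then show ?thesis by (simp add: f_def)
          next
            case False
            then have d: "infdist x C > 0" using C in_closed_iff_infdist_zero[of C x] infdist_nonneg[of x C] by auto
            obtain N where N: "1 < real N * infdist x C" using reals_Archimedean3[OF d] by blast
            have "f n x = 0" if "n \<ge> N" for n
            proof -
              have "real N * infdist x C \<le> real n * infdist x C" using that d by (intro mult_right_mono) auto
              then show ?thesis using N by (simp add: f_def)
            qed
            then have "eventually (\<lambda>n. f n x = 0) sequentially" by (auto simp: eventually_sequentially)
            then have "(\<lambda>n. f n x) \<longlonglongrightarrow> 0" by (rule tendsto_eventually)
            then show ?thesis using False by simp
          qed
        qed
        show "AE x in M. norm (f n x) \<le> 1" for n using f01 by simp
      qed auto
      then show ?thesis using sets_eq_imp_space_eq[OF that(2)] by simp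
    qed
    have "(\<integral>x. f n x \<partial>\<mu>) = (\<integral>x. f n x \<partial>\<nu>)" for n
      by (rule gaussian_transforms_determine_continuous_integrals[OF fin sets eq fc f01])
    then show ?thesis using LIMSEQ_unique[OF lim[OF fin(1) sets(1)]] lim[OF fin(2) sets(2)] by simp
  qed
  then have em: "emeasure \<mu> C = emeasure \<nu> C" if "closed C" for C
    using that by (cases "C = {}") (auto simp: M.emeasure_eq_measure N.emeasure_eq_measure)
  show ?thesis
  proof (rule measure_eqI_generator_eq[where E = "Collect closed" and \<Omega> = UNIV and A = "\<lambda>_. UNIV"])
    show "Int_stable (Collect (closed :: 'a set \<Rightarrow> bool))" by (auto simp: Int_stable_def)
    show "sets \<mu> = sigma_sets UNIV (Collect closed)" "sets \<nu> = sigma_sets UNIV (Collect closed)"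
      using sets by (simp_all add: borel_eq_closed)
  qed (use em in auto)
qed

text \<open>For even \<open>p\<close> the potential only depends on finitely many moments, and the statement is false.\<close>
theorem riesz_potentials_determine_measure:
  fixes \<mu> \<nu> :: "'a::euclidean_space measure"
  assumes p: "p > 0" "\<not> (\<exists>k::int. p = 2 * of_int k)"
    and fin: "finite_measure \<mu>" "finite_measure \<nu>"
    and sets: "sets \<mu> = sets borel" "sets \<nu> = sets borel"
    and int: "integrable \<mu> (\<lambda>x. norm x powr p)" "integrable \<nu> (\<lambda>x. norm x powr p)"
    and eq: "\<And>y. (\<integral>x. norm (x - y) powr p \<partial>\<mu>) = (\<integral>x. norm (x - y) powr p \<partial>\<nu>)"
  shows "\<mu> = \<nu>"
proof (rule gaussian_transforms_determine_measure[OF fin sets])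
  fix s :: real and z :: 'a assume s: "s > 0"
  define k where "k = nat \<lfloor>p / 2\<rfloor>"
  have k: "real k = of_int \<lfloor>p / 2\<rfloor>" using p(1) by (simp add: k_def)
  have "2 * real k \<noteq> p" using p(2) k by metis
  moreover have "real k \<le> p / 2" "p / 2 < real k + 1" unfolding k by linarith+
  ultimately have kp: "2 * real k < p" "p < 2 * real k + 2" by auto
  let ?c = "\<lambda>b. if b then 1 else - 1 :: real" and ?M = "\<lambda>b. if b then \<mu> else \<nu>"
  have "(\<Sum>b\<in>UNIV. ?c b * (\<integral>x. gauss s (x - z) \<partial>?M b)) = 0"
    by (rule riesz_potential_zero_imp_gaussian_zero[OF _ _ _ kp]) (use fin sets int eq s in \<open>auto simp: UNIV_bool\<close>)
  then show "(\<integral>x. gauss s (x - z) \<partial>\<mu>) = (\<integral>x. gauss s (x - z) \<partial>\<nu>)"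
    by (simp add: UNIV_bool)
qed

section \<open>Complex affine moments determine a finite measure\<close>

definition bil :: "complex^'m \<Rightarrow> complex^'m \<Rightarrow> complex" where
  "bil c x = (\<Sum>k\<in>UNIV. c $ k * x $ k)"

lemma bil_simps:
  "bil (c + d) x = bil c x + bil d x" "bil c (x + y) = bil c x + bil c y"
  "bil (c - d) x = bil c x - bil d x" "bil c (x - y) = bil c x - bil c y"
  "bil (t *s c) x = t * bil c x" "bil c (t *s x) = t * bil c x"
  by (simp_all add: bil_def algebra_simps sum.distrib sum_subtractf sum_distrib_left)

lemma bil_scaleR: "bil c (r *\<^sub>R x) = complex_of_real r * bil c x"
  unfolding bil_def vector_scaleR_component sum_distrib_left by (intro sum.cong refl) (simp add: scaleR_conv_of_real)

lemma continuous_bil [continuous_intros]: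
  "continuous_on S f \<Longrightarrow> continuous_on S g \<Longrightarrow> continuous_on S (\<lambda>x. bil (f x) (g x))"
  unfolding bil_def by (intro continuous_intros)

lemma inner_complex_vec: "x \<bullet> y = Re (\<Sum>k\<in>UNIV. x $ k * cnj (y $ k))" for x y :: "complex^'m"
  by (simp add: inner_vec_def inner_complex_def)

text \<open>After multiplying \<open>v\<close> by a number \<open>\<alpha>\<close> of modulus one, the Hermitian product of \<open>u\<close> and \<open>v\<close> is real
and nonnegative. Then the unitary reflection in the hyperplane orthogonal to \<open>w = u - \<alpha> v\<close>
exchanges \<open>u\<close> and \<open>\<alpha> v\<close>; \<open>V\<close> is its transpose, which is the reflection along the conjugate of \<open>w\<close>.\<close>
lemma unitary_reflection_bil:
  fixes u v :: "complex^'m"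
  assumes "norm u = norm v"
  obtains V where "linear V" "bij V" "\<And>c. norm (V c) = norm c" "\<And>c. cmod (bil (V c) u) = cmod (bil c v)"
proof -
  let ?h = "\<lambda>x y :: complex^'m. \<Sum>k\<in>UNIV. x $ k * cnj (y $ k)"
  define \<alpha> where "\<alpha> = (if ?h u v = 0 then 1 else ?h u v / of_real (cmod (?h u v)))"
  have \<alpha>: "cmod \<alpha> = 1" by (auto simp: \<alpha>_def norm_divide)
  define w where "w = u - \<alpha> *s v"
  have huav: "?h u (\<alpha> *s v) = of_real (cmod (?h u v))"
  proof -
    have "?h u (\<alpha> *s v) = cnj \<alpha> * ?h u v" by (simp add: sum_distrib_left mult_ac)
    also have "\<dots> = of_real (cmod (?h u v))"
    proof (cases "?h u v = 0")
      case False
      have "cnj \<alpha> * ?h u v = (?h u v * cnj (?h u v)) / of_real (cmod (?h u v))"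
        unfolding \<alpha>_def using False by (simp add: mult_ac)
      also have "?h u v * cnj (?h u v) = of_real ((cmod (?h u v))\<^sup>2)" by (simp only: complex_norm_square)
      finally show ?thesis using False by (simp add: power2_eq_square)
    qed simp
    finally show ?thesis .
  qed
  have norm_av: "norm (\<alpha> *s v) = norm v"
    unfolding norm_vec_def L2_set_def by (simp add: norm_mult \<alpha>)
  have hxx: "?h x x = of_real ((norm x)\<^sup>2)" for x :: "complex^'m"
    unfolding power2_norm_eq_inner inner_vec_def
    by (simp add: complex_norm_square[symmetric] power2_norm_eq_inner[symmetric])
  have cmodav: "cmod (bil c (\<alpha> *s v)) = cmod (bil c v)" for c by (simp add: bil_simps norm_mult \<alpha>)
  show ?thesis
  proof (cases "w = 0")
    case True
    then have "u = \<alpha> *s v" by (simp add: w_def)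
    then show ?thesis using cmodav by (intro that[of id]) (auto simp: linear_id)
  next
    case False
    define W where "W = (\<chi> k. cnj (w $ k))"
    define V where "V = (\<lambda>c. c - (2 * bil c w / of_real ((norm w)\<^sup>2)) *s W)"
    have nw: "(norm w)\<^sup>2 > 0" using False by simp
    have nW: "norm W = norm w" unfolding W_def norm_vec_def L2_set_def by simp
    have bWw: "bil W w = of_real ((norm w)\<^sup>2)"
      unfolding hxx[symmetric] by (simp add: bil_def W_def mult.commute)
    have w2: "of_real ((norm w)\<^sup>2) = 2 * bil W u"
    proof -
      have 1: "bil W u = of_real ((norm u)\<^sup>2 - cmod (?h u v))"
      proof -
        have "bil W u = ?h u w" by (simp add: bil_def W_def mult.commute)
        also have "\<dots> = ?h u u - ?h u (\<alpha> *s v)" by (simp add: w_def algebra_simps sum_subtractf)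
        finally show ?thesis by (simp only: hxx huav of_real_diff)
      qed
      have "(norm w)\<^sup>2 = (norm u)\<^sup>2 + (norm (\<alpha> *s v))\<^sup>2 - 2 * (u \<bullet> (\<alpha> *s v))"
        unfolding w_def power2_norm_eq_inner by (simp add: inner_simps inner_commute)
      also have "u \<bullet> (\<alpha> *s v) = cmod (?h u v)" unfolding inner_complex_vec huav by simp
      finally have "(norm w)\<^sup>2 = 2 * ((norm u)\<^sup>2 - cmod (?h u v))" using assms norm_av by simp
      then show ?thesis unfolding 1 by (simp only: of_real_mult) simp
    qed
    have Vw: "bil (V c) w = - bil c w" for c
      unfolding V_def bil_simps bWw using nw by (simp add: field_simps)
    have VV: "V (V c) = c" for c
    proof -
      have "V (V c) = V c - (2 * bil (V c) w / of_real ((norm w)\<^sup>2)) *s W" by (simp only: V_def)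
      also have "\<dots> = V c + (2 * bil c w / of_real ((norm w)\<^sup>2)) *s W" unfolding Vw by (simp add: vec_eq_iff)
      also have "\<dots> = c" by (simp add: V_def)
      finally show ?thesis .
    qed
    show ?thesis
    proof (rule that)
      show "linear V"
        unfolding V_def by (rule complex_linear_imp_linear) (auto simp: bil_simps vec_eq_iff algebra_simps add_divide_distrib)
      show "bij V" using VV by (intro o_bij[of V]) (auto simp: fun_eq_iff)
      show "norm (V c) = norm c" for c
      proof -
        define t where "t = 2 * bil c w / of_real ((norm w)\<^sup>2)"
        have "c \<bullet> (t *s W) = Re (cnj t * bil c w)"
          unfolding inner_complex_vec by (simp add: bil_def W_def sum_distrib_left mult_ac)
        also have "cnj t * bil c w = 2 * (bil c w * cnj (bil c w)) / of_real ((norm w)\<^sup>2)" by (simp add: t_def mult_ac)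
        also have "\<dots> = of_real (2 * (cmod (bil c w))\<^sup>2 / (norm w)\<^sup>2)" by (simp only: complex_norm_square[symmetric]) simp
        finally have i: "c \<bullet> (t *s W) = 2 * (cmod (bil c w))\<^sup>2 / (norm w)\<^sup>2" by simp
        have "norm (t *s W) = cmod t * norm W"
          unfolding norm_vec_def L2_set_def by (simp add: norm_mult power_mult_distrib sum_distrib_left[symmetric] real_sqrt_mult)
        then have "(norm (t *s W))\<^sup>2 = 4 * (cmod (bil c w))\<^sup>2 / (norm w)\<^sup>2"
          using nw nW by (simp add: t_def norm_divide norm_mult power_mult_distrib power_divide power2_eq_square)
        then have "(norm (V c))\<^sup>2 = (norm c)\<^sup>2"
          using i unfolding V_def t_def[symmetric] by (simp add: power2_norm_eq_inner inner_simps inner_commute)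
        then show ?thesis by simp
      qed
      have "bil (V c) u = bil c (\<alpha> *s v)" for c
      proof -
        have "2 * bil c w / of_real ((norm w)\<^sup>2) * bil W u = bil c w"
        proof -
          have "bil W u \<noteq> 0" using nw w2 by auto
          then show ?thesis unfolding w2 by simp
        qed
        then have "bil (V c) u = bil c u - bil c w" by (simp add: V_def bil_simps)
        then show ?thesis by (simp add: w_def bil_simps)
      qed
      then show "cmod (bil (V c) u) = cmod (bil c v)" for c using cmodav by simp
    qed
  qed
qed

definition bil_mean :: "real \<Rightarrow> complex^'m \<Rightarrow> ennreal" where
  "bil_mean p v = (\<integral>\<^sup>+c. indicator (ball 0 1) c * ennreal (cmod (bil c v) powr p) \<partial>lborel)"

lemma bil_measurable [measurable]: "(\<lambda>c. bil c v) \<in> borel_measurable borel" "(\<lambda>c. bil v c) \<in> borel_measurable borel"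
  by (intro borel_measurable_continuous_onI continuous_intros)+

lemma bil_pair_measurable [measurable]: "(\<lambda>w. bil (snd w) (fst w)) \<in> borel_measurable (borel \<Otimes>\<^sub>M borel)"
  unfolding borel_prod by (intro borel_measurable_continuous_onI continuous_intros)

lemma unit_ball_measurable [measurable]: "ball (0::'a::real_normed_vector) 1 \<in> sets borel"
  by simp

text \<open>The map \<open>V\<close> of \<open>unitary_reflection_bil\<close> preserves the averaging ball and Lebesgue measure.\<close>
lemma bil_mean_norm_eq:
  fixes u v :: "complex^'m"
  assumes "norm u = norm v" shows "bil_mean p u = bil_mean p v"
proof -
  obtain V where V: "linear V" "bij V" "\<And>c. norm (V c) = norm c" "\<And>c. cmod (bil (V c) u) = cmod (bil c v)"
    using unitary_reflection_bil[OF assms] by blast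
  have d: "distr lborel borel V = lborel"
    by (intro pulls_volume_distr linear_isometry_pulls_volume V)
  have [measurable]: "V \<in> borel_measurable borel"
    using V(1) by (intro borel_measurable_continuous_onI linear_continuous_on linear_conv_bounded_linear[THEN iffD1])
  have "bil_mean p u = (\<integral>\<^sup>+c. indicator (ball 0 1) c * ennreal (cmod (bil c u) powr p) \<partial>(distr lborel borel V))"
    by (simp add: bil_mean_def d)
  also have "\<dots> = (\<integral>\<^sup>+c. indicator (ball 0 1) (V c) * ennreal (cmod (bil (V c) u) powr p) \<partial>lborel)"
    by (rule nn_integral_distr) measurable
  also have "\<dots> = bil_mean p v"
    unfolding bil_mean_def by (intro nn_integral_cong) (simp add: V indicator_def)
  finally show ?thesis .
qed

lemma bil_mean_scale:
  assumes p: "p > 0"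
  obtains \<kappa> where "\<kappa> > 0" "\<And>v :: complex^'m. bil_mean p v = ennreal (\<kappa> * norm v powr p)"
proof -
  define e :: "complex^'m" where "e = axis undefined 1"
  have ne: "norm e = 1" by (simp add: e_def)
  have be: "bil c e = c $ undefined" for c
    unfolding bil_def e_def by (simp add: axis_def if_distrib cong: if_cong)
  have bnd: "cmod (bil c e) \<le> norm c" for c unfolding be by (rule Finite_Cartesian_Product.norm_nth_le)
  have fin: "bil_mean p e < \<infinity>"
    proof -
      have "bil_mean p e \<le> (\<integral>\<^sup>+c. indicator (ball 0 1) c \<partial>(lborel :: (complex^'m) measure))"
        unfolding bil_mean_def
      proof (intro nn_integral_mono)
        fix c :: "complex^'m"
        have "cmod (bil c e) powr p \<le> 1" if "norm c < 1"
          using powr_mono2[of p "cmod (bil c e)" 1] bnd[of c] that p by simp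
        then show "indicator (ball 0 1) c * ennreal (cmod (bil c e) powr p) \<le> indicator (ball 0 1) c"
          by (auto simp: indicator_def)
      qed
      also have "\<dots> = emeasure lborel (ball (0::complex^'m) 1)" by (rule nn_integral_indicator) simp
      also have "\<dots> < \<infinity>" by (rule emeasure_unit_ball_pos_finite)
      finally show ?thesis .
    qed
    have pos: "bil_mean p e \<noteq> 0"
    proof
      assume "bil_mean p e = 0"
      then have "AE c in (lborel :: (complex^'m) measure). indicator (ball 0 1) c * ennreal (cmod (bil c e) powr p) = 0"
        unfolding bil_mean_def by (subst (asm) nn_integral_0_iff_AE) measurable
      then have "AE c in (lborel :: (complex^'m) measure). c \<in> ball 0 1 \<longrightarrow> bil c e = 0"
        by eventually_elim (auto simp: indicator_def split: if_splits)
      then have "bil ((1/2) *\<^sub>R e) e = 0"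
        by (intro continuous_AE_zero_imp_zero[of "ball 0 1" "\<lambda>c. bil c e"]) (auto intro!: continuous_intros simp: ne)
      then show False unfolding be by (simp add: e_def)
    qed
    define \<kappa> where "\<kappa> = enn2real (bil_mean p e)"
    have \<kappa>: "bil_mean p e = ennreal \<kappa>" unfolding \<kappa>_def using fin by simp
    have "\<kappa> > 0" using pos fin unfolding \<kappa>_def by (simp add: enn2real_positive_iff zero_less_iff_neq_zero)
    moreover have "bil_mean p v = ennreal (\<kappa> * norm v powr p)" for v :: "complex^'m"
    proof -
      have "bil_mean p v = bil_mean p (norm v *\<^sub>R e)" by (rule bil_mean_norm_eq) (simp add: ne)
      also have "\<dots> = (\<integral>\<^sup>+c. ennreal (norm v powr p) * (indicator (ball 0 1) c * ennreal (cmod (bil c e) powr p)) \<partial>lborel)"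
        unfolding bil_mean_def bil_scaleR
        by (intro nn_integral_cong) (simp add: norm_mult powr_mult ennreal_mult mult_ac)
      also have "\<dots> = ennreal (norm v powr p) * bil_mean p e"
        unfolding bil_mean_def by (rule nn_integral_cmult) measurable
      also have "\<dots> = ennreal (\<kappa> * norm v powr p)" using \<open>\<kappa> > 0\<close> by (simp add: \<kappa> ennreal_mult mult.commute)
      finally show ?thesis .
    qed
    ultimately show ?thesis using that by blast
qed

text \<open>Plotkin and Rudin. Averaging the hypothesis with \<open>s = - bil c y\<close> over the unit ball of all \<open>c\<close>
yields the Riesz potential at \<open>y\<close>, by \<open>bil_mean_scale\<close>.\<close>
theorem complex_affine_moments_determine_measure:
  fixes \<mu> \<nu> :: "(complex^'m) measure"
  assumes p: "p > 0" "\<not> (\<exists>k::int. p = 2 * of_int k)"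
    and fin: "finite_measure \<mu>" "finite_measure \<nu>"
    and sets [measurable_cong]: "sets \<mu> = sets borel" "sets \<nu> = sets borel"
    and int: "integrable \<mu> (\<lambda>x. norm x powr p)" "integrable \<nu> (\<lambda>x. norm x powr p)"
    and eq: "\<And>s c. (\<integral>\<^sup>+x. ennreal (cmod (s + bil c x) powr p) \<partial>\<mu>) = (\<integral>\<^sup>+x. ennreal (cmod (s + bil c x) powr p) \<partial>\<nu>)"
  shows "\<mu> = \<nu>"
proof (rule riesz_potentials_determine_measure[OF p fin sets int])
  fix y :: "complex^'m"
  obtain \<kappa> where \<kappa>: "\<kappa> > 0" "\<And>v :: complex^'m. bil_mean p v = ennreal (\<kappa> * norm v powr p)"
    using bil_mean_scale[OF p(1)] by blast
  have pot: "ennreal \<kappa> * (\<integral>\<^sup>+x. ennreal (norm (x - y) powr p) \<partial>M) =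
      (\<integral>\<^sup>+c. indicator (ball 0 1) c * (\<integral>\<^sup>+x. ennreal (cmod (- bil c y + bil c x) powr p) \<partial>M) \<partial>lborel)"
    if "finite_measure M" "sets M = sets borel" for M :: "(complex^'m) measure"
  proof -
    interpret M: finite_measure M by fact
    interpret P: pair_sigma_finite M "lborel :: (complex^'m) measure" ..
    note [measurable_cong] = that(2)
    have "ennreal \<kappa> * (\<integral>\<^sup>+x. ennreal (norm (x - y) powr p) \<partial>M) = (\<integral>\<^sup>+x. bil_mean p (x - y) \<partial>M)"
      using \<kappa> by (subst nn_integral_cmult[symmetric]) (auto simp: ennreal_mult)
    also have "\<dots> = (\<integral>\<^sup>+x. (\<integral>\<^sup>+c. indicator (ball 0 1) c * ennreal (cmod (- bil c y + bil c x) powr p) \<partial>lborel) \<partial>M)"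
      unfolding bil_mean_def bil_simps by simp
    also have "\<dots> = (\<integral>\<^sup>+c. (\<integral>\<^sup>+x. indicator (ball 0 1) c * ennreal (cmod (- bil c y + bil c x) powr p) \<partial>M) \<partial>lborel)"
      by (rule P.Fubini'[symmetric]) measurable
    also have "\<dots> = (\<integral>\<^sup>+c. indicator (ball 0 1) c * (\<integral>\<^sup>+x. ennreal (cmod (- bil c y + bil c x) powr p) \<partial>M) \<partial>lborel)"
      by (intro nn_integral_cong nn_integral_cmult) measurable
    finally show ?thesis .
  qed
  have "ennreal \<kappa> * (\<integral>\<^sup>+x. ennreal (norm (x - y) powr p) \<partial>\<mu>) = ennreal \<kappa> * (\<integral>\<^sup>+x. ennreal (norm (x - y) powr p) \<partial>\<nu>)"
    unfolding pot[OF fin(1) sets(1)] pot[OF fin(2) sets(2)] eq ..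
  then have "(\<integral>\<^sup>+x. ennreal (norm (x - y) powr p) \<partial>\<mu>) = (\<integral>\<^sup>+x. ennreal (norm (x - y) powr p) \<partial>\<nu>)"
    using \<kappa>(1) by (auto simp: ennreal_mult_cancel_left)
  then show "(\<integral>x. norm (x - y) powr p \<partial>\<mu>) = (\<integral>x. norm (x - y) powr p \<partial>\<nu>)"
    by (simp add: integral_eq_nn_integral)
qed

section \<open>Holomorphic functions of several variables\<close>

lemma bounded_linear_scalar_line: "bounded_linear (\<lambda>h. h *s (v :: complex^'n))"
proof -
  have "linear (\<lambda>h. h *s (v :: complex^'n))"
    by (rule linearI) (simp_all add: vec_eq_iff algebra_simps scaleR_vec_def)
  then show ?thesis by (simp add: linear_conv_bounded_linear)
qed

lemma continuous_scalar_line [continuous_intros]: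
  "continuous_on S f \<Longrightarrow> continuous_on S g \<Longrightarrow> continuous_on S (\<lambda>x. f x *s (g x :: complex^'n))"
  unfolding vector_scalar_mult_def by (intro continuous_intros)

lemma norm_scalar_line: "norm (h *s (v :: complex^'n)) = cmod h * norm v"
  unfolding norm_vec_def L2_set_def
  by (simp add: norm_mult power_mult_distrib sum_distrib_left[symmetric] real_sqrt_mult)

lemma holomorphic_cn_onE:
  assumes "holomorphic_cn_on f D" "z \<in> D"
  obtains f' where "(f has_derivative f') (at z)" "\<And>c v. f' (c *s v) = c * f' v" "bounded_linear f'"
  using assms unfolding holomorphic_cn_on_def by (metis has_derivative_bounded_linear)

lemma holomorphic_cn_onI:
  assumes "\<And>z. z \<in> D \<Longrightarrow> \<exists>f'. (f has_derivative f') (at z) \<and> (\<forall>c v. f' (c *s v) = c * f' v)"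
  shows "holomorphic_cn_on f D"
  using assms unfolding holomorphic_cn_on_def by blast

lemma holomorphic_cn_on_subset: "holomorphic_cn_on f D \<Longrightarrow> S \<subseteq> D \<Longrightarrow> holomorphic_cn_on f S"
  unfolding holomorphic_cn_on_def by blast

lemma holomorphic_cn_on_cong_open:
  assumes "holomorphic_cn_on f D" "open D" "\<And>z. z \<in> D \<Longrightarrow> g z = f z"
  shows "holomorphic_cn_on g D"
proof (rule holomorphic_cn_onI)
  fix z assume z: "z \<in> D"
  obtain f' where f': "(f has_derivative f') (at z)" "\<And>c v. f' (c *s v) = c * f' v"
    using holomorphic_cn_onE[OF assms(1) z] by metis
  have "(g has_derivative f') (at z)"
    by (rule has_derivative_transform_within_open[OF f'(1) assms(2) z]) (simp add: assms(3))
  then show "\<exists>f'. (g has_derivative f') (at z) \<and> (\<forall>c v. f' (c *s v) = c * f' v)" using f'(2) by blast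
qed

lemma holomorphic_cn_on_continuous: "holomorphic_cn_on f D \<Longrightarrow> continuous_on D f"
  by (intro continuous_at_imp_continuous_on ballI) (meson has_derivative_continuous holomorphic_cn_onE)

lemma holomorphic_cn_on_const: "holomorphic_cn_on (\<lambda>_. c) D"
  by (rule holomorphic_cn_onI) (auto intro!: exI[of _ "\<lambda>_. 0"])

lemma holomorphic_cn_on_nth: "holomorphic_cn_on (\<lambda>z. z $ i) (D :: (complex^'n) set)"
proof (rule holomorphic_cn_onI)
  fix z :: "complex^'n"
  have "((\<lambda>z. z $ i) has_derivative (\<lambda>h. h $ i)) (at z)"
    by (intro bounded_linear_imp_has_derivative bounded_linear_vec_nth)
  then show "\<exists>f'. ((\<lambda>z. z $ i) has_derivative f') (at z) \<and> (\<forall>c v. f' (c *s v) = c * f' v)"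
    by (intro exI[of _ "\<lambda>h. h $ i"]) simp
qed

lemma holomorphic_cn_on_add:
  assumes "holomorphic_cn_on f D" "holomorphic_cn_on g D" shows "holomorphic_cn_on (\<lambda>z. f z + g z) D"
proof (rule holomorphic_cn_onI)
  fix z assume z: "z \<in> D"
  obtain f' where f': "(f has_derivative f') (at z)" "\<And>c v. f' (c *s v) = c * f' v"
    using holomorphic_cn_onE[OF assms(1) z] by metis
  obtain g' where g': "(g has_derivative g') (at z)" "\<And>c v. g' (c *s v) = c * g' v"
    using holomorphic_cn_onE[OF assms(2) z] by metis
  show "\<exists>h. ((\<lambda>z. f z + g z) has_derivative h) (at z) \<and> (\<forall>c v. h (c *s v) = c * h v)"
    using f' g' by (intro exI[of _ "\<lambda>h. f' h + g' h"]) (auto intro!: derivative_intros simp: algebra_simps)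
qed

lemma holomorphic_cn_on_mult:
  assumes "holomorphic_cn_on f D" "holomorphic_cn_on g D" shows "holomorphic_cn_on (\<lambda>z. f z * g z) D"
proof (rule holomorphic_cn_onI)
  fix z assume z: "z \<in> D"
  obtain f' where f': "(f has_derivative f') (at z)" "\<And>c v. f' (c *s v) = c * f' v"
    using holomorphic_cn_onE[OF assms(1) z] by metis
  obtain g' where g': "(g has_derivative g') (at z)" "\<And>c v. g' (c *s v) = c * g' v"
    using holomorphic_cn_onE[OF assms(2) z] by metis
  have "((\<lambda>z. f z * g z) has_derivative (\<lambda>h. f z * g' h + f' h * g z)) (at z)"
    by (rule has_derivative_mult[OF f'(1) g'(1)])
  then show "\<exists>h. ((\<lambda>z. f z * g z) has_derivative h) (at z) \<and> (\<forall>c v. h (c *s v) = c * h v)"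
    using f'(2) g'(2) by (intro exI[of _ "\<lambda>h. f z * g' h + f' h * g z"]) (auto simp: algebra_simps)
qed

lemma holomorphic_cn_on_inverse:
  assumes "holomorphic_cn_on f D" "\<And>z. z \<in> D \<Longrightarrow> f z \<noteq> 0" shows "holomorphic_cn_on (\<lambda>z. inverse (f z)) D"
proof (rule holomorphic_cn_onI)
  fix z assume z: "z \<in> D"
  obtain f' where f': "(f has_derivative f') (at z)" "\<And>c v. f' (c *s v) = c * f' v"
    using holomorphic_cn_onE[OF assms(1) z] by metis
  have "((\<lambda>z. inverse (f z)) has_derivative (\<lambda>h. - (inverse (f z) * f' h * inverse (f z)))) (at z)"
    by (rule Deriv.has_derivative_inverse[OF assms(2)[OF z] f'(1)])
  then show "\<exists>h. ((\<lambda>z. inverse (f z)) has_derivative h) (at z) \<and> (\<forall>c v. h (c *s v) = c * h v)"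
    using f'(2) by (intro exI[of _ "\<lambda>h. - (inverse (f z) * f' h * inverse (f z))"]) (auto simp: algebra_simps)
qed

lemma holomorphic_cn_on_divide:
  assumes "holomorphic_cn_on f D" "holomorphic_cn_on g D" "\<And>z. z \<in> D \<Longrightarrow> g z \<noteq> 0"
  shows "holomorphic_cn_on (\<lambda>z. f z / g z) D"
  using holomorphic_cn_on_mult[OF assms(1) holomorphic_cn_on_inverse[OF assms(2,3)]] by (simp add: divide_inverse)

lemma holomorphic_along_line:
  assumes "(f has_derivative f') (at (z + t *s v))" "\<And>c v. f' (c *s v) = c * f' v"
  shows "((\<lambda>t. f (z + t *s (v :: complex^'n))) has_field_derivative f' v) (at t)"
proof -
  have "((\<lambda>t. z + t *s v) has_derivative (\<lambda>h. h *s v)) (at t)"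
    using has_derivative_add[OF has_derivative_const bounded_linear_imp_has_derivative[OF bounded_linear_scalar_line]]
    by fastforce
  from has_derivative_compose[OF this assms(1)]
  show ?thesis unfolding has_field_derivative_def by (rule has_derivative_eq_rhs) (simp add: fun_eq_iff assms(2) mult.commute)
qed

lemma holomorphic_on_line:
  fixes f :: "complex^'n \<Rightarrow> complex"
  assumes "holomorphic_cn_on f D" "\<And>t. t \<in> S \<Longrightarrow> z + t *s v \<in> D"
  shows "(\<lambda>t. f (z + t *s v)) holomorphic_on S"
  unfolding holomorphic_on_def
proof
  fix t assume "t \<in> S"
  then have "z + t *s v \<in> D" by (rule assms(2))
  then obtain f' where "(f has_derivative f') (at (z + t *s v))" "\<And>c v. f' (c *s v) = c * f' v"
    using holomorphic_cn_onE[OF assms(1)] by metis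
  from holomorphic_along_line[OF this] show "(\<lambda>t. f (z + t *s v)) field_differentiable (at t within S)"
    unfolding field_differentiable_def by (meson has_field_derivative_at_within)
qed

abbreviation circle_point :: "real \<Rightarrow> real \<Rightarrow> complex" where
  "circle_point r x \<equiv> of_real r * exp (2 * of_real pi * \<i> * of_real x)"

text \<open>Cauchy's formulas for a value and a derivative at the centre of a circle, written as integrals over
\<open>{0..1}\<close> so that theorems on parameter integrals apply.\<close>
lemma circle_mean_value:
  fixes h :: "complex \<Rightarrow> complex"
  assumes "continuous_on (cball 0 r) h" "h holomorphic_on ball 0 r" "r > 0"
  shows "h 0 = integral {0..1} (\<lambda>x. h (circle_point r x))"
    and "(h has_field_derivative integral {0..1} (\<lambda>x. h (circle_point r x) / (circle_point r x))) (at 0)"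
proof -
  let ?e = "\<lambda>x. of_real r * exp (2 * of_real pi * \<i> * of_real x) :: complex"
  have c: "circlepath 0 r x = ?e x" for x by (simp add: circlepath_def part_circlepath_def linepath_def algebra_simps)
  have ci: "contour_integral (circlepath 0 r) F = 2 * of_real pi * \<i> * integral {0..1} (\<lambda>x. F (?e x) * ?e x)" for F
  proof -
    have "contour_integral (circlepath 0 r) F = integral {0..1} (\<lambda>x. F (?e x) * (2 * of_real pi * \<i> * of_real r * exp (2 * of_real pi * \<i> * of_real x)))"
      unfolding contour_integral_integral by (simp add: c vector_derivative_circlepath)
    also have "\<dots> = integral {0..1} (\<lambda>x. (2 * of_real pi * \<i>) * (F (?e x) * ?e x))"
      by (intro arg_cong[where f = "integral {0..1}"] ext) (simp add: mult_ac)
    also have "\<dots> = 2 * of_real pi * \<i> * integral {0..1} (\<lambda>x. F (?e x) * ?e x)" by (rule integral_mult_right)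
    finally show ?thesis .
  qed
  have ne: "?e x \<noteq> 0" for x using assms(3) by simp
  have "((\<lambda>u. h u / (u - 0)) has_contour_integral (2 * of_real pi * \<i> * h 0)) (circlepath 0 r)"
    by (rule Cauchy_integral_circlepath[OF assms(1,2)]) (use assms(3) in simp)
  then have "2 * of_real pi * \<i> * h 0 = 2 * of_real pi * \<i> * integral {0..1} (\<lambda>x. h (?e x) / (?e x - 0) * ?e x)"
    using ci[of "\<lambda>u. h u / (u - 0)"] contour_integral_unique by metis
  then show "h 0 = integral {0..1} (\<lambda>x. h (?e x))" using ne by simp
  have "(h has_field_derivative (1 / (2 * of_real pi * \<i>) * contour_integral (circlepath 0 r) (\<lambda>u. h u / (u - 0)\<^sup>2))) (at 0)"
    using Cauchy_derivative_integral_circlepath(2)[OF assms(1,2), of 0] assms(3) by simp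
  also have "1 / (2 * of_real pi * \<i>) * contour_integral (circlepath 0 r) (\<lambda>u. h u / (u - 0)\<^sup>2) = integral {0..1} (\<lambda>x. h (?e x) / ?e x)"
    unfolding ci using ne by (simp add: power2_eq_square)
  finally show "(h has_field_derivative integral {0..1} (\<lambda>x. h (?e x) / ?e x)) (at 0)" .
qed

text \<open>By Cauchy's formula a directional derivative at \<open>z\<close> is a circle integral of \<open>f\<close> in that direction,
and \<open>f\<close> is continuous. Thus complex differentiability at every point already gives a
continuously differentiable function.\<close>
lemma holomorphic_derivative_continuous:
  fixes f :: "complex^'n \<Rightarrow> complex"
  assumes "holomorphic_cn_on f D" "open D"
  shows "continuous_on D (\<lambda>z. frechet_derivative f (at z) v)"
proof (rule continuous_at_imp_continuous_on, rule ballI)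
  fix a assume a: "a \<in> D"
  obtain R where R: "R > 0" "ball a R \<subseteq> D" using assms(2) a open_contains_ball by blast
  \<comment> \<open>The summand \<open>1\<close> covers the case \<open>v = 0\<close>; discs of radius \<open>r\<close> in direction \<open>v\<close> stay within \<open>R / 2\<close>.\<close>
  define r where "r = R / (2 * (norm v + 1))"
  have r: "r > 0" "r * norm v < R / 2"
  proof -
    show "r > 0" unfolding r_def using R by (intro divide_pos_pos) (auto intro: add_nonneg_pos)
    have "norm v / (norm v + 1) < 1" by (simp add: add_nonneg_pos)
    then have "R / 2 * (norm v / (norm v + 1)) < R / 2 * 1" using R by (intro mult_strict_left_mono) auto
    then show "r * norm v < R / 2" by (simp add: r_def)
  qed
  have inD: "z + t *s v \<in> D" if "z \<in> ball a (R / 2)" "t \<in> cball 0 r" for z t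
  proof -
    have "norm (t *s v) \<le> r * norm v" unfolding norm_scalar_line using that(2) by (intro mult_right_mono) auto
    moreover have "dist a (z + t *s v) \<le> dist a z + norm (t *s v)"
      using norm_triangle_ineq4[of "a - z" "t *s v"] by (simp add: dist_norm algebra_simps)
    ultimately have "dist a (z + t *s v) < R" using that(1) r(2) by simp
    then show ?thesis using R(2) by auto
  qed
  let ?e = "\<lambda>x. of_real r * exp (2 * of_real pi * \<i> * of_real x) :: complex"
  have er: "?e x \<in> cball 0 r" for x using r(1) by (simp add: norm_mult)
  have fd: "frechet_derivative f (at z) v = integral {0..1} (\<lambda>x. f (z + ?e x *s v) / ?e x)" if z: "z \<in> ball a (R / 2)" for z
  proof -
    have zD: "z \<in> D" using inD[OF z, of 0] r(1) by simp
    then obtain f' where f': "(f has_derivative f') (at z)" "\<And>c v. f' (c *s v) = c * f' v"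
      using holomorphic_cn_onE[OF assms(1)] by metis
    have "((\<lambda>t. f (z + t *s v)) has_field_derivative f' v) (at 0)"
      using f' by (intro holomorphic_along_line) auto
    moreover have hol: "(\<lambda>t. f (z + t *s v)) holomorphic_on cball 0 r"
      using inD[OF z] by (intro holomorphic_on_line[OF assms(1)]) auto
    then have "((\<lambda>t. f (z + t *s v)) has_field_derivative integral {0..1} (\<lambda>x. f (z + ?e x *s v) / ?e x)) (at 0)"
      using r(1) by (intro circle_mean_value(2)) (auto intro: holomorphic_on_imp_continuous_on holomorphic_on_subset)
    ultimately have "f' v = integral {0..1} (\<lambda>x. f (z + ?e x *s v) / ?e x)" by (rule DERIV_unique)
    then show ?thesis using frechet_derivative_at[OF f'(1)] by simp
  qed
  have "continuous_on (ball a (R / 2)) (\<lambda>z. integral (cbox 0 1) (\<lambda>x. f (z + ?e x *s v) / ?e x))"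
  proof (rule integral_continuous_on_param)
    have "continuous_on (ball a (R / 2) \<times> cbox 0 1) (\<lambda>w. f (fst w + ?e (snd w) *s v) / ?e (snd w))"
    proof (intro continuous_intros continuous_on_compose2[OF holomorphic_cn_on_continuous[OF assms(1)]])
      show "(\<lambda>w. fst w + ?e (snd w) *s v) ` (ball a (R / 2) \<times> cbox 0 1) \<subseteq> D"
        using inD er by auto
    qed (use r in auto)
    then show "continuous_on (ball a (R / 2) \<times> cbox 0 1) (\<lambda>(z, x). f (z + ?e x *s v) / ?e x)"
      by (simp add: case_prod_beta)
  qed
  then have "continuous_on (ball a (R / 2)) (\<lambda>z. frechet_derivative f (at z) v)"
    by (rule continuous_on_eq) (simp add: fd)
  then show "isCont (\<lambda>z. frechet_derivative f (at z) v) a"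
    using R(1) by (simp add: continuous_on_eq_continuous_at)
qed

lemma holomorphic_cn_on_C1:
  fixes f :: "complex^'n \<Rightarrow> complex"
  assumes "holomorphic_cn_on f D" "open D"
  obtains f' where "\<And>z. z \<in> D \<Longrightarrow> (f has_derivative blinfun_apply (f' z)) (at z)" "continuous_on D f'"
    "\<And>z c v. z \<in> D \<Longrightarrow> blinfun_apply (f' z) (c *s v) = c * blinfun_apply (f' z) v"
proof -
  define f' where "f' = (\<lambda>z. Blinfun (frechet_derivative f (at z)))"
  have ap: "(f has_derivative frechet_derivative f (at z)) (at z) \<and> blinfun_apply (f' z) = frechet_derivative f (at z) \<and>
     (\<forall>c v. frechet_derivative f (at z) (c *s v) = c * frechet_derivative f (at z) v)" if zD: "z \<in> D" for z
  proof -
    obtain g where g: "(f has_derivative g) (at z)" "\<And>c v. g (c *s v) = c * g v" "bounded_linear g"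
      using holomorphic_cn_onE[OF assms(1) zD] by metis
    have "g = frechet_derivative f (at z)" by (rule frechet_derivative_at[OF g(1)])
    then show ?thesis using g by (simp add: f'_def bounded_linear_Blinfun_apply)
  qed
  show ?thesis
  proof (rule that[of f'])
    show "continuous_on D f'"
    proof (rule continuous_on_blinfun_componentwise)
      fix i show "continuous_on D (\<lambda>z. blinfun_apply (f' z) i)"
        by (rule continuous_on_eq[OF holomorphic_derivative_continuous[OF assms, of i]]) (simp add: ap)
    qed
  qed (use ap in auto)
qed

section \<open>Zero sets and the identity theorem\<close>

lemma holomorphic_line_convex:
  fixes a z v :: "complex^'n"
  shows "open {t. z + t *s v \<in> ball a R}" "convex {t. z + t *s v \<in> ball a R}"
proof -
  have c: "continuous_on UNIV (\<lambda>t. z + t *s v)" by (intro continuous_intros)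
  show "open {t. z + t *s v \<in> ball a R}"
    using open_vimage[OF open_ball c, of a R] by (simp add: vimage_def)
  have "{t. z + t *s v \<in> ball a R} = (\<lambda>h. h *s v) -` ((\<lambda>x. - z + x) ` ball a R)"
    by (auto simp: image_iff) (metis add.commute add_uminus_conv_diff diff_add_cancel mem_ball minus_add_cancel)
  also have "convex \<dots>"
    by (intro convex_linear_vimage bounded_linear.linear bounded_linear_scalar_line convex_translation) simp
  finally show "convex {t. z + t *s v \<in> ball a R}" .
qed

text \<open>The interior \<open>W\<close> of the zero set is relatively closed: near a point of its closure there is a point
\<open>y\<close> of \<open>W\<close>, and along each complex line through \<open>y\<close> the one-variable identity theorem applies.\<close>
lemma holomorphic_cn_identity:
  fixes f :: "complex^'n \<Rightarrow> complex"
  assumes hol: "holomorphic_cn_on f D" and D: "open D" "connected D"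
    and U: "open U" "U \<noteq> {}" "U \<subseteq> D" and zero: "\<And>z. z \<in> U \<Longrightarrow> f z = 0"
    and "z \<in> D"
  shows "f z = 0"
proof -
  define W where "W = interior {z \<in> D. f z = 0}"
  have WD: "W \<subseteq> D" unfolding W_def using interior_subset by blast
  have W0: "f z = 0" if "z \<in> W" for z using that interior_subset unfolding W_def by blast
  have UW: "U \<subseteq> W" unfolding W_def using U zero by (intro interior_maximal) auto
  have "\<exists>T. open T \<and> a \<in> T \<and> T \<inter> D \<subseteq> W" if a: "a \<in> D" "a \<in> closure W" for a
  proof -
    obtain R where R: "R > 0" "ball a R \<subseteq> D" using D(1) a(1) open_contains_ball by blast
    obtain y where y: "y \<in> W" "dist y a < R" using a(2) R(1) closure_approachable by blast
    have "f b = 0" if b: "b \<in> ball a R" for b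
    proof -
      let ?S = "{t. y + t *s (b - y) \<in> ball a R}"
      have S: "open ?S" "convex ?S" by (rule holomorphic_line_convex)+
      have hS: "(\<lambda>t. f (y + t *s (b - y))) holomorphic_on ?S"
        using R(2) by (intro holomorphic_on_line[OF hol]) auto
      have oW: "open W" by (simp add: W_def)
      let ?V = "?S \<inter> {t. y + t *s (b - y) \<in> W}"
      have "open {t. y + t *s (b - y) \<in> W}"
        using open_vimage[OF oW, of "\<lambda>t. y + t *s (b - y)"] by (simp add: vimage_def continuous_intros)
      then have oV: "open ?V" using S by blast
      have 0: "0 \<in> ?V" using y by (simp add: dist_commute)
      have 1: "1 \<in> ?S" using b by simp
      have "f (y + 1 *s (b - y)) = 0"
      proof (rule analytic_continuation_open[OF oV S(1) _ _ _ hS holomorphic_on_const])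
        show "?V \<noteq> {}" using 0 by blast
        show "connected ?S" using S(2) by (rule convex_connected)
      qed (use W0 1 in auto)
      then show ?thesis by simp
    qed
    then have "ball a R \<subseteq> W" unfolding W_def using R by (intro interior_maximal) auto
    then show ?thesis using R(1) by (intro exI[of _ "ball a R"]) auto
  qed
  then have "closure W \<inter> D \<subseteq> W" by blast
  then have "closedin (top_of_set D) W"
    using WD closure_subset[of W] by (auto simp: closedin_closed intro!: exI[of _ "closure W"])
  moreover have "openin (top_of_set D) W" using WD D(1) by (simp add: openin_open_eq W_def)
  ultimately have "W = {} \<or> W = D" using D(2) by (simp add: connected_clopen)
  then show ?thesis using UW U(2) W0 \<open>z \<in> D\<close> by blast
qed

lemma nonzero_point_nearby:
  fixes f :: "complex^'n \<Rightarrow> complex"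
  assumes "holomorphic_cn_on f D" "open D" "connected D" "w \<in> D" "f w \<noteq> 0" "open U" "a \<in> U" "a \<in> D"
  obtains b where "b \<in> U \<inter> D" "f b \<noteq> 0"
  using holomorphic_cn_identity[OF assms(1-3), of "U \<inter> D" w] assms by (metis Int_iff empty_iff inf.cobounded2 open_Int)

lemma open_imp_fsigma:
  fixes S :: "'a::euclidean_space set"
  assumes "open S" shows "fsigma S"
proof (rule open_Union_compact_subsets[OF assms], goal_cases)
  case (1 C)
  then show ?case using fsigma.intros[of C] compact_imp_closed by metis
qed

text \<open>Locally there is a direction \<open>v\<close> such that \<open>f\<close> vanishes identically on no nearby line parallel to \<open>v\<close>.
Each such line then meets the zero set in a countable set. Instead of Fubini in
coordinates adapted to \<open>v\<close>, the local zero set \<open>T\<close> is translated by \<open>t v\<close> and averaged over \<open>t\<close>;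
all translates have the volume of \<open>T\<close>.\<close>
lemma zeros_null:
  fixes f :: "complex^'n \<Rightarrow> complex"
  assumes hol: "holomorphic_cn_on f D" and D: "open D" "connected D" and w: "w \<in> D" "f w \<noteq> 0"
  shows "{z \<in> D. f z = 0} \<in> null_sets lborel"
proof -
  let ?Z = "{z \<in> D. f z = 0}"
  have Zb: "?Z \<inter> S \<in> sets borel" if "open S" for S
  proof -
    have o: "open (D \<inter> f -` (- {0}))"
      by (rule continuous_open_preimage[OF holomorphic_cn_on_continuous[OF hol] D(1)]) (simp add: open_Compl)
    have "?Z \<inter> S = (D - (D \<inter> f -` (- {0}))) \<inter> S" by auto
    also have "\<dots> \<in> sets borel" by (intro sets.Int sets.Diff borel_open o D(1) that)
    finally show ?thesis .
  qed
  have "\<exists>T. openin (top_of_set ?Z) T \<and> a \<in> T \<and> negligible T" if a: "a \<in> ?Z" for a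
  proof -
    obtain R0 where R0: "R0 > 0" "ball a R0 \<subseteq> D" using D(1) a open_contains_ball by blast
    obtain b where b: "b \<in> ball a (R0 / 2) \<inter> D" "f b \<noteq> 0"
      using nonzero_point_nearby[OF hol D w, of "ball a (R0 / 2)" a] a R0 by (auto simp: mem_ball)
    define v where "v = b - a"
    have "open (D \<inter> f -` (- {0}))"
      by (rule continuous_open_preimage[OF holomorphic_cn_on_continuous[OF hol] D(1)]) (simp add: open_Compl)
    moreover have "b \<in> D \<inter> f -` (- {0})" using b by simp
    ultimately obtain e0 where e0: "e0 > 0" "ball b e0 \<subseteq> D \<inter> f -` (- {0})" using open_contains_ball by blast
    define e where "e = min e0 (R0 / 2)"
    have e: "e > 0" "e \<le> e0" "e \<le> R0 / 2" using e0 R0 by (auto simp: e_def)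
    have shift: "z + 1 *s v \<in> ball b e0" "z + 1 *s v \<in> ball a R0" "z \<in> ball a R0" if "z \<in> ball a e" for z
    proof -
      have "dist b (z + v) = dist a z" by (simp add: v_def dist_norm algebra_simps)
      then show "z + 1 *s v \<in> ball b e0" using that e by simp
      then have "dist b (z + v) < R0 / 2" using that e \<open>dist b (z + v) = dist a z\<close> by simp
      then show "z + 1 *s v \<in> ball a R0" using b(1) dist_triangle[of a "z + v" b] by simp
      show "z \<in> ball a R0" using that e R0 by simp
    qed
    define T where "T = ?Z \<inter> ball a e"
    have Tb [measurable]: "T \<in> sets borel" unfolding T_def by (rule Zb) simp
    have cnt: "countable {t. z + t *s v \<in> T}" for z
    proof (cases "\<exists>t0. z + t0 *s v \<in> T")
      case True
      then obtain t0 where t0: "z + t0 *s v \<in> T" by blast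
      define y where "y = z + t0 *s v"
      have y: "y \<in> ball a e" "y \<in> T" using t0 by (auto simp: T_def y_def)
      let ?S = "{t. y + t *s v \<in> ball a R0}"
      have S: "open ?S" "convex ?S" by (rule holomorphic_line_convex)+
      have hS: "(\<lambda>t. f (y + t *s v)) holomorphic_on ?S"
        using R0(2) by (intro holomorphic_on_line[OF hol]) auto
      have "1 \<in> ?S" "0 \<in> ?S" "f (y + 1 *s v) \<noteq> 0" "f (y + 0 *s v) = 0"
        using shift[OF y(1)] e0(2) y(2) by (auto simp: T_def)
      then have "\<not> (\<lambda>t. f (y + t *s v)) constant_on ?S" unfolding constant_on_def by metis
      then have "countable {t \<in> ?S. f (y + t *s v) = 0}"
        using S by (intro holomorphic_countable_zeros[OF hS] convex_connected open_imp_fsigma) auto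
      then have "countable ((\<lambda>t. t + t0) ` {t \<in> ?S. f (y + t *s v) = 0})" by (rule countable_image)
      moreover have "{t. z + t *s v \<in> T} \<subseteq> (\<lambda>t. t + t0) ` {t \<in> ?S. f (y + t *s v) = 0}"
      proof
        fix t assume t: "t \<in> {t. z + t *s v \<in> T}"
        have e2: "z + t *s v = y + (t - t0) *s v" by (simp add: y_def vec_eq_iff algebra_simps)
        have "z + t *s v \<in> T" using t by simp
        then have "y + (t - t0) *s v \<in> ball a e" "f (y + (t - t0) *s v) = 0" unfolding e2 by (auto simp: T_def)
        then have "t - t0 \<in> {t \<in> ?S. f (y + t *s v) = 0}" using e R0 by auto
        then show "t \<in> (\<lambda>t. t + t0) ` {t \<in> ?S. f (y + t *s v) = 0}"
          by (intro image_eqI[of _ _ "t - t0"]) simp_all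
      qed
      ultimately show ?thesis using countable_subset by blast
    qed simp
    have [measurable]: "(\<lambda>w. fst w + snd w *s v) \<in> borel_measurable (borel \<Otimes>\<^sub>M borel)"
      unfolding borel_prod by (intro borel_measurable_continuous_onI continuous_intros)
    have [measurable]: "(\<lambda>t. z + t *s v) \<in> borel_measurable borel" for z
      by (intro borel_measurable_continuous_onI continuous_intros)
    let ?f = "\<lambda>z t. indicator (ball 0 1) t * (indicator T (z + t *s v) :: ennreal)"
    have b1 [measurable]: "ball (0::complex) 1 \<in> sets borel" by simp
    have "(\<integral>\<^sup>+t. (\<integral>\<^sup>+z. ?f z t \<partial>lborel) \<partial>(lborel :: complex measure)) = (\<integral>\<^sup>+z. (\<integral>\<^sup>+t. ?f z t \<partial>lborel) \<partial>(lborel :: (complex^'n) measure))"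
      by (rule lborel_pair.Fubini') measurable
    also have "\<dots> = (\<integral>\<^sup>+z. 0 \<partial>(lborel :: (complex^'n) measure))"
    proof (rule nn_integral_cong)
      fix z :: "complex^'n"
      have "{t. z + t *s v \<in> T} \<in> null_sets lborel" using cnt by (rule countable_imp_null_set_lborel)
      then have "AE t in lborel. t \<notin> {t. z + t *s v \<in> T}" by (rule AE_not_in)
      then have "AE t in lborel. ?f z t = 0" by eventually_elim auto
      then show "(\<integral>\<^sup>+t. ?f z t \<partial>lborel) = 0" by (subst nn_integral_0_iff_AE) auto
    qed
    finally have z: "(\<integral>\<^sup>+t. (\<integral>\<^sup>+z. ?f z t \<partial>lborel) \<partial>(lborel :: complex measure)) = 0" by simp
    have "(\<integral>\<^sup>+t. (\<integral>\<^sup>+z. ?f z t \<partial>lborel) \<partial>(lborel :: complex measure)) = (\<integral>\<^sup>+t. indicator (ball 0 1) t * emeasure lborel T \<partial>(lborel :: complex measure))"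
    proof (rule nn_integral_cong)
      fix t :: complex
      have "(\<integral>\<^sup>+z. ?f z t \<partial>lborel) = indicator (ball 0 1) t * (\<integral>\<^sup>+z. indicator T (z + t *s v) \<partial>lborel)"
        by (rule nn_integral_cmult) measurable
      also have "(\<integral>\<^sup>+z. indicator T (z + t *s v) \<partial>lborel) = (\<integral>\<^sup>+z. indicator T z \<partial>lborel)"
        by (rule nn_integral_lborel_shift) measurable
      finally show "(\<integral>\<^sup>+z. ?f z t \<partial>lborel) = indicator (ball 0 1) t * emeasure lborel T" by simp
    qed
    also have "\<dots> = emeasure lborel T * emeasure lborel (ball (0::complex) 1)"
      by (subst nn_integral_multc) (auto simp: mult.commute)
    finally have "emeasure lborel T = 0"
      using z emeasure_unit_ball_pos_finite(1)[where 'a=complex] by auto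
    then have "negligible T" using Tb by (simp add: negligible_iff_null_sets null_sets_completion_iff null_setsI)
    moreover have "openin (top_of_set ?Z) T" unfolding T_def by (auto simp: openin_open)
    moreover have "a \<in> T" using a e by (auto simp: T_def)
    ultimately show ?thesis by blast
  qed
  then have "negligible ?Z" by (subst locally_negligible_alt) blast
  moreover have "?Z \<in> sets borel" using Zb[of UNIV] by simp
  ultimately show ?thesis by (simp add: negligible_iff_null_sets null_sets_completion_iff)
qed

section \<open>Removable singularities along a hypersurface\<close>

text \<open>Inside the circle \<open>q\<close> has finitely many zeros, and they are removable singularities of \<open>g\<close>.\<close>
lemma bounded_holomorphic_mean_value_off_zeros:
  fixes g q :: "complex \<Rightarrow> complex"
  assumes S: "open S" "connected S" "cball 0 r \<subseteq> S" "r > 0"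
    and q: "q holomorphic_on S" "q 0 \<noteq> 0" "\<And>t. cmod t = r \<Longrightarrow> q t \<noteq> 0"
    and g: "g holomorphic_on (S - {t \<in> S. q t = 0})" "\<And>t. t \<in> S - {t \<in> S. q t = 0} \<Longrightarrow> cmod (g t) \<le> B"
  shows "g 0 = integral {0..1} (\<lambda>x. g (circle_point r x))"
proof -
  let ?Z = "{t \<in> S. q t = 0}"
  have oSZ: "open (S - ?Z)"
  proof -
    have "open (S \<inter> q -` (- {0}))"
      by (rule continuous_open_preimage[OF holomorphic_on_imp_continuous_on[OF q(1)] S(1)]) (simp add: open_Compl)
    moreover have "S \<inter> q -` (- {0}) = S - ?Z" by auto
    ultimately show ?thesis by simp
  qed
  have "0 \<in> S" using S(3,4) by auto
  define X where "X = {t \<in> cball 0 r. q t = 0}"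
  have finX: "finite X"
  proof (cases "X = {}")
    case False
    then obtain t where t: "t \<in> X" by blast
    have "\<not> q constant_on S"
    proof
      assume "q constant_on S"
      moreover have "t \<in> S" using S(3) t by (auto simp: X_def)
      ultimately have "q 0 = q t" using \<open>0 \<in> S\<close> unfolding constant_on_def by metis
      then show False using t q(2) by (simp add: X_def)
    qed
    then show ?thesis unfolding X_def using S by (intro holomorphic_compact_finite_zeros[OF q(1)]) auto
  qed simp
  define U where "U = (S - ?Z) \<union> ball 0 r"
  have oU: "open U" unfolding U_def using oSZ by (intro open_Un) auto
  have XU: "X \<subseteq> ball 0 r"
  proof
    fix t assume t: "t \<in> X"
    then have "cmod t \<noteq> r" using q(3) by (auto simp: X_def)
    then show "t \<in> ball 0 r" using t by (auto simp: X_def)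
  qed
  have "ball 0 r \<subseteq> S" using S(3) ball_subset_cball by blast
  then have UX: "U - X \<subseteq> S - ?Z" using ball_subset_cball[of "0::complex" r] by (auto simp: U_def X_def)
  have "\<exists>h. h holomorphic_on U \<and> (\<forall>t\<in>U - X. h t = g t)"
  proof (rule removable_singularities[OF finX])
    show "X \<subseteq> interior U" using XU oU by (auto simp: interior_open U_def)
    show "g holomorphic_on U - X" by (rule holomorphic_on_subset[OF g(1) UX])
    fix t assume t: "t \<in> X"
    have "open (U - (X - {t}))" using oU finX by (intro open_Diff finite_imp_closed) auto
    moreover have "t \<in> U - (X - {t})" using t XU by (auto simp: U_def)
    ultimately have "eventually (\<lambda>u. u \<in> U - (X - {t})) (at t)"
      by (intro eventually_at_in_open') auto
    moreover have "eventually (\<lambda>u. u \<noteq> t) (at t)" by (simp add: eventually_at_filter)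
    ultimately have "eventually (\<lambda>u. cmod (g u) \<le> B) (at t)"
    proof eventually_elim
      case (elim u)
      then have "u \<in> U - X" by auto
      then show ?case using UX g(2) by blast
    qed
    then show "g \<in> O[at t](\<lambda>_. 1)" by (intro bigoI[of _ B]) simp
  qed
  then obtain h where h: "h holomorphic_on U" "\<And>t. t \<in> U - X \<Longrightarrow> h t = g t" by blast
  have cU: "cball 0 r \<subseteq> U"
  proof
    fix t :: complex assume t: "t \<in> cball 0 r"
    show "t \<in> U"
    proof (cases "cmod t = r")
      case True
      then show ?thesis using q(3)[of t] t S(3) by (auto simp: U_def)
    qed (use t in \<open>auto simp: U_def\<close>)
  qed
  have "continuous_on (cball 0 r) h" "h holomorphic_on ball 0 r"
    using holomorphic_on_imp_continuous_on[OF holomorphic_on_subset[OF h(1) cU]]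
      holomorphic_on_subset[OF h(1) order_trans[OF ball_subset_cball cU]] by auto
  then have "h 0 = integral {0..1} (\<lambda>x. h (circle_point r x))"
    using S(4) by (rule circle_mean_value)
  moreover have "h 0 = g 0" using q(2) S(4) cU by (intro h(2)) (auto simp: X_def)
  moreover have "h (circle_point r x) = g (circle_point r x)" for x
  proof -
    have "cmod (circle_point r x) = r" using S(4) by (simp add: norm_mult)
    then show ?thesis using q(3)[of "of_real r * exp (2 * of_real pi * \<i> * of_real x)"] cU by (intro h(2)) (auto simp: X_def)
  qed
  ultimately show ?thesis by simp
qed

text \<open>Differentiation under the integral sign; the derivative is complex linear because it is an
integral of complex linear maps.\<close>
lemma circle_average_holomorphic:
  fixes g :: "complex^'n \<Rightarrow> complex"
  assumes hol: "holomorphic_cn_on g G" "open G"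
    and in_G: "\<And>z x. z \<in> ball a e \<Longrightarrow> x \<in> {0..1} \<Longrightarrow> z + c x *s v \<in> G"
    and c: "continuous_on {0..1::real} c"
  shows "holomorphic_cn_on (\<lambda>z. integral {0..1} (\<lambda>x. g (z + c x *s v))) (ball a e)"
proof (rule holomorphic_cn_onI)
  fix z0 assume z0: "z0 \<in> ball a e"
  obtain g' where g': "\<And>z. z \<in> G \<Longrightarrow> (g has_derivative blinfun_apply (g' z)) (at z)" "continuous_on G g'"
    "\<And>z c v. z \<in> G \<Longrightarrow> blinfun_apply (g' z) (c *s v) = c * blinfun_apply (g' z) v"
    using holomorphic_cn_on_C1[OF hol] by blast
  have cg: "continuous_on G g" by (rule holomorphic_cn_on_continuous[OF hol(1)])
  have d: "((\<lambda>z. g (z + c x *s v)) has_derivative blinfun_apply (g' (z + c x *s v))) (at z within ball a e)"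
    if "z \<in> ball a e" "x \<in> cbox 0 1" for z x
  proof -
    have "z + c x *s v \<in> G" using in_G that by simp
    then have "(g has_derivative blinfun_apply (g' (z + c x *s v))) (at (z + c x *s v))" by (rule g'(1))
    moreover have "((\<lambda>z. z + c x *s v) has_derivative (\<lambda>h. h)) (at z within ball a e)"
      by (auto intro!: derivative_eq_intros)
    ultimately show ?thesis by (rule has_derivative_compose[rotated, of g])
  qed
  have cont: "continuous_on (ball a e \<times> cbox 0 1) (\<lambda>(z, x). g' (z + c x *s v))"
  proof -
    have "continuous_on (ball a e \<times> cbox 0 1) (\<lambda>w. g' (fst w + c (snd w) *s v))"
      by (intro continuous_on_compose2[OF g'(2)] continuous_intros continuous_on_compose2[OF c]) (use in_G in auto)
    then show ?thesis by (simp add: case_prod_beta)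
  qed
  have cz: "continuous_on (cbox 0 1) (\<lambda>x. g' (z + c x *s v))" "continuous_on (cbox 0 1) (\<lambda>x. g (z + c x *s v))" if "z \<in> ball a e" for z
    by (intro continuous_on_compose2[OF g'(2)] continuous_on_compose2[OF cg] continuous_intros continuous_on_compose2[OF c]; use in_G that in auto)+
  have "((\<lambda>z. integral (cbox 0 1) (\<lambda>x. g (z + c x *s v))) has_derivative blinfun_apply (integral (cbox 0 1) (\<lambda>x. g' (z0 + c x *s v)))) (at z0 within ball a e)"
  proof (rule leibniz_rule[OF d _ cont z0])
    show "(\<lambda>x. g (z + c x *s v)) integrable_on cbox 0 1" if "z \<in> ball a e" for z
      by (rule integrable_continuous[OF cz(2)[OF that]])
    show "convex (ball a e)" by (rule convex_ball)
  qed
  then have D: "((\<lambda>z. integral {0..1} (\<lambda>x. g (z + c x *s v))) has_derivative blinfun_apply (integral {0..1} (\<lambda>x. g' (z0 + c x *s v)))) (at z0)"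
    unfolding at_within_open[OF z0 open_ball] cbox_interval .
  have ap: "blinfun_apply (integral {0..1} (\<lambda>x. g' (z0 + c x *s v))) w = integral {0..1} (\<lambda>x. blinfun_apply (g' (z0 + c x *s v)) w)" for w
  proof -
    have "(\<lambda>x. g' (z0 + c x *s v)) integrable_on {0..1}" using cz(1)[OF z0] by (simp add: integrable_continuous_interval)
    then show ?thesis
      using integral_linear[of "\<lambda>x. g' (z0 + c x *s v)" "{0..1}" "\<lambda>b. blinfun_apply b w"]
      by (simp add: comp_def blinfun.bounded_linear_left)
  qed
  have "blinfun_apply (integral {0..1} (\<lambda>x. g' (z0 + c x *s v))) (k *s w) = k * blinfun_apply (integral {0..1} (\<lambda>x. g' (z0 + c x *s v))) w" for k w
  proof -
    have "integral {0..1} (\<lambda>x. blinfun_apply (g' (z0 + c x *s v)) (k *s w)) = integral {0..1} (\<lambda>x. k * blinfun_apply (g' (z0 + c x *s v)) w)"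
      using in_G[OF z0] by (intro Henstock_Kurzweil_Integration.integral_cong g'(3)) auto
    then show ?thesis unfolding ap by simp
  qed
  then show "\<exists>f'. ((\<lambda>z. integral {0..1} (\<lambda>x. g (z + c x *s v))) has_derivative f') (at z0) \<and> (\<forall>c v. f' (c *s v) = c * f' v)"
    using D by blast
qed

text \<open>Choose a disc through \<open>a\<close> on whose boundary \<open>f\<close> has no zero. The parallel discs through points
near \<open>a\<close> inherit this, and averaging \<open>g\<close> over their boundaries defines the extension.\<close>
lemma riemann_extension_local:
  fixes f g :: "complex^'n \<Rightarrow> complex"
  assumes D: "open D" "connected D" and f: "holomorphic_cn_on f D" "w \<in> D" "f w \<noteq> 0"
    and g: "holomorphic_cn_on g (D - {z \<in> D. f z = 0})" "\<And>z. z \<in> D \<Longrightarrow> f z \<noteq> 0 \<Longrightarrow> cmod (g z) \<le> B"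
    and a: "a \<in> D"
  obtains e H where "e > 0" "ball a e \<subseteq> D" "holomorphic_cn_on H (ball a e)" "\<And>z. z \<in> ball a e \<Longrightarrow> f z \<noteq> 0 \<Longrightarrow> H z = g z"
proof -
  let ?G = "D - {z \<in> D. f z = 0}"
  have oG: "open ?G"
  proof -
    have "open (D \<inter> f -` (- {0}))"
      by (rule continuous_open_preimage[OF holomorphic_cn_on_continuous[OF f(1)] D(1)]) (simp add: open_Compl)
    moreover have "D \<inter> f -` (- {0}) = ?G" by auto
    ultimately show ?thesis by simp
  qed
  obtain R0 where R0: "R0 > 0" "ball a R0 \<subseteq> D" using D(1) a open_contains_ball by blast
  define R where "R = R0 / 2"
  have R: "R > 0" "ball a R \<subseteq> D" using R0 by (auto simp: R_def)
  obtain b where b: "b \<in> ball a R" "f b \<noteq> 0"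
    using nonzero_point_nearby[OF f(1) D f(2,3), of "ball a R" a] a R by auto
  define v where "v = b - a"
  let ?S0 = "{t. a + t *s v \<in> ball a R}"
  have S0: "open ?S0" "convex ?S0" by (rule holomorphic_line_convex)+
  have "\<exists>r>0. cball 0 r \<subseteq> ?S0 \<and> (\<forall>t. cmod t = r \<longrightarrow> f (a + t *s v) \<noteq> 0)"
  proof -
    have z: "0 \<in> ?S0" "1 \<in> ?S0" using R b by (auto simp: v_def)
    have hol: "(\<lambda>t. f (a + t *s v)) holomorphic_on ?S0" using R(2) by (intro holomorphic_on_line[OF f(1)]) auto
    have "\<exists>r>0. ball 0 r \<subseteq> ?S0 \<and> (\<forall>t\<in>ball 0 r - {0}. f (a + t *s v) \<noteq> 0)"
    proof (cases "f a = 0")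
      case True
      have "f (a + 1 *s v) \<noteq> 0" using b by (simp add: v_def)
      then show ?thesis using isolated_zeros[OF hol S0(1) convex_connected[OF S0(2)] z(1) _ z(2)] True by (metis (no_types, lifting) add.right_neutral vector_smult_lzero)
    next
      case False
      have "open ({t \<in> ?S0. f (a + t *s v) \<noteq> 0})"
        using continuous_open_preimage[OF holomorphic_on_imp_continuous_on[OF hol] S0(1), of "- {0}"]
        by (simp add: open_Compl vimage_def Collect_conj_eq)
      moreover have "0 \<in> {t \<in> ?S0. f (a + t *s v) \<noteq> 0}" using z(1) False by simp
      ultimately obtain r where "r > 0" "ball 0 r \<subseteq> {t \<in> ?S0. f (a + t *s v) \<noteq> 0}" using open_contains_ball by blast
      then show ?thesis by blast
    qed
    then obtain r where r: "r > 0" "ball 0 r \<subseteq> ?S0" "\<forall>t\<in>ball 0 r - {0}. f (a + t *s v) \<noteq> 0" by blast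
    have "cball 0 (r / 2) \<subseteq> ball (0::complex) r" using r(1) by auto
    moreover have "f (a + t *s v) \<noteq> 0" if "cmod t = r / 2" for t
    proof -
      have "t \<in> ball 0 r - {0}" using that r(1) by auto
      then show ?thesis using r(3) by blast
    qed
    ultimately show ?thesis using r by (intro exI[of _ "r / 2"]) auto
  qed
  then obtain r where r: "r > 0" "cball 0 r \<subseteq> ?S0" "\<And>t. cmod t = r \<Longrightarrow> f (a + t *s v) \<noteq> 0" by blast
  let ?K = "(\<lambda>t. a + t *s v) ` sphere 0 r"
  have "compact ?K" by (intro compact_continuous_image continuous_intros compact_sphere)
  moreover have "?K \<subseteq> ?G"
  proof
    fix y assume "y \<in> ?K"
    then obtain t where "t \<in> sphere 0 r" and y: "y = a + t *s v" by blast
    then have t: "y = a + t *s v" "cmod t = r" by simp_all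
    then have "t \<in> cball 0 r" by simp
    then have "y \<in> ball a R" using r(2) t(1) by blast
    then show "y \<in> ?G" using R(2) r(3)[OF t(2)] t(1) by auto
  qed
  ultimately obtain e0 where e0: "e0 > 0" "(\<Union>x\<in>?K. ball x e0) \<subseteq> ?G"
    using compact_subset_open_imp_ball_epsilon_subset[OF _ oG] by blast
  define e where "e = min e0 R"
  have e: "e > 0" "e \<le> e0" "e \<le> R" using e0 R by (auto simp: e_def)
  have sh: "dist (a + u) (z + u) = dist a z" for u z :: "complex^'n" by (simp add: dist_norm)
  have circ: "z + t *s v \<in> ?G" if "z \<in> ball a e" "cmod t = r" for z t
  proof -
    have "z + t *s v \<in> ball (a + t *s v) e0" using that(1) e by (simp add: sh)
    then show ?thesis using e0(2) that(2) by (auto simp: subset_eq)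
  qed
  have disc: "cball 0 r \<subseteq> {t. z + t *s v \<in> ball a R0}" if "z \<in> ball a e" for z
  proof
    fix t :: complex assume "t \<in> cball 0 r"
    then have "dist a (a + t *s v) < R" using r(2) by auto
    moreover have "dist (a + t *s v) (z + t *s v) < R" using that e by (simp add: sh)
    ultimately have "dist a (z + t *s v) < R + R" using dist_triangle[of a "z + t *s v" "a + t *s v"] by linarith
    then show "t \<in> {t. z + t *s v \<in> ball a R0}" by (simp add: R_def)
  qed
  define c where "c = (\<lambda>x. of_real r * exp (2 * of_real pi * \<i> * of_real x) :: complex)"
  have cr: "cmod (c x) = r" for x using r(1) by (simp add: c_def norm_mult)
  define H where "H = (\<lambda>z. integral {0..1} (\<lambda>x. g (z + c x *s v)))"
  show ?thesis
  proof (rule that[OF e(1)])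
    show "ball a e \<subseteq> D" using R(2) e(3) by auto
    show "holomorphic_cn_on H (ball a e)"
      unfolding H_def by (rule circle_average_holomorphic[OF g(1) oG]) (use circ cr in \<open>auto simp: c_def intro!: continuous_intros\<close>)
    fix z assume z: "z \<in> ball a e" "f z \<noteq> 0"
    let ?q = "\<lambda>t. f (z + t *s v)" and ?g = "\<lambda>t. g (z + t *s v)"
    have "?g 0 = integral {0..1} (\<lambda>x. ?g (circle_point r x))"
    proof (rule bounded_holomorphic_mean_value_off_zeros[where S = "{t. z + t *s v \<in> ball a R0}" and q = ?q])
      show "open ({t. z + t *s v \<in> ball a R0})" "connected ({t. z + t *s v \<in> ball a R0})" using holomorphic_line_convex[of z v a R0] by (auto intro: convex_connected)
      show "cball 0 r \<subseteq> {t. z + t *s v \<in> ball a R0}" by (rule disc[OF z(1)])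
      show "?q holomorphic_on {t. z + t *s v \<in> ball a R0}" using R0(2) by (intro holomorphic_on_line[OF f(1)]) auto
      show "?q 0 \<noteq> 0" using z(2) by simp
      show "?q t \<noteq> 0" if "cmod t = r" for t using circ[OF z(1) that] by auto
      show "?g holomorphic_on {t. z + t *s v \<in> ball a R0} - {t \<in> {t. z + t *s v \<in> ball a R0}. ?q t = 0}"
        using R0(2) by (intro holomorphic_on_line[OF g(1)]) auto
      show "cmod (?g t) \<le> B" if "t \<in> {t. z + t *s v \<in> ball a R0} - {t \<in> {t. z + t *s v \<in> ball a R0}. ?q t = 0}" for t
        using that R0(2) by (intro g(2)) auto
    qed (rule r(1))
    then show "H z = g z" by (simp add: H_def c_def)
  qed
qed

lemma eq_off_zeros:
  fixes f :: "complex^'n \<Rightarrow> complex" and h1 h2 :: "complex^'n \<Rightarrow> 'b::real_normed_vector"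
  assumes D: "open D" "connected D" and f: "holomorphic_cn_on f D" "w \<in> D" "f w \<noteq> 0"
    and U: "open U" "U \<subseteq> D" "continuous_on U h1" "continuous_on U h2"
    and eq: "\<And>z. z \<in> U \<Longrightarrow> f z \<noteq> 0 \<Longrightarrow> h1 z = h2 z" and z: "z \<in> U"
  shows "h1 z = h2 z"
proof (rule ccontr)
  assume ne: "h1 z \<noteq> h2 z"
  have o: "open (U \<inter> (\<lambda>z. h1 z - h2 z) -` (- {0}))"
    using U by (intro continuous_open_preimage continuous_intros) (auto simp: open_Compl)
  have m: "z \<in> U \<inter> (\<lambda>z. h1 z - h2 z) -` (- {0})" using ne z by simp
  have "z \<in> D" using U(2) z by blast
  then obtain b where "b \<in> (U \<inter> (\<lambda>z. h1 z - h2 z) -` (- {0})) \<inter> D" "f b \<noteq> 0"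
    using nonzero_point_nearby[OF f(1) D f(2,3) o m] by blast
  then show False using eq by auto
qed

text \<open>Local extensions agree by density of the complement of the zeros, so their values at the centres
of the balls fit together.\<close>
theorem riemann_removable_hypersurface:
  fixes f g :: "complex^'n \<Rightarrow> complex"
  assumes D: "open D" "connected D" and f: "holomorphic_cn_on f D" "w \<in> D" "f w \<noteq> 0"
    and g: "holomorphic_cn_on g (D - {z \<in> D. f z = 0})" "\<And>z. z \<in> D \<Longrightarrow> f z \<noteq> 0 \<Longrightarrow> cmod (g z) \<le> B"
  obtains H where "holomorphic_cn_on H D" "\<And>z. z \<in> D \<Longrightarrow> f z \<noteq> 0 \<Longrightarrow> H z = g z"
proof -
  have "\<forall>a\<in>D. \<exists>e H. e > 0 \<and> ball a e \<subseteq> D \<and> holomorphic_cn_on H (ball a e) \<and> (\<forall>z\<in>ball a e. f z \<noteq> 0 \<longrightarrow> H z = g z)"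
  proof
    fix a assume a: "a \<in> D"
    show "\<exists>e H. e > 0 \<and> ball a e \<subseteq> D \<and> holomorphic_cn_on H (ball a e) \<and> (\<forall>z\<in>ball a e. f z \<noteq> 0 \<longrightarrow> H z = g z)"
    proof (rule riemann_extension_local[OF D f g a])
      fix e H assume "e > 0" "ball a e \<subseteq> D" "holomorphic_cn_on H (ball a e)" "\<And>z. z \<in> ball a e \<Longrightarrow> f z \<noteq> 0 \<Longrightarrow> H z = g z"
      then show ?thesis by (intro exI[of _ e] exI[of _ H]) simp
    qed
  qed
  then obtain e H where eH: "\<And>a. a \<in> D \<Longrightarrow> e a > 0" "\<And>a. a \<in> D \<Longrightarrow> ball a (e a) \<subseteq> D"
    "\<And>a. a \<in> D \<Longrightarrow> holomorphic_cn_on (H a) (ball a (e a))"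
    "\<And>a z. a \<in> D \<Longrightarrow> z \<in> ball a (e a) \<Longrightarrow> f z \<noteq> 0 \<Longrightarrow> H a z = g z"
    by metis
  have agree: "H z z = H a z" if a: "a \<in> D" "z \<in> ball a (e a)" for a z
  proof -
    have zD: "z \<in> D" using a eH(2) by blast
    let ?U = "ball z (e z) \<inter> ball a (e a)"
    show ?thesis
    proof (rule eq_off_zeros[OF D f, of ?U "H z" "H a"])
      show "continuous_on ?U (H z)" "continuous_on ?U (H a)"
        using holomorphic_cn_on_continuous[OF eH(3)[OF zD]] holomorphic_cn_on_continuous[OF eH(3)[OF a(1)]]
        by (auto intro: continuous_on_subset)
      show "?U \<subseteq> D" using eH(2) a(1) by blast
      show "z \<in> ?U" using a eH(1)[OF zD] by simp
      show "H z y = H a y" if "y \<in> ?U" "f y \<noteq> 0" for y using eH(4) zD a(1) that by auto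
    qed (intro open_Int open_ball)
  qed
  show ?thesis
  proof (rule that[of "\<lambda>z. H z z"])
    show "holomorphic_cn_on (\<lambda>z. H z z) D"
    proof (rule holomorphic_cn_onI)
      fix a assume a: "a \<in> D"
      have "holomorphic_cn_on (\<lambda>z. H z z) (ball a (e a))"
        by (rule holomorphic_cn_on_cong_open[OF eH(3)[OF a] open_ball agree[OF a]])
      moreover have "a \<in> ball a (e a)" using eH(1)[OF a] by simp
      ultimately show "\<exists>f'. ((\<lambda>z. H z z) has_derivative f') (at a) \<and> (\<forall>c v. f' (c *s v) = c * f' v)"
        unfolding holomorphic_cn_on_def by blast
    qed
    show "H z z = g z" if "z \<in> D" "f z \<noteq> 0" for z using eH(1,4) that by simp
  qed
qed

lemma has_derivative_vecI:
  fixes G :: "complex^'n \<Rightarrow> complex^'m"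
  assumes "\<And>i. ((\<lambda>z. G z $ i) has_derivative (\<lambda>h. G' h $ i)) (at z)"
  shows "(G has_derivative G') (at z)"
proof -
  have "((\<lambda>z. G z \<bullet> b) has_derivative (\<lambda>h. G' h \<bullet> b)) (at z)" if bB: "b \<in> Basis" for b
  proof -
    obtain i u where b: "b = axis i u" using bB unfolding Basis_vec_def UN_iff by blast
    have "((\<lambda>z. G z $ i \<bullet> u) has_derivative (\<lambda>h. G' h $ i \<bullet> u)) (at z)"
      by (rule bounded_linear.has_derivative[OF bounded_linear_inner_left assms])
    then show ?thesis by (simp add: b inner_axis)
  qed
  then show ?thesis unfolding has_derivative_componentwise_within[of G] by blast
qed

lemma holomorphic_map_C1:
  fixes G :: "complex^'n \<Rightarrow> complex^'m"
  assumes "holomorphic_map_on G D" "open D"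
  obtains G' where "\<And>z. z \<in> D \<Longrightarrow> (G has_derivative blinfun_apply (G' z)) (at z)" "continuous_on D G'"
    "\<And>z c v. z \<in> D \<Longrightarrow> blinfun_apply (G' z) (c *s v) = c *s blinfun_apply (G' z) v"
proof -
  have "\<forall>i. \<exists>g'. (\<forall>z\<in>D. ((\<lambda>z. G z $ i) has_derivative blinfun_apply (g' z)) (at z)) \<and> continuous_on D g' \<and>
     (\<forall>z\<in>D. \<forall>c v. blinfun_apply (g' z) (c *s v) = c * blinfun_apply (g' z) v)"
  proof
    fix i
    have h: "holomorphic_cn_on (\<lambda>z. G z $ i) D" using assms(1) by (simp add: holomorphic_map_on_def)
    show "\<exists>g'. (\<forall>z\<in>D. ((\<lambda>z. G z $ i) has_derivative blinfun_apply (g' z)) (at z)) \<and> continuous_on D g' \<and>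
     (\<forall>z\<in>D. \<forall>c v. blinfun_apply (g' z) (c *s v) = c * blinfun_apply (g' z) v)"
      using holomorphic_cn_on_C1[OF h assms(2)] by metis
  qed
  then obtain g' where g': "\<And>i z. z \<in> D \<Longrightarrow> ((\<lambda>z. G z $ i) has_derivative blinfun_apply (g' i z)) (at z)"
    "\<And>i. continuous_on D (g' i)" "\<And>i z c v. z \<in> D \<Longrightarrow> blinfun_apply (g' i z) (c *s v) = c * blinfun_apply (g' i z) v"
    by metis
  define G' where "G' = (\<lambda>z. Blinfun (\<lambda>h. \<chi> i. blinfun_apply (g' i z) h))"
  have ap: "blinfun_apply (G' z) = (\<lambda>h. \<chi> i. blinfun_apply (g' i z) h)" for z
  proof -
    have "linear (\<lambda>h. \<chi> i. blinfun_apply (g' i z) h)"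
      by (rule linearI) (auto simp: vec_eq_iff blinfun.add_right blinfun.scaleR_right)
    then show ?thesis unfolding G'_def by (intro bounded_linear_Blinfun_apply) (simp add: linear_conv_bounded_linear)
  qed
  show ?thesis
  proof (rule that[of G'])
    show "(G has_derivative blinfun_apply (G' z)) (at z)" if "z \<in> D" for z
      unfolding ap by (rule has_derivative_vecI) (use g'(1)[OF that] in simp)
    show "continuous_on D G'"
      by (rule continuous_on_blinfun_componentwise) (unfold ap, intro continuous_intros g'(2))
    show "blinfun_apply (G' z) (c *s v) = c *s blinfun_apply (G' z) v" if "z \<in> D" for z c v
      unfolding ap using g'(3)[OF that] by (simp add: vec_eq_iff)
  qed
qed

lemma holomorphic_map_continuous:
  assumes "holomorphic_map_on G D" shows "continuous_on D G"
proof -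
  have "continuous_on D (\<lambda>z. \<chi> i. G z $ i)"
    using assms by (intro continuous_on_vec_lambda holomorphic_cn_on_continuous) (simp add: holomorphic_map_on_def)
  then show ?thesis by simp
qed

lemma complex_linear_matrix:
  fixes L :: "complex^'n \<Rightarrow> complex^'m"
  assumes "linear L" "\<And>c v. L (c *s v) = c *s L v"
  shows "L = (*v) (matrix L)"
proof -
  have "Vector_Spaces.linear (*s) (*s) L"
    unfolding Vector_Spaces.linear_iff using assms linear_add[OF assms(1)]
    by (simp add: vec.vector_space_axioms)
  then have "L x = matrix L *v x" for x by (rule matrix_works[symmetric])
  then show ?thesis by blast
qed

lemma holomorphic_jacobian_eq:
  assumes "(G has_derivative G') (at z)" shows "holomorphic_jacobian G z = det (matrix G')"
  using frechet_derivative_at[OF assms] by (simp add: holomorphic_jacobian_def)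

lemma holomorphic_jacobian_continuous:
  fixes G :: "complex^'n \<Rightarrow> complex^'n"
  assumes "holomorphic_map_on G D" "open D"
  shows "continuous_on D (holomorphic_jacobian G)"
proof -
  obtain G' where G': "\<And>z. z \<in> D \<Longrightarrow> (G has_derivative blinfun_apply (G' z)) (at z)" "continuous_on D G'"
    "\<And>z c v. z \<in> D \<Longrightarrow> blinfun_apply (G' z) (c *s v) = c *s blinfun_apply (G' z) v"
    using holomorphic_map_C1[OF assms] by blast
  have "continuous_on D (\<lambda>z. det (matrix (blinfun_apply (G' z))))"
    unfolding det_def matrix_def by (simp, intro continuous_intros G'(2))
  then show ?thesis by (rule continuous_on_eq) (simp add: holomorphic_jacobian_eq[OF G'(1)])
qed

lemma holomorphic_map_eq_jacobian:
  assumes "open U" "z \<in> U" "\<And>y. y \<in> U \<Longrightarrow> G y = H y" "(H has_derivative H') (at z)"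
  shows "holomorphic_jacobian G z = holomorphic_jacobian H z"
proof -
  have "(G has_derivative H') (at z)"
    by (rule has_derivative_transform_within_open[OF assms(4,1,2)]) (simp add: assms(3))
  then show ?thesis using assms(4) by (simp add: holomorphic_jacobian_eq)
qed

lemma emeasure_linear_preimage_ball:
  fixes A :: "complex^'n^'n"
  assumes "invertible A" "s \<ge> 0"
  shows "emeasure lborel {z. A *v (z - z0) \<in> ball 0 s} = ennreal (1 / (cmod (det A))\<^sup>2 * (unit_ball_vol (real DIM(complex^'n)) * s ^ DIM(complex^'n)))"
proof -
  have pv: "pulls_volume ((*v) A) (1 / (cmod (det A))\<^sup>2)" by (rule matrix_pulls_volume[OF assms(1)])
  have [measurable]: "(*v) A \<in> borel_measurable borel" using pv by (simp add: pulls_volume_def)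
  let ?P = "(*v) A -` ball 0 s"
  have P: "?P \<in> sets borel" using measurable_sets[of "(*v) A" borel borel "ball 0 s"] by simp
  have "emeasure lborel {z. A *v (z - z0) \<in> ball 0 s} = (\<integral>\<^sup>+z. indicator ?P (z + - z0) \<partial>lborel)"
  proof -
    have "{z. A *v (z - z0) \<in> ball 0 s} = (\<lambda>z. z - z0) -` ?P" by auto
    moreover have "(\<lambda>z. z - z0) -` ?P \<in> sets borel"
      using measurable_sets[of "\<lambda>z. z - z0" borel borel ?P] P by simp
    moreover have "(indicator ?P (z + - z0) :: ennreal) = indicator ((\<lambda>z. z - z0) -` ?P) z" for z by (simp add: indicator_def)
    ultimately show ?thesis by simp
  qed
  also have "\<dots> = (\<integral>\<^sup>+z. indicator ?P z \<partial>lborel)"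
    by (rule nn_integral_lborel_shift) (use P in simp)
  also have "\<dots> = emeasure lborel ?P" using P by simp
  also have "\<dots> = ennreal (1 / (cmod (det A))\<^sup>2) * emeasure lborel (ball (0::complex^'n) s)"
    using pv unfolding pulls_volume_def by (metis open_ball borel_open)
  also have "emeasure lborel (ball (0::complex^'n) s) = ennreal (unit_ball_vol (real DIM(complex^'n)) * s ^ DIM(complex^'n))"
    by (rule emeasure_ball[OF assms(2)])
  also have "ennreal (1 / (cmod (det A))\<^sup>2) * \<dots> = ennreal (1 / (cmod (det A))\<^sup>2 * (unit_ball_vol (real DIM(complex^'n)) * s ^ DIM(complex^'n)))"
    by (rule ennreal_mult'[symmetric]) simp
  finally show ?thesis .
qed

text \<open>One half of the change of variables formula, at a single point, for the map \<open>G\<close> and the linear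
inverse \<open>A\<close> of its derivative. Up to a factor \<open>1 + \<epsilon>\<close>, \<open>G\<close> maps the ball of radius \<open>r\<close> into the
preimage under \<open>A\<close> of a ball of radius \<open>r\<close>, whose volume is known; the assumption \<open>vol\<close> says that the density
\<open>h\<close> gives the part \<open>P r\<close> of the image at least the mass of the original ball. Only this inequality is
proved: the opposite one arises by exchanging the roles of the two domains.\<close>
lemma jacobian_le_density:
  fixes A :: "complex^'n^'n" and G :: "complex^'n \<Rightarrow> complex^'n"
  assumes inv: "invertible A" and G: "(G has_derivative M) (at w0)" "\<And>v. A *v M v = v" "G w0 = z0"
    and h: "isCont h z0" "h z0 \<ge> 0"
    and r0: "r0 > 0" and P: "\<And>r z. 0 < r \<Longrightarrow> r < r0 \<Longrightarrow> z \<in> P r \<Longrightarrow> \<exists>w\<in>ball w0 r. z = G w"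
    and vol: "\<And>r. 0 < r \<Longrightarrow> r < r0 \<Longrightarrow> emeasure lborel (ball w0 r) \<le> (\<integral>\<^sup>+z. indicator (P r) z * ennreal (h z) \<partial>lborel)"
  shows "(cmod (det A))\<^sup>2 \<le> h z0"
proof -
  let ?N = "DIM(complex^'n)"
  let ?V = "unit_ball_vol (real ?N)"
  have V: "?V > 0" by (simp add: unit_ball_vol_pos)
  have dA: "(cmod (det A))\<^sup>2 > 0" using inv by (simp add: invertible_det_nz)
  have dAG: "((\<lambda>w. A *v G w) has_derivative (\<lambda>v. A *v M v)) (at w0)"
    using linear_matrix_vector_mult_complex[of A] by (intro bounded_linear.has_derivative[OF _ G(1)]) (simp add: linear_conv_bounded_linear)
  have key: "(cmod (det A))\<^sup>2 \<le> (h z0 + \<epsilon>) * (1 + \<epsilon>) ^ ?N" if \<epsilon>: "\<epsilon> > 0" for \<epsilon>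
  proof -
    obtain d1 where d1: "d1 > 0" "\<And>w. norm (w - w0) < d1 \<Longrightarrow> norm (A *v G w - A *v G w0 - (w - w0)) \<le> \<epsilon> * norm (w - w0)"
      using dAG \<epsilon> unfolding has_derivative_at_alt G(2) by blast
    obtain d2 where d2: "d2 > 0" "\<And>z. dist z z0 < d2 \<Longrightarrow> dist (h z) (h z0) < \<epsilon>"
      using h(1) \<epsilon> unfolding continuous_at_eps_delta by blast
    have "isCont G w0" using G(1) by (rule has_derivative_continuous)
    then obtain d3 where d3: "d3 > 0" "\<And>w. dist w w0 < d3 \<Longrightarrow> dist (G w) z0 < d2"
      using d2(1) unfolding continuous_at_eps_delta G(3) by blast
    define r where "r = min (min d1 d3) r0 / 2"
    have r: "r > 0" "r < d1" "r < d3" "r < r0" using d1(1) d3(1) r0 by (auto simp: r_def)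
    let ?E = "{z. A *v (z - z0) \<in> ball 0 ((1 + \<epsilon>) * r)}"
    have PE: "z \<in> ?E \<and> h z \<le> h z0 + \<epsilon>" if zP: "z \<in> P r" for z
    proof -
      obtain w where w: "w \<in> ball w0 r" "z = G w" using P[OF r(1,4) zP] by blast
      have nw: "norm (w - w0) < r" using w(1) by (simp add: dist_norm norm_minus_commute)
      have "A *v (z - z0) = (A *v G w - A *v G w0 - (w - w0)) + (w - w0)"
        by (simp add: w(2) G(3) matrix_vector_mult_diff_distrib)
      then have "norm (A *v (z - z0)) \<le> norm (A *v G w - A *v G w0 - (w - w0)) + norm (w - w0)"
        by (metis norm_triangle_ineq)
      also have "\<dots> \<le> \<epsilon> * norm (w - w0) + norm (w - w0)" using d1(2) nw r(2) by simp
      also have "\<dots> = (1 + \<epsilon>) * norm (w - w0)" by (simp add: algebra_simps)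
      also have "\<dots> < (1 + \<epsilon>) * r" using nw \<epsilon> by (intro mult_strict_left_mono) auto
      finally have "z \<in> ?E" by simp
      moreover have "dist (h z) (h z0) < \<epsilon>"
        using d2(2) d3(2) nw r(3) w(2) by (simp add: dist_norm)
      then have "h z \<le> h z0 + \<epsilon>" by (simp add: dist_real_def)
      ultimately show ?thesis by blast
    qed
    have Em: "?E \<in> sets borel"
    proof -
      have "continuous_on UNIV (\<lambda>z. A *v (z - z0))"
        unfolding matrix_vector_mult_def by (intro continuous_intros)
      then have "open ((\<lambda>z. A *v (z - z0)) -` ball 0 ((1 + \<epsilon>) * r))" by (intro open_vimage) auto
      then show ?thesis by (simp add: vimage_def)
    qed
    have "ennreal (?V * r ^ ?N) = emeasure lborel (ball w0 r)" using r(1) by (simp add: emeasure_ball)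
    also have "\<dots> \<le> (\<integral>\<^sup>+z. indicator (P r) z * ennreal (h z) \<partial>lborel)" by (rule vol[OF r(1,4)])
    also have "\<dots> \<le> (\<integral>\<^sup>+z. ennreal (h z0 + \<epsilon>) * indicator ?E z \<partial>lborel)"
      using PE by (intro nn_integral_mono) (auto simp: indicator_def intro!: ennreal_leI)
    also have "\<dots> = ennreal (h z0 + \<epsilon>) * emeasure lborel ?E"
      using Em by (simp add: nn_integral_cmult)
    also have "emeasure lborel ?E = ennreal (1 / (cmod (det A))\<^sup>2 * (?V * ((1 + \<epsilon>) * r) ^ ?N))"
      using \<epsilon> r by (intro emeasure_linear_preimage_ball[OF inv]) auto
    also have "ennreal (h z0 + \<epsilon>) * \<dots> = ennreal ((h z0 + \<epsilon>) * (1 / (cmod (det A))\<^sup>2 * (?V * ((1 + \<epsilon>) * r) ^ ?N)))"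
      using \<epsilon> h(2) by (intro ennreal_mult'[symmetric]) simp
    finally have "?V * r ^ ?N \<le> (h z0 + \<epsilon>) * (1 / (cmod (det A))\<^sup>2 * (?V * ((1 + \<epsilon>) * r) ^ ?N))"
      using \<epsilon> r h(2) V by (subst (asm) ennreal_le_iff) auto
    also have "\<dots> = ((h z0 + \<epsilon>) * (1 + \<epsilon>) ^ ?N / (cmod (det A))\<^sup>2) * (?V * r ^ ?N)"
      by (simp add: power_mult_distrib)
    finally have "1 * (?V * r ^ ?N) \<le> ((h z0 + \<epsilon>) * (1 + \<epsilon>) ^ ?N / (cmod (det A))\<^sup>2) * (?V * r ^ ?N)" by simp
    then have "1 \<le> (h z0 + \<epsilon>) * (1 + \<epsilon>) ^ ?N / (cmod (det A))\<^sup>2"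
      using V r(1) by (subst (asm) mult_le_cancel_right) auto
    then show ?thesis using dA by (simp add: le_divide_eq)
  qed
  have "((\<lambda>\<epsilon>. (h z0 + \<epsilon>) * (1 + \<epsilon>) ^ ?N) \<longlongrightarrow> (h z0 + 0) * (1 + 0) ^ ?N) (at_right 0)"
    by (intro tendsto_intros)
  then have "(cmod (det A))\<^sup>2 \<le> (h z0 + 0) * (1 + 0) ^ ?N"
  proof (rule tendsto_lowerbound)
    show "eventually (\<lambda>\<epsilon>. (cmod (det A))\<^sup>2 \<le> (h z0 + \<epsilon>) * (1 + \<epsilon>) ^ ?N) (at_right 0)"
      using eventually_at_right_less[of "0::real"] by eventually_elim (rule key)
  qed simp
  then show ?thesis by simp
qed

section \<open>Functions of class \<open>A\<^sup>p\<close>\<close>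

abbreviation Ap_coord :: "(complex^'n) set \<Rightarrow> 'n \<Rightarrow> complex^'n \<Rightarrow> complex" where
  "Ap_coord D i \<equiv> extend_zero D (\<lambda>z. z $ i)"

lemma Ap_holomorphic: "\<phi> \<in> Ap p D \<Longrightarrow> holomorphic_cn_on \<phi> D"
  by (simp add: Ap_def)

lemma Ap_outside: "\<phi> \<in> Ap p D \<Longrightarrow> z \<notin> D \<Longrightarrow> \<phi> z = 0"
  by (simp add: Ap_def)

lemma Ap_measurable:
  assumes "open D" "\<phi> \<in> Ap p D" shows "\<phi> \<in> borel_measurable borel"
proof -
  have "(\<lambda>z. if z \<in> D then \<phi> z else 0) \<in> borel_measurable borel"
    using assms(1)
    by (intro borel_measurable_continuous_on_if holomorphic_cn_on_continuous[OF Ap_holomorphic[OF assms(2)]] continuous_on_const) simp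
  also have "(\<lambda>z. if z \<in> D then \<phi> z else 0) = \<phi>" using Ap_outside[OF assms(2)] by auto
  finally show ?thesis .
qed

lemma Ap_integrable:
  assumes "\<phi> \<in> Ap p D" shows "integrable lborel (\<lambda>z. cmod (\<phi> z) powr p)"
proof -
  have "integrable lborel (\<lambda>z. indicator D z *\<^sub>R (cmod (\<phi> z) powr p))"
    using assms by (simp add: Ap_def set_integrable_def)
  also have "(\<lambda>z. indicator D z *\<^sub>R (cmod (\<phi> z) powr p)) = (\<lambda>z. cmod (\<phi> z) powr p)"
    using Ap_outside[OF assms] by (auto simp: indicator_def fun_eq_iff)
  finally show ?thesis .
qed

lemma ApI:
  assumes "holomorphic_cn_on \<phi> D" "\<And>z. z \<notin> D \<Longrightarrow> \<phi> z = 0" "integrable lborel (\<lambda>z. cmod (\<phi> z) powr p)"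
  shows "\<phi> \<in> Ap p D"
proof -
  have "(\<lambda>z. indicator D z *\<^sub>R (cmod (\<phi> z) powr p)) = (\<lambda>z. cmod (\<phi> z) powr p)"
    using assms(2) by (auto simp: indicator_def fun_eq_iff)
  then show ?thesis using assms by (simp add: Ap_def set_integrable_def)
qed

lemma Ap_norm_powr:
  assumes "p > 0" "\<phi> \<in> Ap p D"
  shows "(\<integral>\<^sup>+z. ennreal (cmod (\<phi> z) powr p) \<partial>lborel) = ennreal (Ap_norm p D \<phi> powr p)"
proof -
  have "(\<lambda>z. indicator D z *\<^sub>R (cmod (\<phi> z) powr p)) = (\<lambda>z. cmod (\<phi> z) powr p)"
    using Ap_outside[OF assms(2)] by (auto simp: indicator_def fun_eq_iff)
  then have "Ap_norm p D \<phi> = (\<integral>z. cmod (\<phi> z) powr p \<partial>lborel) powr (1 / p)"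
    by (simp add: Ap_norm_def set_lebesgue_integral_def)
  moreover have "(\<integral>z. cmod (\<phi> z) powr p \<partial>lborel) \<ge> 0" by simp
  ultimately have "Ap_norm p D \<phi> powr p = (\<integral>z. cmod (\<phi> z) powr p \<partial>lborel)"
    using assms(1) by (simp add: powr_powr)
  then show ?thesis using Ap_integrable[OF assms(2)] by (simp add: nn_integral_eq_integral)
qed

lemma Ap_add:
  assumes "open D" "p > 0" "\<phi> \<in> Ap p D" "\<psi> \<in> Ap p D" shows "(\<lambda>z. \<phi> z + \<psi> z) \<in> Ap p D"
proof (rule ApI)
  show "holomorphic_cn_on (\<lambda>z. \<phi> z + \<psi> z) D" using assms by (intro holomorphic_cn_on_add Ap_holomorphic)
  show "\<phi> z + \<psi> z = 0" if "z \<notin> D" for z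
    using Ap_outside[OF assms(3) that] Ap_outside[OF assms(4) that] by simp
  have [measurable]: "\<phi> \<in> borel_measurable borel" "\<psi> \<in> borel_measurable borel" using assms Ap_measurable by blast+
  show "integrable lborel (\<lambda>z. cmod (\<phi> z + \<psi> z) powr p)"
  proof (rule Bochner_Integration.integrable_bound[of _ "\<lambda>z. 2 powr p * (cmod (\<phi> z) powr p + cmod (\<psi> z) powr p)"])
    show "integrable lborel (\<lambda>z. 2 powr p * (cmod (\<phi> z) powr p + cmod (\<psi> z) powr p))"
      by (intro integrable_mult_right Bochner_Integration.integrable_add Ap_integrable[OF assms(3)] Ap_integrable[OF assms(4)])
    show "AE z in lborel. norm (cmod (\<phi> z + \<psi> z) powr p) \<le> norm (2 powr p * (cmod (\<phi> z) powr p + cmod (\<psi> z) powr p))"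
      using norm_diff_powr_le[OF assms(2), of "\<phi> _" "- \<psi> _"] by (intro AE_I2) simp
  qed measurable
qed

lemma Ap_scale:
  assumes "p > 0" "\<phi> \<in> Ap p D" shows "(\<lambda>z. c * \<phi> z) \<in> Ap p D"
proof (rule ApI)
  show "holomorphic_cn_on (\<lambda>z. c * \<phi> z) D"
    using assms by (intro holomorphic_cn_on_mult holomorphic_cn_on_const Ap_holomorphic)
  show "c * \<phi> z = 0" if "z \<notin> D" for z using Ap_outside[OF assms(2) that] by simp
  show "integrable lborel (\<lambda>z. cmod (c * \<phi> z) powr p)"
    using Ap_integrable[OF assms(2)] by (simp add: norm_mult powr_mult)
qed

lemma Ap_coord_in_Ap:
  assumes "open D" "bounded D" "p > 0" shows "Ap_coord D i \<in> Ap p D"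
proof -
  obtain C where C: "\<And>x. x \<in> D \<Longrightarrow> norm x \<le> C" using assms(2) unfolding bounded_iff by blast
  show ?thesis
    by (rule bounded_in_Ap[OF assms holomorphic_cn_on_nth, of _ C])
       (use C Finite_Cartesian_Product.norm_nth_le order_trans in blast)
qed

lemma vec_measurable:
  fixes f :: "'m::finite \<Rightarrow> 'x \<Rightarrow> complex"
  assumes "\<And>k. f k \<in> borel_measurable M"
  shows "(\<lambda>x. \<chi> k. f k x) \<in> borel_measurable M"
proof (rule borel_measurable_euclidean_space[THEN iffD2], rule ballI)
  fix b :: "complex^'m" assume bB: "b \<in> Basis"
  obtain j u where b: "b = axis j u" using bB unfolding Basis_vec_def UN_iff by blast
  have [measurable]: "f j \<in> borel_measurable M" by (rule assms)
  have "(\<lambda>x. f j x \<bullet> u) \<in> borel_measurable M" by measurable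
  then show "(\<lambda>x. (\<chi> k. f k x) \<bullet> b) \<in> borel_measurable M" by (simp add: b inner_axis)
qed

text \<open>The hypotheses are symmetric in the two domains. Facts about the map attached to the inverse of \<open>T\<close>
are obtained by interpreting the locale below a second time.\<close>
lemma Ap_isometry_inv_into:
  assumes "open D1" "p > 0" and T: "Ap_linear_isometry p D1 D2 T"
  shows "Ap_linear_isometry p D2 D1 (inv_into (Ap p D1) T)"
proof -
  let ?S = "inv_into (Ap p D1) T"
  have b: "bij_betw T (Ap p D1) (Ap p D2)" using T by (simp add: Ap_linear_isometry_def)
  have bS: "bij_betw ?S (Ap p D2) (Ap p D1)" by (rule bij_betw_inv_into[OF b])
  have S: "?S \<psi> \<in> Ap p D1" "T (?S \<psi>) = \<psi>" if "\<psi> \<in> Ap p D2" for \<psi>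
    using that bS b by (auto simp: bij_betw_apply bij_betw_inv_into_right)
  have inv: "?S (T \<phi>) = \<phi>" if "\<phi> \<in> Ap p D1" for \<phi> using that b by (simp add: bij_betw_inv_into_left)
  have "?S (\<lambda>z. \<phi> z + \<psi> z) = (\<lambda>w. ?S \<phi> w + ?S \<psi> w)" if "\<phi> \<in> Ap p D2" "\<psi> \<in> Ap p D2" for \<phi> \<psi>
  proof -
    have "T (\<lambda>w. ?S \<phi> w + ?S \<psi> w) = (\<lambda>z. \<phi> z + \<psi> z)"
      using T S that by (simp add: Ap_linear_isometry_def)
    then show ?thesis using inv[OF Ap_add[OF assms(1,2) S(1)[OF that(1)] S(1)[OF that(2)]]] by simp
  qed
  moreover have "?S (\<lambda>z. c * \<phi> z) = (\<lambda>w. c * ?S \<phi> w)" if "\<phi> \<in> Ap p D2" for \<phi> c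
  proof -
    have "T (\<lambda>w. c * ?S \<phi> w) = (\<lambda>z. c * \<phi> z)"
      using T S that by (simp add: Ap_linear_isometry_def)
    then show ?thesis using inv[OF Ap_scale[OF assms(2) S(1)[OF that], of c]] by simp
  qed
  moreover have "Ap_norm p D1 (?S \<phi>) = Ap_norm p D2 \<phi>" if "\<phi> \<in> Ap p D2" for \<phi>
  proof -
    have "Ap_norm p D2 (T (?S \<phi>)) = Ap_norm p D1 (?S \<phi>)" using T S(1)[OF that] unfolding Ap_linear_isometry_def by blast
    then show ?thesis using S(2)[OF that] by simp
  qed
  ultimately show ?thesis using bS by (simp add: Ap_linear_isometry_def)
qed

locale Ap_isometry =
  fixes p :: real and D1 D2 :: "(complex^'n) set" and T :: "(complex^'n \<Rightarrow> complex) \<Rightarrow> (complex^'n \<Rightarrow> complex)"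
  assumes p: "p > 0" "\<not> (\<exists>k::int. p = 2 * of_int k)"
    and D1: "is_domain D1" "bounded D1" and D2: "is_domain D2" "bounded D2"
    and T: "Ap_linear_isometry p D1 D2 T"
begin

lemma o1: "open D1" "connected D1" "D1 \<noteq> {}" and o2: "open D2" "connected D2" "D2 \<noteq> {}"
  using D1 D2 by (auto simp: is_domain_def)

definition Tinv where "Tinv = inv_into (Ap p D1) T"

definition \<phi>0 where "\<phi>0 = Tinv (Ap_one D2)"

definition \<psi> where "\<psi> i = Tinv (Ap_coord D2 i)"

text \<open>The set where the quotients defining \<open>F\<close> make sense.\<close>
definition G where "G = {z \<in> D1. \<phi>0 z \<noteq> 0}"

definition F where "F z = (\<chi> i. \<psi> i z / \<phi>0 z)"

lemma T_bij: "bij_betw T (Ap p D1) (Ap p D2)" using T by (simp add: Ap_linear_isometry_def)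

lemma T_in: "\<phi> \<in> Ap p D1 \<Longrightarrow> T \<phi> \<in> Ap p D2" using T_bij bij_betw_apply by metis

lemma Tinv_in: "\<phi> \<in> Ap p D2 \<Longrightarrow> Tinv \<phi> \<in> Ap p D1"
  unfolding Tinv_def using bij_betw_inv_into[OF T_bij] bij_betw_apply by metis

lemma T_Tinv: "\<phi> \<in> Ap p D2 \<Longrightarrow> T (Tinv \<phi>) = \<phi>"
  unfolding Tinv_def using T_bij by (simp add: bij_betw_inv_into_right)

lemma T_add: "\<phi> \<in> Ap p D1 \<Longrightarrow> \<psi>' \<in> Ap p D1 \<Longrightarrow> T (\<lambda>z. \<phi> z + \<psi>' z) = (\<lambda>w. T \<phi> w + T \<psi>' w)"
  using T by (simp add: Ap_linear_isometry_def)

lemma T_scale: "\<phi> \<in> Ap p D1 \<Longrightarrow> T (\<lambda>z. c * \<phi> z) = (\<lambda>w. c * T \<phi> w)"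
  using T by (simp add: Ap_linear_isometry_def)

lemma T_nn_integral:
  assumes "\<phi> \<in> Ap p D1"
  shows "(\<integral>\<^sup>+z. ennreal (cmod (\<phi> z) powr p) \<partial>lborel) = (\<integral>\<^sup>+w. ennreal (cmod (T \<phi> w) powr p) \<partial>lborel)"
proof -
  have "Ap_norm p D2 (T \<phi>) = Ap_norm p D1 \<phi>" using T assms by (simp add: Ap_linear_isometry_def)
  then show ?thesis unfolding Ap_norm_powr[OF p(1) assms] Ap_norm_powr[OF p(1) T_in[OF assms]] by simp
qed

lemma one_in: "Ap_one D1 \<in> Ap p D1" "Ap_one D2 \<in> Ap p D2"
  using Ap_one_in_Ap o1 o2 D1 D2 p by blast+

lemma coord_in: "Ap_coord D1 i \<in> Ap p D1" "Ap_coord D2 i \<in> Ap p D2"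
  using Ap_coord_in_Ap o1 o2 D1 D2 p by blast+

lemma \<phi>0: "\<phi>0 \<in> Ap p D1" "T \<phi>0 = Ap_one D2"
  unfolding \<phi>0_def using Tinv_in T_Tinv one_in by auto

lemma \<psi>: "\<psi> i \<in> Ap p D1" "T (\<psi> i) = Ap_coord D2 i"
  unfolding \<psi>_def using Tinv_in T_Tinv coord_in by auto

lemma T_sum:
  assumes "finite K" "\<And>k. k \<in> K \<Longrightarrow> \<Phi> k \<in> Ap p D1"
  shows "(\<lambda>z. \<Sum>k\<in>K. c k * \<Phi> k z) \<in> Ap p D1 \<and> T (\<lambda>z. \<Sum>k\<in>K. c k * \<Phi> k z) = (\<lambda>w. \<Sum>k\<in>K. c k * T (\<Phi> k) w)"
  using assms
proof (induction rule: finite_induct)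
  case empty
  show ?case using Ap_scale[OF p(1) one_in(1), of 0] T_scale[OF one_in(1), of 0] by simp
next
  case (insert k K)
  then have IH: "(\<lambda>z. \<Sum>k\<in>K. c k * \<Phi> k z) \<in> Ap p D1" "T (\<lambda>z. \<Sum>k\<in>K. c k * \<Phi> k z) = (\<lambda>w. \<Sum>k\<in>K. c k * T (\<Phi> k) w)"
    and k: "\<Phi> k \<in> Ap p D1" by auto
  note s = Ap_scale[OF p(1) k, of "c k"]
  show ?case using insert.hyps Ap_add[OF o1(1) p(1) s IH(1)] T_add[OF s IH(1)] T_scale[OF k, of "c k"] IH(2) by simp
qed

lemma \<phi>0_nonzero: obtains w where "w \<in> D1" "\<phi>0 w \<noteq> 0"
proof (rule ccontr)
  assume "\<not> thesis"
  then have "\<phi>0 = (\<lambda>z. 0)" using that Ap_outside[OF \<phi>0(1)] by blast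
  then have "T \<phi>0 = (\<lambda>w. 0)" using T_scale[OF \<phi>0(1), of 0] by simp
  moreover obtain w where "w \<in> D2" using o2 by blast
  ultimately show False using \<phi>0(2) by (auto simp: extend_zero_def dest: fun_cong[of _ _ w])
qed

lemma AE_\<phi>0: "AE z in lborel. z \<in> D1 \<longrightarrow> \<phi>0 z \<noteq> 0"
proof -
  obtain w where "w \<in> D1" "\<phi>0 w \<noteq> 0" by (rule \<phi>0_nonzero)
  then have "{z \<in> D1. \<phi>0 z = 0} \<in> null_sets lborel"
    using zeros_null[OF Ap_holomorphic[OF \<phi>0(1)] o1(1,2)] by blast
  then have "AE z in lborel. z \<notin> {z \<in> D1. \<phi>0 z = 0}" by (rule AE_not_in)
  then show ?thesis by eventually_elim auto
qed

text \<open>Both sides are masses of \<open>W\<close>: under the image of \<open>|\<phi>\<^sub>0|\<^sup>p d\<lambda>\<close> by the quotients, and under the image of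
Lebesgue measure on \<open>D2\<close>. The isometry property for the combinations \<open>comb s c\<close> says that the two image measures
satisfy the hypothesis of \<open>complex_affine_moments_determine_measure\<close>; the quotients are
meaningful almost everywhere because the zeros of \<open>\<phi>0\<close> form a null set.\<close>
theorem equimeasurable:
  fixes \<Phi> :: "'m::finite \<Rightarrow> complex^'n \<Rightarrow> complex"
  assumes \<Phi>: "\<And>k. \<Phi> k \<in> Ap p D1" and W: "W \<in> sets borel"
  shows "(\<integral>\<^sup>+z. ennreal (cmod (\<phi>0 z) powr p) * indicator W (\<chi> k. \<Phi> k z / \<phi>0 z) \<partial>lborel)
       = (\<integral>\<^sup>+w. indicator D2 w * indicator W (\<chi> k. T (\<Phi> k) w) \<partial>lborel)"
proof -
  define f where "f = (\<lambda>z. \<chi> k. \<Phi> k z / \<phi>0 z)"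
  define g where "g = (\<lambda>w. \<chi> k. T (\<Phi> k) w)"
  have m\<phi>0 [measurable]: "\<phi>0 \<in> borel_measurable borel" by (rule Ap_measurable[OF o1(1) \<phi>0(1)])
  have [measurable]: "\<Phi> k \<in> borel_measurable borel" for k by (rule Ap_measurable[OF o1(1) \<Phi>])
  have [measurable]: "T (\<Phi> k) \<in> borel_measurable borel" for k by (rule Ap_measurable[OF o2(1) T_in[OF \<Phi>]])
  have [measurable]: "D2 \<in> sets borel" using o2(1) by simp
  have mf [measurable]: "f \<in> borel_measurable borel" unfolding f_def by (rule vec_measurable) measurable
  have mg [measurable]: "g \<in> borel_measurable borel" unfolding g_def by (rule vec_measurable) measurable
  define \<mu> where "\<mu> = distr (density lborel (\<lambda>z. ennreal (cmod (\<phi>0 z) powr p))) borel f"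
  define \<nu> where "\<nu> = distr (density lborel (indicator D2)) borel g"
  have i\<mu>: "(\<integral>\<^sup>+x. H x \<partial>\<mu>) = (\<integral>\<^sup>+z. ennreal (cmod (\<phi>0 z) powr p) * H (f z) \<partial>lborel)"
    if [measurable]: "H \<in> borel_measurable borel" for H
    unfolding \<mu>_def by (subst nn_integral_distr, simp, simp, subst nn_integral_density) simp_all
  have i\<nu>: "(\<integral>\<^sup>+x. H x \<partial>\<nu>) = (\<integral>\<^sup>+w. indicator D2 w * H (g w) \<partial>lborel)"
    if [measurable]: "H \<in> borel_measurable borel" for H
    unfolding \<nu>_def by (subst nn_integral_distr, simp, simp, subst nn_integral_density) simp_all
  define comb where "comb = (\<lambda>s c z. s * \<phi>0 z + (\<Sum>k\<in>UNIV. c $ k * \<Phi> k z))"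
  have comb: "comb s c \<in> Ap p D1" "T (comb s c) = (\<lambda>w. s * Ap_one D2 w + (\<Sum>k\<in>UNIV. c $ k * T (\<Phi> k) w))" for s c
  proof -
    note sum = T_sum[of UNIV \<Phi> "\<lambda>k. c $ k", OF finite \<Phi>]
    note sc = Ap_scale[OF p(1) \<phi>0(1), of s]
    show "comb s c \<in> Ap p D1" unfolding comb_def using sum sc by (intro Ap_add o1(1) p(1)) auto
    show "T (comb s c) = (\<lambda>w. s * Ap_one D2 w + (\<Sum>k\<in>UNIV. c $ k * T (\<Phi> k) w))"
      unfolding comb_def using sum T_add[OF sc, of "\<lambda>z. \<Sum>k\<in>UNIV. c $ k * \<Phi> k z"] T_scale[OF \<phi>0(1), of s] \<phi>0(2) by simp
  qed
  have mom\<mu>: "(\<integral>\<^sup>+x. ennreal (cmod (s + bil c x) powr p) \<partial>\<mu>) = (\<integral>\<^sup>+z. ennreal (cmod (comb s c z) powr p) \<partial>lborel)" for s c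
  proof -
    have "(\<integral>\<^sup>+x. ennreal (cmod (s + bil c x) powr p) \<partial>\<mu>) = (\<integral>\<^sup>+z. ennreal (cmod (\<phi>0 z) powr p) * ennreal (cmod (s + bil c (f z)) powr p) \<partial>lborel)"
      by (rule i\<mu>) measurable
    also have "\<dots> = (\<integral>\<^sup>+z. ennreal (cmod (comb s c z) powr p) \<partial>lborel)"
    proof (rule nn_integral_cong_AE)
      show "AE z in lborel. ennreal (cmod (\<phi>0 z) powr p) * ennreal (cmod (s + bil c (f z)) powr p) = ennreal (cmod (comb s c z) powr p)"
        using AE_\<phi>0
      proof eventually_elim
        case (elim z)
        show ?case
        proof (cases "z \<in> D1")
          case True
          then have nz: "\<phi>0 z \<noteq> 0" using elim by simp
          have "comb s c z = \<phi>0 z * (s + bil c (f z))"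
            using nz by (simp add: comb_def bil_def f_def algebra_simps sum_distrib_left)
          then show ?thesis by (simp add: norm_mult powr_mult ennreal_mult)
        next
          case False
          then show ?thesis using Ap_outside[OF comb(1)] Ap_outside[OF \<phi>0(1)] by simp
        qed
      qed
    qed
    finally show ?thesis .
  qed
  have mom\<nu>: "(\<integral>\<^sup>+x. ennreal (cmod (s + bil c x) powr p) \<partial>\<nu>) = (\<integral>\<^sup>+w. ennreal (cmod (T (comb s c) w) powr p) \<partial>lborel)" for s c
  proof -
    have "(\<integral>\<^sup>+x. ennreal (cmod (s + bil c x) powr p) \<partial>\<nu>) = (\<integral>\<^sup>+w. indicator D2 w * ennreal (cmod (s + bil c (g w)) powr p) \<partial>lborel)"
      by (rule i\<nu>) measurable
    also have "\<dots> = (\<integral>\<^sup>+w. ennreal (cmod (T (comb s c) w) powr p) \<partial>lborel)"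
    proof (rule nn_integral_cong)
      fix w show "indicator D2 w * ennreal (cmod (s + bil c (g w)) powr p) = ennreal (cmod (T (comb s c) w) powr p)"
      proof (cases "w \<in> D2")
        case True
        then show ?thesis unfolding comb(2) by (simp add: bil_def g_def extend_zero_def)
      next
        case False
        then show ?thesis using Ap_outside[OF T_in[OF comb(1)]] by simp
      qed
    qed
    finally show ?thesis .
  qed
  have mom: "(\<integral>\<^sup>+x. ennreal (cmod (s + bil c x) powr p) \<partial>\<mu>) = (\<integral>\<^sup>+x. ennreal (cmod (s + bil c x) powr p) \<partial>\<nu>)" for s c
    unfolding mom\<mu> mom\<nu> by (rule T_nn_integral[OF comb(1)])
  \<comment> \<open>Finite \<open>p\<close>-norms also bound the total mass (take \<open>s = 1\<close>, \<open>c = 0\<close>) and the \<open>p\<close>-th moments of both measures.\<close>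
  have momfin: "(\<integral>\<^sup>+x. ennreal (cmod (s + bil c x) powr p) \<partial>\<mu>) < \<infinity>" for s c
    unfolding mom\<mu> Ap_norm_powr[OF p(1) comb(1)] by simp
  have bil0: "bil 0 x = 0" for x :: "complex^'m" by (simp add: bil_def)
  have fin: "finite_measure M \<and> integrable M (\<lambda>x. norm x powr p)"
    if sM [measurable_cong]: "sets M = sets borel" and mM: "\<And>s c. (\<integral>\<^sup>+x. ennreal (cmod (s + bil c x) powr p) \<partial>M) < \<infinity>" for M :: "(complex^'m) measure"
  proof
    have "(\<integral>\<^sup>+x. ennreal (cmod (1 + bil 0 x) powr p) \<partial>M) = emeasure M (space M)" by (simp add: bil0)
    then show "finite_measure M" using mM[of 1 0] by (intro finite_measureI) simp
    have bk: "bil (axis k 1) x = x $ k" for k and x :: "complex^'m"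
      unfolding bil_def by (simp add: axis_def if_distrib[where f="\<lambda>a. a * _"] cong: if_cong)
    have ik: "integrable M (\<lambda>x. cmod (bil (axis k 1) x) powr p)" for k
      using mM[of 0 "axis k 1"] by (intro integrableI_bounded) auto
    let ?m = "real CARD('m)"
    show "integrable M (\<lambda>x. norm x powr p)"
    proof (rule Bochner_Integration.integrable_bound[of _ "\<lambda>x. ?m powr p * (\<Sum>k\<in>UNIV. cmod (bil (axis k 1) x) powr p)"])
      show "integrable M (\<lambda>x. ?m powr p * (\<Sum>k\<in>UNIV. cmod (bil (axis k 1) x) powr p))"
        by (intro integrable_mult_right Bochner_Integration.integrable_sum ik)
      show "AE x in M. norm (norm x powr p) \<le> norm (?m powr p * (\<Sum>k\<in>UNIV. cmod (bil (axis k 1) x) powr p))"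
      proof (rule AE_I2)
        fix x :: "complex^'m"
        obtain k0 where k0: "\<And>k. cmod (x $ k) \<le> cmod (x $ k0)"
        proof -
          have "Max (range (\<lambda>k. cmod (x $ k))) \<in> range (\<lambda>k. cmod (x $ k))" by (rule Max_in) auto
          then obtain k0 where "Max (range (\<lambda>k. cmod (x $ k))) = cmod (x $ k0)" by blast
          moreover have "cmod (x $ k) \<le> Max (range (\<lambda>k. cmod (x $ k)))" for k by (rule Max_ge) auto
          ultimately show ?thesis using that by metis
        qed
        have "norm x \<le> (\<Sum>k\<in>UNIV. cmod (x $ k))" unfolding norm_vec_def by (rule L2_set_le_sum) simp
        also have "\<dots> \<le> ?m * cmod (x $ k0)" using sum_bounded_above[of UNIV "\<lambda>k. cmod (x $ k)" "cmod (x $ k0)"] k0 by simp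
        finally have "norm x powr p \<le> (?m * cmod (x $ k0)) powr p" using p(1) by (intro powr_mono2) auto
        also have "\<dots> = ?m powr p * cmod (x $ k0) powr p" by (simp add: powr_mult)
        also have "\<dots> \<le> ?m powr p * (\<Sum>k\<in>UNIV. cmod (x $ k) powr p)"
          by (intro mult_left_mono member_le_sum) auto
        finally show "norm (norm x powr p) \<le> norm (?m powr p * (\<Sum>k\<in>UNIV. cmod (bil (axis k 1) x) powr p))"
          by (simp add: bk sum_nonneg)
      qed
    qed measurable
  qed
  have s: "sets \<mu> = sets borel" "sets \<nu> = sets borel" by (simp_all add: \<mu>_def \<nu>_def)
  have "\<mu> = \<nu>"
  proof (rule complex_affine_moments_determine_measure[OF p _ _ s _ _ mom])
    show "finite_measure \<mu>" "integrable \<mu> (\<lambda>x. norm x powr p)" using fin[OF s(1)] momfin by blast+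
    show "finite_measure \<nu>" "integrable \<nu> (\<lambda>x. norm x powr p)" using fin[OF s(2)] momfin mom by auto
  qed
  then show ?thesis using i\<mu>[of "indicator W"] i\<nu>[of "indicator W"] W by (simp add: f_def g_def)
qed
end

section \<open>The map attached to an isometry\<close>

context Ap_isometry
begin

lemma Ap_isometry_inverse: "Ap_isometry p D2 D1 Tinv"
  unfolding Ap_isometry_def Tinv_def using p D1 D2 Ap_isometry_inv_into[OF o1(1) p(1) T] by auto

lemma Tinv_T: "\<phi> \<in> Ap p D1 \<Longrightarrow> Tinv (T \<phi>) = \<phi>"
  unfolding Tinv_def using T_bij by (simp add: bij_betw_inv_into_left)

lemma inverse_Tinv: "\<phi> \<in> Ap p D1 \<Longrightarrow> Ap_isometry.Tinv p D2 Tinv \<phi> = T \<phi>"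
proof -
  assume \<phi>: "\<phi> \<in> Ap p D1"
  interpret I: Ap_isometry p D2 D1 Tinv by (rule Ap_isometry_inverse)
  show "I.Tinv \<phi> = T \<phi>" using I.Tinv_T[OF T_in[OF \<phi>]] Tinv_T[OF \<phi>] by simp
qed

lemma G_open: "open G" and G_sub: "G \<subseteq> D1"
proof -
  have "open (D1 \<inter> \<phi>0 -` (- {0}))"
    by (rule continuous_open_preimage[OF holomorphic_cn_on_continuous[OF Ap_holomorphic[OF \<phi>0(1)]] o1(1)]) (simp add: open_Compl)
  moreover have "D1 \<inter> \<phi>0 -` (- {0}) = G" by (auto simp: G_def)
  ultimately show "open G" by simp
qed (auto simp: G_def)

lemma F_holomorphic: "holomorphic_map_on F G"
  unfolding holomorphic_map_on_def F_def
  using holomorphic_cn_on_divide[OF holomorphic_cn_on_subset[OF Ap_holomorphic[OF \<psi>(1)] G_sub] holomorphic_cn_on_subset[OF Ap_holomorphic[OF \<phi>0(1)] G_sub]]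
  by (simp add: G_def)

text \<open>The domain of the map attached to \<open>T\<close>, as \<open>assoc_source_eq\<close> shows.\<close>
definition U where "U = {z \<in> G. F z \<in> D2}"

lemma U_open: "open U" and U_sub: "U \<subseteq> G"
proof -
  have "open (G \<inter> F -` D2)"
    by (rule continuous_open_preimage[OF holomorphic_map_continuous[OF F_holomorphic] G_open o2(1)])
  moreover have "G \<inter> F -` D2 = U" by (auto simp: U_def)
  ultimately show "open U" by simp
qed (auto simp: U_def)

lemma \<phi>0_measurable [measurable]: "\<phi>0 \<in> borel_measurable borel"
  by (rule Ap_measurable[OF o1(1) \<phi>0(1)])

text \<open>Apply \<open>equimeasurable\<close> to the coordinate preimages together with \<open>\<phi>\<close>, which gets the extra index
\<open>None\<close>. On \<open>D2\<close> the vector of transformed functions lies on the graph of \<open>T \<phi>\<close>, so \<open>W\<close>, the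
complement of the graph, is a null set on the other side as well.\<close>
lemma graph_AE:
  assumes \<phi>: "\<phi> \<in> Ap p D1"
  shows "AE z in lborel. z \<in> G \<longrightarrow> F z \<in> D2 \<and> \<phi> z / \<phi>0 z = T \<phi> (F z)"
proof -
  define \<Phi> where "\<Phi> = case_option \<phi> \<psi>"
  have \<Phi>: "\<Phi> k \<in> Ap p D1" for k by (cases k) (auto simp: \<Phi>_def \<phi> \<psi>)
  define pr :: "complex^('n option) \<Rightarrow> complex^'n" where "pr = (\<lambda>x. \<chi> i. x $ Some i)"
  have mnth [measurable]: "(\<lambda>x::complex^('n option). x $ k) \<in> borel_measurable borel" for k
    by (intro borel_measurable_continuous_onI continuous_intros)
  have [measurable]: "pr \<in> borel_measurable borel" unfolding pr_def by (rule vec_measurable) measurable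
  have [measurable]: "T \<phi> \<in> borel_measurable borel" by (rule Ap_measurable[OF o2(1) T_in[OF \<phi>]])
  have [measurable]: "\<phi> \<in> borel_measurable borel" by (rule Ap_measurable[OF o1(1) \<phi>])
  have [measurable]: "D2 \<in> sets borel" "G \<in> sets borel" using o2(1) G_open by auto
  define W where "W = {x \<in> space borel. \<not> (pr x \<in> D2 \<and> x $ None = T \<phi> (pr x))}"
  have W: "W \<in> sets borel" unfolding W_def by measurable
  have in_W: "(\<chi> k. \<Phi> k z / \<phi>0 z) \<in> W \<longleftrightarrow> \<not> (F z \<in> D2 \<and> \<phi> z / \<phi>0 z = T \<phi> (F z))" for z
    by (simp add: W_def pr_def \<Phi>_def F_def)
  have notW: "(\<chi> k. T (\<Phi> k) w) \<notin> W" if w: "w \<in> D2" for w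
  proof -
    have "pr (\<chi> k. T (\<Phi> k) w) = w" using w by (simp add: pr_def \<Phi>_def \<psi> extend_zero_def vec_eq_iff)
    then show ?thesis using w by (simp add: W_def \<Phi>_def)
  qed
  have "(\<integral>\<^sup>+z. ennreal (cmod (\<phi>0 z) powr p) * indicator W (\<chi> k. \<Phi> k z / \<phi>0 z) \<partial>lborel)
       = (\<integral>\<^sup>+w. indicator D2 w * indicator W (\<chi> k. T (\<Phi> k) w) \<partial>lborel)"
    by (rule equimeasurable[OF \<Phi> W])
  also have "\<dots> = (\<integral>\<^sup>+w. 0 \<partial>(lborel :: (complex^'n) measure))"
    by (intro nn_integral_cong) (use notW in \<open>auto simp: indicator_def\<close>)
  finally have z: "(\<integral>\<^sup>+z. ennreal (cmod (\<phi>0 z) powr p) * indicator W (\<chi> k. \<Phi> k z / \<phi>0 z) \<partial>lborel) = 0" by simp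
  have [measurable]: "\<Phi> k \<in> borel_measurable borel" for k by (rule Ap_measurable[OF o1(1) \<Phi>])
  have mc: "(\<lambda>z. \<chi> k. \<Phi> k z / \<phi>0 z) \<in> borel_measurable borel" by (rule vec_measurable) measurable
  have "(\<lambda>z. indicator W (\<chi> k. \<Phi> k z / \<phi>0 z) :: ennreal) \<in> borel_measurable borel"
    using measurable_compose[OF mc borel_measurable_indicator[OF W]] by simp
  then have "AE z in lborel. ennreal (cmod (\<phi>0 z) powr p) * indicator W (\<chi> k. \<Phi> k z / \<phi>0 z) = 0"
    using z by (subst (asm) nn_integral_0_iff_AE) auto
  then show ?thesis
  proof eventually_elim
    case (elim z)
    show ?case
    proof
      assume "z \<in> G"
      then have "ennreal (cmod (\<phi>0 z) powr p) \<noteq> 0" by (simp add: G_def)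
      then have "(\<chi> k. \<Phi> k z / \<phi>0 z) \<notin> W" using elim by (auto simp: indicator_def split: if_splits)
      then show "F z \<in> D2 \<and> \<phi> z / \<phi>0 z = T \<phi> (F z)" using in_W by blast
    qed
  qed
qed

lemma AE_U: "AE z in lborel. z \<in> G \<longrightarrow> z \<in> U"
  using graph_AE[OF \<phi>0(1)] by eventually_elim (auto simp: U_def)

text \<open>The functions \<open>T (\<psi> k)\<close> are the coordinates, so their joint distribution is Lebesgue measure on \<open>D2\<close>.\<close>
lemma image_volume:
  assumes B: "B \<in> sets borel"
  shows "(\<integral>\<^sup>+z. ennreal (cmod (\<phi>0 z) powr p) * indicator B (F z) \<partial>lborel) = emeasure lborel (D2 \<inter> B)"
proof -
  have "(\<integral>\<^sup>+z. ennreal (cmod (\<phi>0 z) powr p) * indicator B (F z) \<partial>lborel) = (\<integral>\<^sup>+w. indicator D2 w * indicator B (\<chi> k. T (\<psi> k) w) \<partial>lborel)"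
    using equimeasurable[OF \<psi>(1) B] by (simp add: F_def)
  also have "\<dots> = (\<integral>\<^sup>+w. indicator (D2 \<inter> B) w \<partial>lborel)"
  proof (rule nn_integral_cong)
    fix w
    have "(\<chi> k. T (\<psi> k) w) = w" if "w \<in> D2" using that by (simp add: \<psi> extend_zero_def vec_eq_iff)
    then show "indicator D2 w * indicator B (\<chi> k. T (\<psi> k) w) = (indicator (D2 \<inter> B) w :: ennreal)"
      by (auto simp: indicator_def)
  qed
  also have "\<dots> = emeasure lborel (D2 \<inter> B)" using B o2(1) by simp
  finally show ?thesis .
qed

text \<open>Both sides are continuous on the open set \<open>U\<close> and agree almost everywhere by \<open>graph_AE\<close>.\<close>
lemma T_weighted_composition:
  assumes \<phi>: "\<phi> \<in> Ap p D1" and z: "z \<in> U"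
  shows "\<phi> z = \<phi>0 z * T \<phi> (F z)"
proof -
  let ?g = "\<lambda>z. \<phi> z - \<phi>0 z * T \<phi> (F z)"
  have sub: "U \<subseteq> D1" using U_sub G_sub by blast
  have "continuous_on U (\<lambda>z. T \<phi> (F z))"
    by (rule continuous_on_compose2[OF holomorphic_cn_on_continuous[OF Ap_holomorphic[OF T_in[OF \<phi>]]]
          continuous_on_subset[OF holomorphic_map_continuous[OF F_holomorphic] U_sub]]) (auto simp: U_def)
  moreover have "continuous_on U \<phi>" "continuous_on U \<phi>0"
    using holomorphic_cn_on_continuous[OF Ap_holomorphic[OF \<phi>]] holomorphic_cn_on_continuous[OF Ap_holomorphic[OF \<phi>0(1)]] sub
    by (auto intro: continuous_on_subset)
  ultimately have "continuous_on U ?g" by (intro continuous_intros)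
  moreover have "AE z in lborel. z \<in> U \<longrightarrow> ?g z = 0"
    using graph_AE[OF \<phi>]
  proof eventually_elim
    case (elim z)
    show ?case
    proof
      assume "z \<in> U"
      then have "z \<in> G" "\<phi>0 z \<noteq> 0" by (auto simp: U_def G_def)
      then have "\<phi> z / \<phi>0 z = T \<phi> (F z)" using elim by blast
      then have "\<phi> z = \<phi>0 z * T \<phi> (F z)" using \<open>\<phi>0 z \<noteq> 0\<close> by (simp add: divide_eq_eq mult.commute)
      then show "?g z = 0" by simp
    qed
  qed
  ultimately have "?g z = 0" using continuous_AE_zero_imp_zero[OF U_open _ _ z] by blast
  then show ?thesis by simp
qed

text \<open>The preimage of the exterior of \<open>D2\<close> is open and null, hence empty.\<close>
lemma F_closure: "z \<in> G \<Longrightarrow> F z \<in> closure D2"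
proof (rule ccontr)
  assume z: "z \<in> G" and n: "F z \<notin> closure D2"
  have o: "open (G \<inter> F -` (- closure D2))"
    by (rule continuous_open_preimage[OF holomorphic_map_continuous[OF F_holomorphic] G_open]) (simp add: open_Compl)
  have "AE x in lborel. x \<in> G \<inter> F -` (- closure D2) \<longrightarrow> (1::real) = 0"
    using AE_U by eventually_elim (use closure_subset[of D2] in \<open>auto simp: U_def\<close>)
  then have "(1::real) = 0" using continuous_AE_zero_imp_zero[OF o continuous_on_const, of "1::real" z] z n by blast
  then show False by simp
qed

text \<open>If \<open>T\<close> takes the functions vanishing at \<open>z\<close> to those vanishing at \<open>w\<close>, then testing with
\<open>\<phi>0\<close> and with \<open>\<psi> i - w\<^sub>i \<phi>0\<close> gives \<open>\<phi>0 z \<noteq> 0\<close> and \<open>F z = w\<close>. The converse is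
\<open>T_weighted_composition\<close>.\<close>
lemma T_vanishing_iff:
  assumes "z \<in> D1" "w \<in> D2"
  shows "T ` Ap_vanishing p D1 z = Ap_vanishing p D2 w \<longleftrightarrow> z \<in> U \<and> F z = w"
proof
  assume eq: "T ` Ap_vanishing p D1 z = Ap_vanishing p D2 w"
  have vanish: "\<phi> z = 0" if \<phi>: "\<phi> \<in> Ap p D1" "T \<phi> w = 0" for \<phi>
  proof -
    have "T \<phi> \<in> T ` Ap_vanishing p D1 z" unfolding eq using \<phi> T_in by (simp add: Ap_vanishing_def)
    then obtain \<phi>' where "\<phi>' \<in> Ap p D1" "\<phi>' z = 0" "T \<phi>' = T \<phi>" by (auto simp: Ap_vanishing_def)
    then show ?thesis using T_bij \<phi>(1) by (metis bij_betw_inv_into_left)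
  qed
  have nz: "\<phi>0 z \<noteq> 0"
  proof
    assume "\<phi>0 z = 0"
    then have "T \<phi>0 \<in> Ap_vanishing p D2 w" unfolding eq[symmetric] using \<phi>0(1) by (simp add: Ap_vanishing_def)
    then show False using assms(2) by (simp add: \<phi>0(2) Ap_vanishing_def extend_zero_def)
  qed
  have "\<psi> i z / \<phi>0 z = w $ i" for i
  proof -
    note sc = Ap_scale[OF p(1) \<phi>0(1), of "- (w $ i)"]
    have "T (\<lambda>z. \<psi> i z + - (w $ i) * \<phi>0 z) w = 0"
      unfolding T_add[OF \<psi>(1) sc] T_scale[OF \<phi>0(1)] using assms(2) by (simp add: \<psi>(2) \<phi>0(2) extend_zero_def)
    then have "\<psi> i z + - (w $ i) * \<phi>0 z = 0" by (rule vanish[OF Ap_add[OF o1(1) p(1) \<psi>(1) sc]])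
    then show ?thesis using nz by (simp add: divide_eq_eq)
  qed
  then have "F z = w" by (simp add: F_def vec_eq_iff)
  then show "z \<in> U \<and> F z = w" using nz assms by (simp add: U_def G_def)
next
  assume z: "z \<in> U \<and> F z = w"
  have nz: "\<phi>0 z \<noteq> 0" using z by (auto simp: U_def G_def)
  show "T ` Ap_vanishing p D1 z = Ap_vanishing p D2 w"
  proof (intro equalityI subsetI)
    fix f assume "f \<in> T ` Ap_vanishing p D1 z"
    then obtain \<phi> where \<phi>: "\<phi> \<in> Ap p D1" "\<phi> z = 0" "f = T \<phi>" by (auto simp: Ap_vanishing_def)
    then show "f \<in> Ap_vanishing p D2 w"
      using T_weighted_composition[OF \<phi>(1), of z] z nz T_in by (auto simp: Ap_vanishing_def)
  next
    fix f assume "f \<in> Ap_vanishing p D2 w"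
    then have f: "f \<in> Ap p D2" "f w = 0" by (auto simp: Ap_vanishing_def)
    have "Tinv f z = 0" using T_weighted_composition[OF Tinv_in[OF f(1)], of z] z f by (simp add: T_Tinv)
    then show "f \<in> T ` Ap_vanishing p D1 z"
      using f by (intro image_eqI[of _ _ "Tinv f"]) (auto simp: Ap_vanishing_def T_Tinv Tinv_in)
  qed
qed

lemma assoc_source_eq: "assoc_source p D1 D2 T = U"
proof -
  have "U \<subseteq> D1" using U_sub G_sub by blast
  then show ?thesis using T_vanishing_iff by (auto simp: assoc_source_def U_def)
qed

lemma assoc_map_eq:
  assumes "z \<in> U" shows "assoc_map p D1 D2 T z = F z"
proof -
  have "z \<in> D1" "F z \<in> D2" using assms U_sub G_sub by (auto simp: U_def)
  then show ?thesis
    using assoc_map_iff[OF o2(1) D2(2) p(1), of z D1 T "F z"] T_vanishing_iff assms assoc_source_eq by blast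
qed

text \<open>The inverse of \<open>T\<close> has \<open>T 1\<close> in the role of \<open>\<phi>0\<close> and the transformed coordinates of \<open>D1\<close> in the role of the \<open>\<psi> i\<close>, so
all three claims follow from \<open>T_weighted_composition\<close> for \<open>1\<close> and for the coordinates.\<close>
lemma F_inverse:
  assumes z: "z \<in> U"
  shows "\<phi>0 z * T (Ap_one D1) (F z) = 1"
    and "Ap_isometry.F p D2 D1 Tinv (F z) = z"
    and "F z \<in> Ap_isometry.U p D2 D1 Tinv"
proof -
  interpret I: Ap_isometry p D2 D1 Tinv by (rule Ap_isometry_inverse)
  have zD: "z \<in> D1" "F z \<in> D2" using z U_sub G_sub by (auto simp: U_def)
  show 1: "\<phi>0 z * T (Ap_one D1) (F z) = 1"
    using T_weighted_composition[OF one_in(1) z] zD by (simp add: extend_zero_def)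
  have I0: "I.\<phi>0 = T (Ap_one D1)" unfolding I.\<phi>0_def by (rule inverse_Tinv[OF one_in(1)])
  have I\<psi>: "I.\<psi> i = T (Ap_coord D1 i)" for i unfolding I.\<psi>_def by (rule inverse_Tinv[OF coord_in(1)])
  have "I.\<psi> i (F z) / I.\<phi>0 (F z) = z $ i" for i
  proof -
    have "z $ i = \<phi>0 z * T (Ap_coord D1 i) (F z)"
      using T_weighted_composition[OF coord_in(1) z, of i] zD by (simp add: extend_zero_def)
    moreover have "T (Ap_one D1) (F z) \<noteq> 0" using 1 by auto
    ultimately show ?thesis using 1 unfolding I0 I\<psi> by (simp add: divide_eq_eq mult_ac)
  qed
  then show 2: "I.F (F z) = z" by (simp add: I.F_def vec_eq_iff)
  show "F z \<in> I.U" using zD 1 2 unfolding I.U_def I.G_def I0 by auto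
qed

lemma F_section:
  assumes w: "w \<in> Ap_isometry.U p D2 D1 Tinv"
  shows "Ap_isometry.F p D2 D1 Tinv w \<in> U" "F (Ap_isometry.F p D2 D1 Tinv w) = w"
proof -
  interpret I: Ap_isometry p D2 D1 Tinv by (rule Ap_isometry_inverse)
  have wD: "w \<in> D2" "I.F w \<in> D1" using w I.U_sub I.G_sub by (auto simp: I.U_def)
  have e: "Tinv ` Ap_vanishing p D2 w = Ap_vanishing p D1 (I.F w)"
    using I.T_vanishing_iff[OF wD] w by blast
  have "T ` (Tinv ` Ap_vanishing p D2 w) = Ap_vanishing p D2 w"
    unfolding image_image by (auto simp: Ap_vanishing_def T_Tinv intro!: image_eqI)
  then have "T ` Ap_vanishing p D1 (I.F w) = Ap_vanishing p D2 w" unfolding e .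
  then show "I.F w \<in> U" "F (I.F w) = w" using T_vanishing_iff[OF wD(2,1)] by auto
qed

end

section \<open>The Jacobian and the boundary behaviour\<close>

text \<open>Adding a null set to a domain does not change norms, and by the identity theorem continuations
are unique.\<close>
lemma restriction_isometry:
  fixes D E :: "(complex^'n) set"
  assumes p: "p > 0" and E: "open E" "connected E" and D: "open D" "D \<noteq> {}" "D \<subseteq> E"
    and null: "E - D \<in> null_sets lborel"
    and ext: "\<And>f. f \<in> Ap p D \<Longrightarrow> \<exists>g. holomorphic_cn_on g E \<and> (\<forall>z\<in>D. g z = f z)"
  shows "Ap_linear_isometry p E D (extend_zero D)"
proof -
  have AE_D: "AE z in lborel. z \<in> E \<longrightarrow> z \<in> D"
    using AE_not_in[OF null] by eventually_elim auto
  have ae: "AE z in lborel. cmod (extend_zero D f z) powr p = cmod (f z) powr p" if "\<And>z. z \<notin> E \<Longrightarrow> f z = 0" for f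
    using AE_D by eventually_elim (use that D(3) in \<open>auto simp: extend_zero_def\<close>)
  have mE: "f \<in> borel_measurable borel" if "holomorphic_cn_on f E" "\<And>z. z \<notin> E \<Longrightarrow> f z = 0" for f :: "_ \<Rightarrow> complex"
  proof -
    have "(\<lambda>z. if z \<in> E then f z else 0) \<in> borel_measurable borel"
      using E(1) by (intro borel_measurable_continuous_on_if holomorphic_cn_on_continuous[OF that(1)] continuous_on_const) simp
    also have "(\<lambda>z. if z \<in> E then f z else 0) = f" using that(2) by auto
    finally show ?thesis .
  qed
  have mD: "extend_zero D f \<in> borel_measurable borel" if "holomorphic_cn_on f E" for f
    unfolding extend_zero_def using D
    by (intro borel_measurable_continuous_on_if holomorphic_cn_on_continuous[OF holomorphic_cn_on_subset[OF that]] continuous_on_const) auto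
  have into: "extend_zero D f \<in> Ap p D" if f: "f \<in> Ap p E" for f
  proof (rule ApI)
    have hf: "holomorphic_cn_on f E" by (rule Ap_holomorphic[OF f])
    show "holomorphic_cn_on (extend_zero D f) D"
      by (rule holomorphic_cn_on_cong_open[OF holomorphic_cn_on_subset[OF hf D(3)] D(1)]) (simp add: extend_zero_def)
    show "extend_zero D f z = 0" if "z \<notin> D" for z using that by (simp add: extend_zero_def)
    have [measurable]: "f \<in> borel_measurable borel" "extend_zero D f \<in> borel_measurable borel"
      using mE[OF hf Ap_outside[OF f]] mD[OF hf] by auto
    show "integrable lborel (\<lambda>z. cmod (extend_zero D f z) powr p)"
      using Ap_integrable[OF f] by (subst integrable_cong_AE[OF _ _ ae[OF Ap_outside[OF f]]]) auto
  qed
  have norm: "Ap_norm p D (extend_zero D f) = Ap_norm p E f" if f: "f \<in> Ap p E" for f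
  proof -
    have hf: "holomorphic_cn_on f E" by (rule Ap_holomorphic[OF f])
    have [measurable]: "f \<in> borel_measurable borel" "extend_zero D f \<in> borel_measurable borel"
      using mE[OF hf Ap_outside[OF f]] mD[OF hf] by auto
    have "(\<integral>z. cmod (extend_zero D f z) powr p \<partial>lborel) = (\<integral>z. cmod (f z) powr p \<partial>lborel)"
      by (rule integral_cong_AE) (use ae[OF Ap_outside[OF f]] in auto)
    moreover have "(\<lambda>z. indicator D z *\<^sub>R (cmod (extend_zero D f z) powr p)) = (\<lambda>z. cmod (extend_zero D f z) powr p)"
      by (auto simp: fun_eq_iff extend_zero_def)
    moreover have "(\<lambda>z. indicator E z *\<^sub>R (cmod (f z) powr p)) = (\<lambda>z. cmod (f z) powr p)"
      using Ap_outside[OF f] by (auto simp: fun_eq_iff indicator_def)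
    ultimately show ?thesis by (simp add: Ap_norm_def set_lebesgue_integral_def)
  qed
  have "bij_betw (extend_zero D) (Ap p E) (Ap p D)"
  proof (rule bij_betw_imageI)
    show "inj_on (extend_zero D) (Ap p E)"
    proof (rule inj_onI)
      fix f g assume f: "f \<in> Ap p E" and g: "g \<in> Ap p E" and eq: "extend_zero D f = extend_zero D g"
      have h: "holomorphic_cn_on (\<lambda>z. f z + (- 1) * g z) E"
        by (intro holomorphic_cn_on_add holomorphic_cn_on_mult holomorphic_cn_on_const Ap_holomorphic[OF f] Ap_holomorphic[OF g])
      have "f z = g z" if "z \<in> D" for z
        using fun_cong[OF eq, of z] that by (simp add: extend_zero_def)
      then have "f z + (- 1) * g z = 0" if "z \<in> E" for z
        using holomorphic_cn_identity[OF h E D _ that] by simp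
      then have "f z = g z" for z using Ap_outside[OF f] Ap_outside[OF g] by (cases "z \<in> E") auto
      then show "f = g" by blast
    qed
    show "extend_zero D ` Ap p E = Ap p D"
    proof (intro equalityI subsetI)
      fix f assume f: "f \<in> Ap p D"
      obtain g0 where g0: "holomorphic_cn_on g0 E" "\<And>z. z \<in> D \<Longrightarrow> g0 z = f z" using ext[OF f] by blast
      define g where "g = extend_zero E g0"
      have hg: "holomorphic_cn_on g E"
        by (rule holomorphic_cn_on_cong_open[OF g0(1) E(1)]) (simp add: g_def extend_zero_def)
      have g_out: "g z = 0" if "z \<notin> E" for z using that by (simp add: g_def extend_zero_def)
      have eg: "extend_zero D g = f"
        using g0(2) D(3) Ap_outside[OF f] by (auto simp: g_def extend_zero_def fun_eq_iff)
      have [measurable]: "g \<in> borel_measurable borel" "f \<in> borel_measurable borel"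
        using mE[OF hg g_out] Ap_measurable[OF D(1) f] by auto
      have aeg: "AE z in lborel. cmod (f z) powr p = cmod (g z) powr p"
        using ae[of g] g_out unfolding eg by blast
      have "integrable lborel (\<lambda>z. cmod (g z) powr p)"
        using Ap_integrable[OF f] by (subst (asm) integrable_cong_AE[OF _ _ aeg]) auto
      then have "g \<in> Ap p E" using hg g_out by (intro ApI)
      then show "f \<in> extend_zero D ` Ap p E" using eg by blast
    qed (use into in auto)
  qed
  then show ?thesis using norm by (auto simp: Ap_linear_isometry_def extend_zero_def fun_eq_iff)
qed

lemma holomorphic_cn_on_Un:
  assumes "holomorphic_cn_on f A" "holomorphic_cn_on f B" shows "holomorphic_cn_on f (A \<union> B)"
  using assms unfolding holomorphic_cn_on_def by blast

context Ap_isometry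
begin

lemma jacobian_matrices:
  assumes z: "z \<in> U"
  obtains A B where "(F has_derivative (*v) A) (at z)" "(Ap_isometry.F p D2 D1 Tinv has_derivative (*v) B) (at (F z))"
    "A ** B = mat 1" "B ** A = mat 1"
proof -
  interpret I: Ap_isometry p D2 D1 Tinv by (rule Ap_isometry_inverse)
  obtain F' where F': "\<And>z. z \<in> G \<Longrightarrow> (F has_derivative blinfun_apply (F' z)) (at z)"
    "\<And>z c v. z \<in> G \<Longrightarrow> blinfun_apply (F' z) (c *s v) = c *s blinfun_apply (F' z) v"
    using holomorphic_map_C1[OF F_holomorphic G_open] by metis
  obtain I' where I': "\<And>z. z \<in> I.G \<Longrightarrow> (I.F has_derivative blinfun_apply (I' z)) (at z)"
    "\<And>z c v. z \<in> I.G \<Longrightarrow> blinfun_apply (I' z) (c *s v) = c *s blinfun_apply (I' z) v"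
    using holomorphic_map_C1[OF I.F_holomorphic I.G_open] by metis
  have lin: "linear (blinfun_apply b)" for b :: "(complex^'n) \<Rightarrow>\<^sub>L (complex^'n)"
    by (rule bounded_linear.linear[OF blinfun.bounded_linear_right])
  have zG: "z \<in> G" using z U_sub by blast
  have w: "F z \<in> I.U" "I.F (F z) = z" using F_inverse[OF z] by auto
  have wG: "F z \<in> I.G" using w(1) I.U_sub by blast
  define A where "A = matrix (blinfun_apply (F' z))"
  define B where "B = matrix (blinfun_apply (I' (F z)))"
  have A: "(*v) A = blinfun_apply (F' z)" unfolding A_def by (rule complex_linear_matrix[OF lin F'(2)[OF zG], symmetric])
  have B: "(*v) B = blinfun_apply (I' (F z))" unfolding B_def by (rule complex_linear_matrix[OF lin I'(2)[OF wG], symmetric])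
  have dA: "(F has_derivative (*v) A) (at z)" using F'(1)[OF zG] by (simp add: A)
  have dB: "(I.F has_derivative (*v) B) (at (F z))" using I'(1)[OF wG] by (simp add: B)
  have FI: "F (I.F w) = w" if "w \<in> I.U" for w using F_section[OF that] by blast
  have "((\<lambda>x. I.F (F x)) has_derivative (\<lambda>v. B *v (A *v v))) (at z)"
    by (rule has_derivative_compose[OF dA dB])
  then have "((\<lambda>x. x) has_derivative (\<lambda>v. B *v (A *v v))) (at z)"
    by (rule has_derivative_transform_within_open[OF _ U_open z]) (simp add: F_inverse)
  then have BA: "(\<lambda>v. B *v (A *v v)) = (\<lambda>v. v)" by (rule has_derivative_unique[OF _ has_derivative_ident])
  have dA': "(F has_derivative (*v) A) (at (I.F (F z)))" using dA w(2) by simp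
  have "((\<lambda>x. F (I.F x)) has_derivative (\<lambda>v. A *v (B *v v))) (at (F z))"
    by (rule has_derivative_compose[OF dB dA'])
  then have "((\<lambda>x. x) has_derivative (\<lambda>v. A *v (B *v v))) (at (F z))"
    by (rule has_derivative_transform_within_open[OF _ I.U_open w(1)]) (simp add: FI)
  then have AB: "(\<lambda>v. A *v (B *v v)) = (\<lambda>v. v)" by (rule has_derivative_unique[OF _ has_derivative_ident])
  show ?thesis
    by (rule that[OF dA dB]) (use AB BA in \<open>simp_all add: matrix_eq matrix_vector_mul_assoc[symmetric] fun_eq_iff\<close>)
qed

text \<open>By \<open>image_volume\<close> and \<open>AE_U\<close>, the part of \<open>U\<close> that \<open>F\<close> maps into a small ball around \<open>F z\<close> has
exactly the mass of that ball with respect to the density \<open>|\<phi>\<^sub>0|\<^sup>p\<close>, so \<open>jacobian_le_density\<close> applies.\<close>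
lemma jacobian_le_\<phi>0:
  assumes z: "z \<in> U" shows "(cmod (holomorphic_jacobian F z))\<^sup>2 \<le> cmod (\<phi>0 z) powr p"
proof -
  interpret I: Ap_isometry p D2 D1 Tinv by (rule Ap_isometry_inverse)
  obtain A B where A: "(F has_derivative (*v) A) (at z)" and B: "(I.F has_derivative (*v) B) (at (F z))"
    and AB: "A ** B = mat 1" "B ** A = mat 1" using jacobian_matrices[OF z] by blast
  have zG: "z \<in> G" "z \<in> D1" using z U_sub G_sub by auto
  have FzD: "F z \<in> D2" using z by (simp add: U_def)
  obtain r0 where r0: "r0 > 0" "ball (F z) r0 \<subseteq> D2" using o2(1) FzD open_contains_ball by blast
  define P where "P = (\<lambda>r. U \<inter> F -` ball (F z) r)"
  have "(cmod (det A))\<^sup>2 \<le> cmod (\<phi>0 z) powr p"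
  proof (rule jacobian_le_density[where G = I.F and M = "(*v) B" and ?w0.0 = "F z" and ?r0.0 = r0 and P = P and h = "\<lambda>z. cmod (\<phi>0 z) powr p"])
    show "invertible A" using AB invertible_def by blast
    show "A *v (B *v v) = v" for v using AB by (simp add: matrix_vector_mul_assoc)
    show "I.F (F z) = z" by (rule F_inverse(2)[OF z])
    have "isCont \<phi>0 z" using holomorphic_cn_on_continuous[OF Ap_holomorphic[OF \<phi>0(1)]] zG(2) o1(1)
      by (simp add: continuous_on_eq_continuous_at)
    moreover have "cmod (\<phi>0 z) \<noteq> 0" using zG(1) by (simp add: G_def)
    ultimately show "isCont (\<lambda>z. cmod (\<phi>0 z) powr p) z" by (intro continuous_intros) auto
    show "\<exists>w\<in>ball (F z) r. x = I.F w" if "x \<in> P r" for x r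
      using that F_inverse(2) by (auto simp: P_def intro!: bexI[of _ "F x"])
    show "emeasure lborel (ball (F z) r) \<le> (\<integral>\<^sup>+x. indicator (P r) x * ennreal (cmod (\<phi>0 x) powr p) \<partial>lborel)" if "0 < r" "r < r0" for r
    proof -
      have "D2 \<inter> ball (F z) r = ball (F z) r" using r0(2) that by (auto simp: subset_eq)
      then have "emeasure lborel (ball (F z) r) = (\<integral>\<^sup>+x. ennreal (cmod (\<phi>0 x) powr p) * indicator (ball (F z) r) (F x) \<partial>lborel)"
        using image_volume[of "ball (F z) r"] by simp
      also have "\<dots> = (\<integral>\<^sup>+x. indicator (P r) x * ennreal (cmod (\<phi>0 x) powr p) \<partial>lborel)"
      proof (rule nn_integral_cong_AE)
        show "AE x in lborel. ennreal (cmod (\<phi>0 x) powr p) * indicator (ball (F z) r) (F x) = indicator (P r) x * ennreal (cmod (\<phi>0 x) powr p)"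
          using AE_U
        proof eventually_elim
          case (elim x)
          show ?case
          proof (cases "x \<in> G")
            case True
            then show ?thesis using elim by (simp add: P_def indicator_def)
          next
            case False
            then have "\<phi>0 x = 0" using Ap_outside[OF \<phi>0(1)] by (auto simp: G_def)
            then show ?thesis by simp
          qed
        qed
      qed
      finally show ?thesis by simp
    qed
  qed (use B r0(1) in auto)
  then show ?thesis using holomorphic_jacobian_eq[OF A] by simp
qed

text \<open>The reverse inequality is \<open>jacobian_le_\<phi>0\<close> for the inverse isometry at \<open>F z\<close>: Jacobians and
weights of mutually inverse maps are reciprocal.\<close>
lemma jacobian_eq_U:
  assumes z: "z \<in> U" shows "(cmod (holomorphic_jacobian F z))\<^sup>2 = cmod (\<phi>0 z) powr p"
proof (rule antisym[OF jacobian_le_\<phi>0[OF z]])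
  interpret I: Ap_isometry p D2 D1 Tinv by (rule Ap_isometry_inverse)
  obtain A B where A: "(F has_derivative (*v) A) (at z)" and B: "(I.F has_derivative (*v) B) (at (F z))"
    and AB: "A ** B = mat 1" "B ** A = mat 1" using jacobian_matrices[OF z] by blast
  have "det A * det B = 1" using AB(1) by (metis det_I det_mul)
  then have d: "(cmod (det A))\<^sup>2 * (cmod (det B))\<^sup>2 = 1" by (metis norm_mult norm_one power_mult_distrib power_one)
  have jA: "holomorphic_jacobian F z = det A" and jB: "holomorphic_jacobian I.F (F z) = det B"
    using holomorphic_jacobian_eq[OF A] holomorphic_jacobian_eq[OF B] by auto
  have "(cmod (det B))\<^sup>2 \<le> cmod (I.\<phi>0 (F z)) powr p"
    using I.jacobian_le_\<phi>0[OF F_inverse(3)[OF z]] jB by simp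
  also have "I.\<phi>0 (F z) = T (Ap_one D1) (F z)" unfolding I.\<phi>0_def using inverse_Tinv[OF one_in(1)] by simp
  finally have b: "(cmod (det B))\<^sup>2 \<le> cmod (T (Ap_one D1) (F z)) powr p" .
  have "cmod (\<phi>0 z) powr p * cmod (T (Ap_one D1) (F z)) powr p = 1"
    unfolding powr_mult[symmetric] norm_mult[symmetric] F_inverse(1)[OF z] by simp
  then have "cmod (\<phi>0 z) powr p * (cmod (det B))\<^sup>2 \<le> (cmod (det A))\<^sup>2 * (cmod (det B))\<^sup>2"
    unfolding d using mult_left_mono[OF b, of "cmod (\<phi>0 z) powr p"] by simp
  moreover have "(cmod (det B))\<^sup>2 > 0" using d by (cases "det B = 0") auto
  ultimately show "cmod (\<phi>0 z) powr p \<le> (cmod (holomorphic_jacobian F z))\<^sup>2"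
    unfolding jA by (rule mult_right_le_imp_le)
qed

lemma jacobian_eq_G:
  assumes z: "z \<in> G" shows "(cmod (holomorphic_jacobian F z))\<^sup>2 = cmod (\<phi>0 z) powr p"
proof -
  let ?g = "\<lambda>z. (cmod (holomorphic_jacobian F z))\<^sup>2 - cmod (\<phi>0 z) powr p"
  have "continuous_on G \<phi>0"
    using holomorphic_cn_on_continuous[OF Ap_holomorphic[OF \<phi>0(1)]] G_sub continuous_on_subset by blast
  then have "continuous_on G ?g"
    by (intro continuous_intros holomorphic_jacobian_continuous[OF F_holomorphic G_open]) (auto simp: G_def)
  moreover have "AE z in lborel. z \<in> G \<longrightarrow> ?g z = 0"
    using AE_U by eventually_elim (simp add: jacobian_eq_U)
  ultimately have "?g z = 0" using continuous_AE_zero_imp_zero[OF G_open _ _ z] by blast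
  then show ?thesis by simp
qed

text \<open>Suppose \<open>F z0\<close> lies outside \<open>D2\<close>. By \<open>jacobian_eq_G\<close> the map \<open>F\<close> has a holomorphic local inverse \<open>g\<close>
near \<open>z0\<close>, defined on an open set \<open>V0\<close>. The formula \<open>f = (Tinv f / \<phi>0) \<circ> g\<close>, valid on
\<open>D2 \<inter> V0\<close>, continues each \<open>f\<close> to \<open>D2 \<union> V0\<close>, and \<open>V0 - D2\<close> is the image of a null set.\<close>
lemma complete_imp_U_eq_G:
  assumes complete: "Ap_complete p D2" shows "U = G"
proof (rule ccontr)
  assume "U \<noteq> G"
  then obtain z0 where z0: "z0 \<in> G" "F z0 \<notin> D2" using U_sub by (auto simp: U_def)
  obtain F' where F': "\<And>z. z \<in> G \<Longrightarrow> (F has_derivative blinfun_apply (F' z)) (at z)" "continuous_on G F'"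
    "\<And>z c v. z \<in> G \<Longrightarrow> blinfun_apply (F' z) (c *s v) = c *s blinfun_apply (F' z) v"
    using holomorphic_map_C1[OF F_holomorphic G_open] by metis
  have lin: "linear (blinfun_apply b)" for b :: "(complex^'n) \<Rightarrow>\<^sub>L (complex^'n)"
    by (rule bounded_linear.linear[OF blinfun.bounded_linear_right])
  define A where "A = matrix (blinfun_apply (F' z0))"
  have A: "blinfun_apply (F' z0) = (*v) A" unfolding A_def by (rule complex_linear_matrix[OF lin F'(3)[OF z0(1)]])
  have "cmod (\<phi>0 z0) powr p > 0" using z0(1) by (simp add: G_def)
  then have "holomorphic_jacobian F z0 \<noteq> 0" using jacobian_eq_G[OF z0(1)] by auto
  then have "invertible A"
    using holomorphic_jacobian_eq[OF F'(1)[OF z0(1)]] by (simp add: A_def invertible_det_nz)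
  then obtain B where AB: "B ** A = mat 1" by (auto simp: invertible_def)
  have blB: "bounded_linear ((*v) B)" using linear_matrix_vector_mult_complex linear_conv_bounded_linear by blast
  have invf: "Blinfun ((*v) B) o\<^sub>L F' z0 = id_blinfun"
    by (rule blinfun_eqI) (simp add: bounded_linear_Blinfun_apply[OF blB] A matrix_vector_mul_assoc AB)
  obtain U' V g g' where IFT: "open U'" "U' \<subseteq> G" "z0 \<in> U'" "open V" "F z0 \<in> V" "homeomorphism U' V F g"
    "\<And>y. y \<in> V \<Longrightarrow> (g has_derivative (g' y)) (at y)"
    "\<And>y. y \<in> V \<Longrightarrow> g' y = inv (blinfun_apply (F' (g y)))"
    "\<And>y. y \<in> V \<Longrightarrow> bij (blinfun_apply (F' (g y)))"
    using inverse_function_theorem[OF G_open F'(1,2) z0(1) invf] by metis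
  have gF: "g (F z) = z" if "z \<in> U'" for z using IFT(6) that by (simp add: homeomorphism_def)
  have Fg: "F (g y) = y" "g y \<in> U'" if "y \<in> V" for y using IFT(6) that by (auto simp: homeomorphism_def)
  obtain \<delta> where \<delta>: "\<delta> > 0" "ball z0 \<delta> \<subseteq> U'" using IFT(1,3) open_contains_ball by blast
  define V0 where "V0 = F ` ball z0 \<delta>"
  have V0: "V0 = V \<inter> g -` ball z0 \<delta>"
  proof -
    have "F z \<in> V" if "z \<in> U'" for z using IFT(6) that by (auto simp: homeomorphism_def)
    then show ?thesis using \<delta>(2) gF Fg unfolding V0_def by (force simp: image_iff)
  qed
  have V0o: "open V0" unfolding V0
    using IFT(4,6) by (intro continuous_open_preimage) (auto simp: homeomorphism_def)
  have BG: "ball z0 \<delta> \<subseteq> G" using \<delta>(2) IFT(2) by blast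
  have V0c: "connected V0" unfolding V0_def
    by (intro connected_continuous_image continuous_on_subset[OF holomorphic_map_continuous[OF F_holomorphic] BG]) simp
  have FzV0: "F z0 \<in> V0" unfolding V0_def using \<delta>(1) by simp
  define E where "E = D2 \<union> V0"
  have "D2 \<inter> V0 \<noteq> {}"
    using F_closure[OF z0(1)] V0o FzV0 open_Int_closure_eq_empty[of V0 D2] by blast
  then have Edom: "open E" "connected E" unfolding E_def using o2 V0o V0c by (auto intro: connected_Un)
  have null: "E - D2 \<in> null_sets lborel"
  proof -
    let ?N = "ball z0 \<delta> - U"
    have "AE z in lborel. z \<notin> ?N" using AE_U by eventually_elim (use BG in auto)
    moreover have Nb: "?N \<in> sets borel" using U_open by auto
    ultimately have "?N \<in> null_sets lborel" by (subst AE_iff_null_sets) auto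
    then have "negligible ?N" using Nb by (simp add: negligible_iff_null_sets null_sets_completion_iff)
    moreover have "F differentiable_on ?N"
      using F'(1) BG unfolding differentiable_on_def differentiable_def
      by (meson Diff_iff has_derivative_at_withinI subsetD)
    ultimately have "negligible (F ` ?N)" by (intro negligible_differentiable_image_negligible) auto
    moreover have "E - D2 \<subseteq> F ` ?N" unfolding E_def V0_def using BG by (auto simp: U_def)
    ultimately have "negligible (E - D2)" by (rule negligible_subset)
    moreover have "E - D2 \<in> sets borel" using Edom(1) o2(1) by auto
    ultimately show ?thesis by (simp add: negligible_iff_null_sets null_sets_completion_iff)
  qed
  have "Ap_linear_isometry p E D2 (extend_zero D2)"
  proof (rule restriction_isometry[OF p(1) Edom o2(1,3) _ null])
    show "D2 \<subseteq> E" by (auto simp: E_def)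
    fix f assume f: "f \<in> Ap p D2"
    define q where "q = (\<lambda>z. Tinv f z / \<phi>0 z)"
    define h where "h = (\<lambda>w. if w \<in> D2 then f w else q (g w))"
    \<comment> \<open>On the overlap the new formula reproduces \<open>f\<close>, so the two pieces glue.\<close>
    have agree: "q (g w) = f w" if "w \<in> V0" "w \<in> D2" for w
    proof -
      have "g w \<in> U" "F (g w) = w" using that Fg[of w] IFT(2) unfolding V0 by (auto simp: U_def)
      then show ?thesis
        using T_weighted_composition[OF Tinv_in[OF f], of "g w"] T_Tinv[OF f] by (auto simp: q_def U_def G_def)
    qed
    have hq: "holomorphic_cn_on q G" unfolding q_def
      using holomorphic_cn_on_divide[OF holomorphic_cn_on_subset[OF Ap_holomorphic[OF Tinv_in[OF f]] G_sub] holomorphic_cn_on_subset[OF Ap_holomorphic[OF \<phi>0(1)] G_sub]]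
      by (simp add: G_def)
    have hqg: "holomorphic_cn_on (\<lambda>w. q (g w)) V0"
    proof (rule holomorphic_cn_onI)
      fix w assume "w \<in> V0"
      then have wV: "w \<in> V" "g w \<in> G" using V0 BG by auto
      obtain q' where q': "(q has_derivative q') (at (g w))" "\<And>c v. q' (c *s v) = c * q' v"
        using holomorphic_cn_onE[OF hq wV(2)] by metis
      have d: "((\<lambda>w. q (g w)) has_derivative (\<lambda>v. q' (g' w v))) (at w)"
        by (rule has_derivative_compose[OF IFT(7)[OF wV(1)] q'(1)])
      have "g' w (c *s v) = c *s g' w v" for c v
      proof -
        let ?L = "blinfun_apply (F' (g w))"
        have b: "bij ?L" by (rule IFT(9)[OF wV(1)])
        have "?L (c *s inv ?L v) = c *s v" using F'(3)[OF wV(2)] b by (simp add: bij_is_surj surj_f_inv_f)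
        then have "inv ?L (c *s v) = c *s inv ?L v" using b by (metis bij_is_inj inv_f_f)
        then show ?thesis unfolding IFT(8)[OF wV(1)] .
      qed
      then show "\<exists>f'. ((\<lambda>w. q (g w)) has_derivative f') (at w) \<and> (\<forall>c v. f' (c *s v) = c * f' v)"
        using d q'(2) by (intro exI[of _ "\<lambda>v. q' (g' w v)"]) simp
    qed
    have "holomorphic_cn_on h D2"
      by (rule holomorphic_cn_on_cong_open[OF Ap_holomorphic[OF f] o2(1)]) (simp add: h_def)
    moreover have "holomorphic_cn_on h V0"
      by (rule holomorphic_cn_on_cong_open[OF hqg V0o]) (simp add: h_def agree)
    ultimately have "holomorphic_cn_on h E" unfolding E_def by (rule holomorphic_cn_on_Un)
    then show "\<exists>g. holomorphic_cn_on g E \<and> (\<forall>z\<in>D2. g z = f z)" by (intro exI[of _ h]) (simp add: h_def)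
  qed
  moreover have "is_domain E" "D2 \<subset> E" using Edom o2(3) FzV0 z0(2) by (auto simp: is_domain_def E_def)
  ultimately show False using complete unfolding Ap_complete_def by blast
qed

text \<open>\<open>F\<close> is bounded because its values lie in the closure of \<open>D2\<close>.\<close>
lemma F_extends:
  obtains F1 where "holomorphic_extension F1 D1 F G"
proof -
  obtain w where w: "w \<in> D1" "\<phi>0 w \<noteq> 0" by (rule \<phi>0_nonzero)
  have "bounded (closure D2)" by (rule bounded_closure[OF D2(2)])
  then obtain C where C: "\<And>x. x \<in> closure D2 \<Longrightarrow> norm x \<le> C" unfolding bounded_iff by blast
  have eqG: "D1 - {z \<in> D1. \<phi>0 z = 0} = G" by (auto simp: G_def)
  have "\<forall>i. \<exists>H. holomorphic_cn_on H D1 \<and> (\<forall>z\<in>G. H z = F z $ i)"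
  proof
    fix i
    have 1: "holomorphic_cn_on (\<lambda>z. F z $ i) (D1 - {z \<in> D1. \<phi>0 z = 0})"
      unfolding eqG using F_holomorphic by (simp add: holomorphic_map_on_def)
    have 2: "cmod (F z $ i) \<le> C" if "z \<in> D1" "\<phi>0 z \<noteq> 0" for z
      using C[OF F_closure[of z]] that Finite_Cartesian_Product.norm_nth_le[of "F z" i] by (simp add: G_def)
    obtain H where "holomorphic_cn_on H D1" "\<And>z. z \<in> D1 \<Longrightarrow> \<phi>0 z \<noteq> 0 \<Longrightarrow> H z = F z $ i"
      using riemann_removable_hypersurface[OF o1(1,2) Ap_holomorphic[OF \<phi>0(1)] w 1 2] by blast
    then show "\<exists>H. holomorphic_cn_on H D1 \<and> (\<forall>z\<in>G. H z = F z $ i)" by (auto simp: G_def)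
  qed
  then obtain H where H: "\<And>i. holomorphic_cn_on (H i) D1" "\<And>i z. z \<in> G \<Longrightarrow> H i z = F z $ i" by metis
  have "holomorphic_extension (\<lambda>z. \<chi> i. H i z) D1 F G"
    using H by (simp add: holomorphic_extension_def holomorphic_map_on_def vec_eq_iff)
  then show ?thesis using that by blast
qed

text \<open>Both claims extend identities from the dense set \<open>G\<close> by continuity: the Jacobian formula, and
\<open>1 = \<phi>0 \<cdot> (T 1 \<circ> F)\<close>, which rules out that \<open>F1\<close> maps a zero of \<open>\<phi>0\<close> into \<open>D2\<close>.\<close>
lemma extension_properties:
  assumes F1: "holomorphic_extension F1 D1 F G"
  shows "z \<in> D1 \<Longrightarrow> norm (holomorphic_jacobian F1 z) powr (2 / p) = norm (\<phi>0 z)"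
    and "z \<in> D1 \<Longrightarrow> \<phi>0 z = 0 \<Longrightarrow> F1 z \<in> frontier D2"
proof -
  obtain w where w: "w \<in> D1" "\<phi>0 w \<noteq> 0" by (rule \<phi>0_nonzero)
  note eq = eq_off_zeros[OF o1(1,2) Ap_holomorphic[OF \<phi>0(1)] w]
  have hF1: "holomorphic_map_on F1 D1" and F1F: "\<And>z. z \<in> G \<Longrightarrow> F1 z = F z"
    using F1 by (auto simp: holomorphic_extension_def)
  have c0: "continuous_on D1 \<phi>0" by (rule holomorphic_cn_on_continuous[OF Ap_holomorphic[OF \<phi>0(1)]])
  have cF1: "continuous_on D1 F1" by (rule holomorphic_map_continuous[OF hF1])
  show "norm (holomorphic_jacobian F1 z) powr (2 / p) = norm (\<phi>0 z)" if z: "z \<in> D1"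
  proof -
    have "norm (holomorphic_jacobian F1 z) powr (2 / p) = norm (\<phi>0 z)"
    proof (rule eq[of D1 "\<lambda>z. norm (holomorphic_jacobian F1 z) powr (2 / p)" "\<lambda>z. norm (\<phi>0 z)"])
      show "continuous_on D1 (\<lambda>z. norm (holomorphic_jacobian F1 z) powr (2 / p))"
        using p(1) by (intro continuous_on_powr' continuous_intros holomorphic_jacobian_continuous[OF hF1 o1(1)]) auto
      show "continuous_on D1 (\<lambda>z. norm (\<phi>0 z))" by (intro continuous_intros c0)
      fix y assume "y \<in> D1" "\<phi>0 y \<noteq> 0"
      then have y: "y \<in> G" by (simp add: G_def)
      have d: "\<exists>H'. (F has_derivative H') (at y)"
        using holomorphic_map_C1[OF F_holomorphic G_open] y by metis
      then have j: "holomorphic_jacobian F1 y = holomorphic_jacobian F y"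
        using holomorphic_map_eq_jacobian[OF G_open y, of F1 F] F1F by blast
      have "norm (holomorphic_jacobian F y) powr (2 / p) = ((norm (holomorphic_jacobian F y))\<^sup>2) powr (1 / p)"
      proof (cases "holomorphic_jacobian F y = 0")
        case False
        then have sq: "(norm (holomorphic_jacobian F y))\<^sup>2 = norm (holomorphic_jacobian F y) powr 2" by simp
        show ?thesis unfolding sq powr_powr by simp
      qed simp
      also have "\<dots> = norm (\<phi>0 y)" unfolding jacobian_eq_G[OF y] using p(1) by (simp add: powr_powr)
      finally show "norm (holomorphic_jacobian F1 y) powr (2 / p) = norm (\<phi>0 y)" by (simp add: j)
    qed (use o1 z in auto)
    then show ?thesis .
  qed
  show "F1 z \<in> frontier D2" if z: "z \<in> D1" "\<phi>0 z = 0"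
  proof -
    have "F1 z \<in> closure D2"
    proof (rule ccontr)
      assume n: "F1 z \<notin> closure D2"
      have "open (D1 \<inter> F1 -` (- closure D2))"
        by (rule continuous_open_preimage[OF cF1 o1(1)]) (simp add: open_Compl)
      then obtain b where "b \<in> (D1 \<inter> F1 -` (- closure D2)) \<inter> D1" "\<phi>0 b \<noteq> 0"
        using nonzero_point_nearby[OF Ap_holomorphic[OF \<phi>0(1)] o1(1,2) w, of "D1 \<inter> F1 -` (- closure D2)" z] n z by blast
      then show False using F_closure[of b] F1F[of b] by (auto simp: G_def)
    qed
    moreover have "F1 z \<notin> D2"
    proof
      assume F1z: "F1 z \<in> D2"
      let ?V = "D1 \<inter> F1 -` D2"
      have "(\<lambda>_. 1) z = \<phi>0 z * T (Ap_one D1) (F1 z)"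
      proof (rule eq[of ?V "\<lambda>_. 1" "\<lambda>z. \<phi>0 z * T (Ap_one D1) (F1 z)"])
        show "open ?V" by (rule continuous_open_preimage[OF cF1 o1(1) o2(1)])
        have "continuous_on ?V (\<lambda>z. T (Ap_one D1) (F1 z))"
          by (rule continuous_on_compose2[OF holomorphic_cn_on_continuous[OF Ap_holomorphic[OF T_in[OF one_in(1)]]] continuous_on_subset[OF cF1]]) auto
        then show "continuous_on ?V (\<lambda>z. \<phi>0 z * T (Ap_one D1) (F1 z))"
          using c0 by (intro continuous_intros) (auto intro: continuous_on_subset)
        fix y assume y: "y \<in> ?V" "\<phi>0 y \<noteq> 0"
        then have "y \<in> U" using F1F[of y] by (simp add: U_def G_def)
        then have "\<phi>0 y * T (Ap_one D1) (F y) = 1" by (rule F_inverse(1))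
        then show "1 = \<phi>0 y * T (Ap_one D1) (F1 y)" using F1F[of y] y by (simp add: G_def)
      qed (use F1z z in auto)
      then show False using z(2) by simp
    qed
    ultimately show ?thesis using o2(1) by (simp add: frontier_def interior_open)
  qed
qed
end

theorem theorem4p2:
  fixes p :: real
    and D1 D2 :: "(complex^'n) set"
    and T :: "(complex^'n \<Rightarrow> complex) \<Rightarrow> (complex^'n \<Rightarrow> complex)"
  assumes "p > 0" and "\<not> (\<exists>k::int. p = 2 * of_int k)"
    and "is_domain D1" and "bounded D1" and "Ap_complete p D1"
    and "is_domain D2" and "bounded D2" and "Ap_complete p D2"
    and "Ap_linear_isometry p D1 D2 T"
    and "\<phi>0 = inv_into (Ap p D1) T (Ap_one D2)"
    and "A1 = {z \<in> D1. \<phi>0 z = 0}"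
    and "A2 = {w \<in> D2. T (Ap_one D1) w = 0}"
    and "F = assoc_map p D1 D2 T"
  shows
    "assoc_source p D1 D2 T = D1 - A1 \<and> assoc_target p D1 D2 T = D2 - A2
     \<and> biholomorphic_map F (D1 - A1) (D2 - A2)
     \<and> (\<exists>F1. holomorphic_extension F1 D1 F (D1 - A1))
     \<and> (\<exists>F2. holomorphic_extension F2 D2 (inv_into (D1 - A1) F) (D2 - A2))
     \<and> (\<forall>F1 F2. holomorphic_extension F1 D1 F (D1 - A1)
           \<and> holomorphic_extension F2 D2 (inv_into (D1 - A1) F) (D2 - A2) \<longrightarrow>
         (\<forall>z\<in>D1. norm (holomorphic_jacobian F1 z) powr (2 / p) = norm (\<phi>0 z))
         \<and> (\<forall>w\<in>D2. norm (holomorphic_jacobian F2 w) powr (2 / p) = norm (T (Ap_one D1) w))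
         \<and> F1 ` A1 \<subseteq> frontier D2 \<and> F2 ` A2 \<subseteq> frontier D1)"
proof -
  interpret L: Ap_isometry p D1 D2 T using assms by unfold_locales
  interpret I: Ap_isometry p D2 D1 L.Tinv by (rule L.Ap_isometry_inverse)
  have \<phi>0: "\<phi>0 = L.\<phi>0" using assms(10) by (simp add: L.\<phi>0_def L.Tinv_def)
  have I\<phi>0: "I.\<phi>0 = T (Ap_one D1)" unfolding I.\<phi>0_def by (rule L.inverse_Tinv[OF L.one_in(1)])
  have G1: "D1 - A1 = L.G" using assms(11) \<phi>0 by (auto simp: L.G_def)
  have G2: "D2 - A2 = I.G" using assms(12) I\<phi>0 by (auto simp: I.G_def)
  have UG1: "L.U = L.G" by (rule L.complete_imp_U_eq_G[OF assms(8)])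
  have UG2: "I.U = I.G" by (rule I.complete_imp_U_eq_G[OF assms(5)])
  have FF: "F z = L.F z" if "z \<in> L.G" for z using L.assoc_map_eq that UG1 assms(13) by simp
  have to2: "L.F z \<in> I.G" "I.F (L.F z) = z" if "z \<in> L.G" for z
    using L.F_inverse(2,3) that UG1 UG2 by auto
  have to1: "I.F w \<in> L.G" "L.F (I.F w) = w" if "w \<in> I.G" for w
    using L.F_section that UG1 UG2 by auto
  have bij: "bij_betw F L.G I.G"
    by (rule bij_betw_byWitness[where f' = I.F]) (use FF to1 to2 in auto)
  have inv: "inv_into L.G F w = I.F w" if w: "w \<in> I.G" for w
    using bij_betw_inv_into_left[OF bij to1(1)[OF w]] FF[OF to1(1)[OF w]] to1(2)[OF w] by simp
  have source: "assoc_source p D1 D2 T = L.G" using L.assoc_source_eq UG1 by simp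
  have target: "assoc_target p D1 D2 T = I.G"
    using assoc_map_bij[OF L.o1(1) assms(4) L.o2(1) assms(7,1,9)] bij source assms(13)
    by (simp add: bij_betw_def)
  have cong: "holomorphic_map_on H' S" if "holomorphic_map_on H S" "open S" "\<And>z. z \<in> S \<Longrightarrow> H' z = H z" for H H' S
    using that holomorphic_cn_on_cong_open unfolding holomorphic_map_on_def by (metis (no_types, lifting))
  have hol: "holomorphic_map_on F L.G" "holomorphic_map_on (inv_into L.G F) I.G"
    using cong[OF L.F_holomorphic L.G_open FF] cong[OF I.F_holomorphic I.G_open inv] by auto
  have ext1: "holomorphic_extension H D1 F L.G \<longleftrightarrow> holomorphic_extension H D1 L.F L.G" for H
    using FF by (simp add: holomorphic_extension_def)
  have ext2: "holomorphic_extension H D2 (inv_into L.G F) I.G \<longleftrightarrow> holomorphic_extension H D2 I.F I.G" for H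
    using inv by (simp add: holomorphic_extension_def)
  show ?thesis
    unfolding G1 G2 biholomorphic_map_def ext1 ext2
  proof (intro conjI allI impI ballI)
    show "\<exists>F1. holomorphic_extension F1 D1 L.F L.G" using L.F_extends by blast
    show "\<exists>F2. holomorphic_extension F2 D2 I.F I.G" using I.F_extends by blast
    fix F1 F2 assume h: "holomorphic_extension F1 D1 L.F L.G \<and> holomorphic_extension F2 D2 I.F I.G"
    show "norm (holomorphic_jacobian F1 z) powr (2 / p) = norm (\<phi>0 z)" if "z \<in> D1" for z
      using L.extension_properties(1)[of F1 z] h that \<phi>0 by blast
    show "norm (holomorphic_jacobian F2 w) powr (2 / p) = norm (T (Ap_one D1) w)" if "w \<in> D2" for w
      using I.extension_properties(1)[of F2 w] h that I\<phi>0 by metis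
    show "F1 ` A1 \<subseteq> frontier D2" using L.extension_properties(2)[of F1] h assms(11) \<phi>0 by auto
    show "F2 ` A2 \<subseteq> frontier D1" using I.extension_properties(2)[of F2] h assms(12) I\<phi>0 by auto
  qed (use source target bij hol in auto)
qed

end
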